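(* The Hawaiian Pants $\mathbb{P}$ is 1-UV$_0$.
   Context: The Hawaiian Pants $\mathbb{P}$: For $n\in\mathbb{N}=\{1,2,\dots\}$ let $C_n\subseteq \mathbb{R}^2$ be the circle of radius $\frac{1}{n}$ centered at $(\frac{1}{n},0)$, and let $\mathbb{H}=\bigcup_{i=1}^\infty C_i\subseteq\mathbb{R}^2$ (subspace topology) be the Hawaiian Earring, with basepoint $b_0=(0,0)$. Define $\ell_n:[0,1]\rightarrow C_n$ by $\ell_n(t)=(\frac{1}{n}(1-\cos 2\pi t),\frac{1}{n}\sin 2\pi t)$. For each $n$, let $D_{n,1},D_{n,2}$ be disjoint closed disks in the interior $D_n^\circ$ of a closed disk $D_n\subseteq\mathbb{R}^2$ and let $P_n=D_n\setminus(D_{n,1}^\circ\cup D_{n,2}^\circ)$ (a "pair of pants"). Let $\alpha_n,\beta_n,\gamma_n:[0,1]\rightarrow P_n$ be parametrizations (as simple closed curves) of the boundaries $\partial D_n,\partial D_{n,1},\partial D_{n,2}$, respectively, with clockwise orientation. Let $f_n:\partial P_n\rightarrow\mathbb{H}$ be the map with $f_n\circ\alpha_n=\ell_n$, $f_n\circ\beta_n=\ell_{2n}$, $f_n\circ\gamma_n=\ell_{2n+1}$, and let $f:\coprod_n\partial P_n\rightarrow\mathbb{H}$ be given by $f|_{\partial P_n}=f_n$. Then $\mathbb{P}=\mathbb{H}\cup_f\left(\coprod_{n\in\mathbb{N}}P_n\right)$ is the adjunction space (quotient topology). A space $X$ is 1-UV$_0$ at $x\in X$ if for every neighborhood $U$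 of $x$ in $X$ there is an open subset $V$ of $X$ with $x\in V\subseteq U$ such that for every map $f:D^2\rightarrow X$ from the closed unit disk with $f(S^1)\subseteq V$ there is a map $g:D^2\rightarrow U$ with $f|_{S^1}=g|_{S^1}$. The space $X$ is 1-UV$_0$ if it is 1-UV$_0$ at every point $x\in X$. (Map means continuous map.) *)

theory Defs
  imports "HOL-Complex_Analysis.Winding_Numbers"
begin

section \<open>Quotient topologies and adjunction spaces\<close>

definition quotient_topology :: "'a topology \<Rightarrow> 'a rel \<Rightarrow> 'a set topology" where
  "quotient_topology X r =
     topology (\<lambda>U. U \<subseteq> topspace X // r \<and> openin X {x \<in> topspace X. r `` {x} \<in> U})"

lemma openin_quotient_topology:
  "openin (quotient_topology X r) U \<longleftrightarrow>
     U \<subseteq> topspace X // r \<and> openin X {x \<in> topspace X. r `` {x} \<in> U}"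
proof -
  have inter: "{x \<in> topspace X. r `` {x} \<in> S \<inter> T} =
      {x \<in> topspace X. r `` {x} \<in> S} \<inter> {x \<in> topspace X. r `` {x} \<in> T}" for S T
    by auto
  have union: "{x \<in> topspace X. r `` {x} \<in> \<Union>\<K>} =
      (\<Union>K\<in>\<K>. {x \<in> topspace X. r `` {x} \<in> K})" for \<K>
    by auto
  have "istopology (\<lambda>U. U \<subseteq> topspace X // r \<and> openin X {x \<in> topspace X. r `` {x} \<in> U})"
    unfolding istopology_def inter union by blast
  then show ?thesis
    by (simp add: quotient_topology_def)
qed

lemma topspace_quotient_topology [simp]:
  "topspace (quotient_topology X r) = topspace X // r"
proof -
  have "{x \<in> topspace X. r `` {x} \<in> topspace X // r} = topspace X"
    by (auto simp: quotient_def)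
  then have "openin (quotient_topology X r) (topspace X // r)"
    by (simp add: openin_quotient_topology)
  then show ?thesis
    by (meson openin_quotient_topology openin_subset openin_topspace subset_antisym)
qed

lemma quotient_map_quotient_topology:
  "quotient_map X (quotient_topology X r) (\<lambda>x. r `` {x})"
  by (auto simp: quotient_map_def openin_quotient_topology quotient_def)

definition binary_sum_topology :: "'a topology \<Rightarrow> 'b topology \<Rightarrow> ('a + 'b) topology" where
  "binary_sum_topology X Y =
     topology (\<lambda>U. openin X (Inl -` U) \<and> openin Y (Inr -` U))"

lemma openin_binary_sum_topology:
  "openin (binary_sum_topology X Y) U \<longleftrightarrow> openin X (Inl -` U) \<and> openin Y (Inr -` U)"
proof -
  have "istopology (\<lambda>U. openin X (Inl -` U) \<and> openin Y (Inr -` U))"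
    unfolding istopology_def vimage_Int vimage_Union by blast
  then show ?thesis
    by (simp add: binary_sum_topology_def)
qed

lemma topspace_binary_sum_topology [simp]:
  "topspace (binary_sum_topology X Y) = topspace X <+> topspace Y"
proof (rule antisym)
  show "topspace (binary_sum_topology X Y) \<subseteq> topspace X <+> topspace Y"
  proof
    fix z assume z: "z \<in> topspace (binary_sum_topology X Y)"
    have "openin X (Inl -` topspace (binary_sum_topology X Y))"
      "openin Y (Inr -` topspace (binary_sum_topology X Y))"
      using openin_binary_sum_topology openin_topspace by blast+
    with z show "z \<in> topspace X <+> topspace Y"
      by (cases z) (use openin_subset in fastforce)+
  qed
  have "Inl -` (topspace X <+> topspace Y) = topspace X"
    "Inr -` (topspace X <+> topspace Y) = topspace Y"
    by auto
  then show "topspace X <+> topspace Y \<subseteq> topspace (binary_sum_topology X Y)"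
    by (intro openin_subset) (simp add: openin_binary_sum_topology)
qed

text \<open>
  The space obtained from the disjoint union of \<open>X\<close> and \<open>Y\<close> by gluing each point \<open>y\<close> of \<open>A\<close>
  (a subset of \<open>Y\<close>) to \<open>f y\<close> in \<open>X\<close>. Its points are the classes of the equivalence relation
  generated by these identifications.
\<close>

definition adjunction_space ::
    "'a topology \<Rightarrow> 'b topology \<Rightarrow> 'b set \<Rightarrow> ('b \<Rightarrow> 'a) \<Rightarrow> ('a + 'b) set topology" where
  "adjunction_space X Y A f =
     (let r = {(Inr y, Inl (f y)) |y. y \<in> A}
      in quotient_topology (binary_sum_topology X Y) ((r \<union> r\<inverse>)\<^sup>*))"


section \<open>The Hawaiian Earring and the Hawaiian Pants\<close>

text \<open>The plane is identified with the complex numbers.\<close>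

definition hawaiian_circle :: "nat \<Rightarrow> complex set" where
  "hawaiian_circle n = sphere (Complex (1 / real n) 0) (1 / real n)"

definition hawaiian_earring :: "complex set" where
  "hawaiian_earring = (\<Union>n\<in>{1..}. hawaiian_circle n)"

definition hawaiian_loop :: "nat \<Rightarrow> real \<Rightarrow> complex" where
  "hawaiian_loop n t =
     Complex (1 / real n * (1 - cos (2 * pi * t))) (1 / real n * sin (2 * pi * t))"

definition closed_disk :: "complex set \<Rightarrow> bool" where
  "closed_disk D \<longleftrightarrow> (\<exists>c r. 0 < r \<and> D = cball c r)"

definition clockwise_boundary :: "complex set \<Rightarrow> (real \<Rightarrow> complex) \<Rightarrow> bool" where
  "clockwise_boundary D p \<longleftrightarrow>
     simple_path p \<and> pathfinish p = pathstart p \<and> path_image p = frontier D \<and>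
     (\<forall>z\<in>interior D. winding_number p z = -1)"

definition pair_of_pants :: "complex set \<Rightarrow> complex set \<Rightarrow> complex set \<Rightarrow> complex set" where
  "pair_of_pants D D1 D2 = D - (interior D1 \<union> interior D2)"

text \<open>
  The frontier of \<open>P n\<close> in the plane is its boundary as a surface, that is, the union of the
  three boundary circles.
\<close>

definition hawaiian_pants ::
    "(nat \<Rightarrow> complex set) \<Rightarrow> (nat \<Rightarrow> complex \<Rightarrow> complex) \<Rightarrow> (complex + nat \<times> complex) set topology"
  where
  "hawaiian_pants P f =
     adjunction_space (top_of_set hawaiian_earring)
       (sum_topology (\<lambda>n. top_of_set (P n)) {1..})
       (SIGMA n:{1..}. frontier (P n)) (\<lambda>(n, z). f n z)"


section \<open>The property 1-UV0\<close>

text \<open>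
  A neighborhood \<open>U\<close> need not be open.
\<close>

definition one_UV0_at :: "'a topology \<Rightarrow> 'a \<Rightarrow> bool" where
  "one_UV0_at X x \<longleftrightarrow>
     (\<forall>U. U \<subseteq> topspace X \<and> (\<exists>W. openin X W \<and> x \<in> W \<and> W \<subseteq> U) \<longrightarrow>
        (\<exists>V. openin X V \<and> x \<in> V \<and> V \<subseteq> U \<and>
           (\<forall>f. continuous_map (top_of_set (cball (0::complex) 1)) X f \<and> f ` sphere 0 1 \<subseteq> V \<longrightarrow>
              (\<exists>g. continuous_map (top_of_set (cball 0 1)) (subtopology X U) g \<and>
                   (\<forall>z\<in>sphere 0 1. f z = g z)))))"

definition one_UV0 :: "'a topology \<Rightarrow> bool" where
  "one_UV0 X \<longleftrightarrow> (\<forall>x\<in>topspace X. one_UV0_at X x)"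

end

theory Submission
  imports Defs
begin

text \<open>
  Give the \<open>m\<close>-th circle of the earring height \<open>m\<close>, extend the heights to the pants, and pull the
  covering \<open>t \<mapsto> exp (2\<pi>\<i>t)\<close> of the unit circle back along the height modulo \<open>1\<close>. The pullback
  contains a copy of the earring for each integer \<open>i\<close> (a sheet), and a copy of the \<open>n\<close>-th pair of
  pants for each integer \<open>p\<close>; the latter joins the copies of the circles \<open>m = n, 2n, 2n+1\<close> on the
  sheets \<open>m - p\<close>. The copies with the same \<open>p\<close> form a binary tree of circles, and since
  all heights are different, each tree meets the sheet \<open>0\<close> in at most one circle, namely the \<open>p\<close>-th.
  Sending each circle of the tree to a power of the \<open>p\<close>-th loop, where the exponents form a flow
  of value \<open>1\<close> through the \<open>p\<close>-th circle, extends over all pants by degree theory for maps to a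
  circle. So the pullback retracts onto the sheet \<open>0\<close>.

  A map of the disk into the Hawaiian Pants lifts to the pullback because its height modulo \<open>1\<close> has a
  continuous logarithm. If its boundary lies near a point of the earring, the lifted disk followed by
  the retraction, which is adjusted to be the identity near that point, fills the boundary within a
  prescribed neighbourhood.
\<close>

section \<open>The Hawaiian Earring\<close>

text \<open>A disk with small boundary may run through infinitely many pants far away, and no
  retraction of the Hawaiian Pants onto the earring can pull it back: it would make the class of the
  first loop the sum of the classes of the second and third in the homology of the earring, which is
  refuted by collapsing all circles but the first. In the pullback only one circle of each tree has
  a prescribed image. The others are free, and as the whole tree goes to a single circle, only
  degrees have to add up over each pair of pants. Trees with \<open>p \<le> 0\<close> do not meet
  the sheet \<open>0\<close> and are collapsed to the basepoint.

  The flow has values in \<open>{-1, 0, 1}\<close>, and on the sheet \<open>i\<close> the circle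
  \<open>m\<close> goes to the circle \<open>m - i\<close>, of comparable size for fixed
  \<open>i\<close>. This gives continuity at the basepoint of each sheet, where infinitely many
  trees meet.

  The pullback is never built as a space. For a disk \<open>u\<close> with real angle
  \<open>l\<close>, the pair of \<open>u z\<close> and \<open>l z\<close> is the lifted point. The
  disk is cut into open pieces on which the sheet or the tree is constant, and the retraction is
  pasted from maps on these pieces.\<close>

lemma hawaiian_circle_iff_unit:
  assumes "m \<ge> 1"
  shows "z \<in> hawaiian_circle m \<longleftrightarrow> norm (1 - of_nat m * z) = 1"
proof -
  have c: "Complex (1 / real m) 0 = 1 / of_nat m"
    by (simp add: complex_eq_iff Re_divide_of_nat Im_divide_of_nat)
  have "1 - of_nat m * z = of_nat m * (1 / of_nat m - z)"
    using assms by (simp add: field_simps)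
  then have "norm (1 - of_nat m * z) = real m * norm (1 / of_nat m - z)"
    by (simp add: norm_mult)
  then show ?thesis
    using assms by (simp add: hawaiian_circle_def c dist_norm field_simps)
qed

lemma unit_point_in_hawaiian_circle:
  assumes "m \<ge> 1" "norm w = 1"
  shows "(1 - w) / of_nat m \<in> hawaiian_circle m"
  using assms by (simp add: hawaiian_circle_iff_unit)

lemma zero_in_hawaiian_circle: "m \<ge> 1 \<Longrightarrow> 0 \<in> hawaiian_circle m"
  by (simp add: hawaiian_circle_iff_unit)

lemma zero_in_hawaiian_earring: "0 \<in> hawaiian_earring"
  using zero_in_hawaiian_circle[of 1] by (auto simp: hawaiian_earring_def)

lemma hawaiian_circle_subset: "m \<ge> 1 \<Longrightarrow> hawaiian_circle m \<subseteq> hawaiian_earring"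
  by (auto simp: hawaiian_earring_def)

lemma hawaiian_earringE:
  assumes "z \<in> hawaiian_earring"
  obtains m where "m \<ge> 1" "z \<in> hawaiian_circle m"
  using assms by (auto simp: hawaiian_earring_def)

lemma norm_le_on_hawaiian_circle:
  assumes "m \<ge> 1" "z \<in> hawaiian_circle m"
  shows "norm z \<le> 2 / real m"
proof -
  have "real m * norm z = norm (1 - (1 - of_nat m * z))" by (simp add: norm_mult)
  also have "\<dots> \<le> norm (1::complex) + norm (1 - of_nat m * z)" by (rule norm_triangle_ineq4)
  also have "\<dots> = 2" using assms by (simp add: hawaiian_circle_iff_unit)
  finally show ?thesis using assms by (simp add: field_simps)
qed

text \<open>Inversion turns the circles, which all pass through the origin, into the vertical lines
  with real part \<open>m / 2\<close>. These are disjoint, so two circles meet only at the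
  basepoint.\<close>

lemma hawaiian_circle_iff_Re_inverse:
  assumes "m \<ge> 1" "z \<noteq> 0"
  shows "z \<in> hawaiian_circle m \<longleftrightarrow> 2 * Re (1 / z) = real m"
proof -
  define a where "a = (Re z)\<^sup>2 + (Im z)\<^sup>2"
  have a: "a > 0" using assms(2) by (simp add: a_def sum_power2_gt_zero_iff complex_eq_iff)
  have "Re (1 / z) = Re z / a" by (simp add: Re_divide a_def)
  moreover have "(norm (1 - of_nat m * z))\<^sup>2 = 1 + real m * (real m * a - 2 * Re z)"
    unfolding cmod_power2 a_def by (simp add: power2_eq_square algebra_simps)
  moreover have "norm (1 - of_nat m * z) = 1 \<longleftrightarrow> (norm (1 - of_nat m * z))\<^sup>2 = 1"
    using power2_eq_iff_nonneg[of "norm (1 - of_nat m * z)" 1] by simp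
  ultimately have "norm (1 - of_nat m * z) = 1 \<longleftrightarrow> 2 * Re (1 / z) = real m"
    using assms(1) a by (auto simp: divide_eq_eq)
  then show ?thesis using assms by (simp add: hawaiian_circle_iff_unit)
qed

lemma hawaiian_circle_unique:
  assumes "m \<ge> 1" "m' \<ge> 1" "z \<in> hawaiian_circle m" "z \<in> hawaiian_circle m'" "z \<noteq> 0"
  shows "m = m'"
  using assms by (simp add: hawaiian_circle_iff_Re_inverse)

lemma hawaiian_loop_eq:
  "hawaiian_loop m t = (1 - exp (- (2 * pi * t) * \<i>)) / of_nat m"
proof -
  have "exp (- (2 * pi * t) * \<i>) = cis (- (2 * pi * t))"
    by (simp add: cis_conv_exp mult.commute)
  also have "\<dots> = Complex (cos (2 * pi * t)) (- sin (2 * pi * t))"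
    by (simp add: complex_eq_iff)
  finally show ?thesis
    by (simp add: hawaiian_loop_def complex_eq_iff Re_divide_of_nat Im_divide_of_nat)
qed

lemma hawaiian_loop_image:
  assumes "m \<ge> 1"
  shows "hawaiian_loop m ` {0..1} = hawaiian_circle m"
proof
  show "hawaiian_loop m ` {0..1} \<subseteq> hawaiian_circle m"
    using assms by (auto simp: hawaiian_loop_eq hawaiian_circle_iff_unit)
next
  show "hawaiian_circle m \<subseteq> hawaiian_loop m ` {0..1}"
  proof
    fix z assume z: "z \<in> hawaiian_circle m"
    \<comment> \<open>The loops run clockwise; after conjugation the angle \<open>Arg2pi w\<close>
      is the parameter times \<open>2 * pi\<close>.\<close>
    define w where "w = cnj (1 - of_nat m * z)"
    have "norm w = 1" using z assms by (simp add: w_def hawaiian_circle_iff_unit del: complex_cnj_diff)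
    define t where "t = Arg2pi w"
    have t: "0 \<le> t" "t < 2 * pi" "w = exp (\<i> * of_real t)"
      using Arg2pi[of w] \<open>norm w = 1\<close> by (auto simp: t_def is_Arg_def)
    define s where "s = t / (2 * pi)"
    have s: "s \<in> {0..1}" "2 * pi * s = t" using t by (auto simp: s_def field_simps)
    have "exp (- (2 * pi * s) * \<i>) = exp (cnj (\<i> * of_real t))"
      by (simp add: mult.commute flip: s(2))
    also have "\<dots> = cnj w" by (simp add: t(3) exp_cnj)
    finally have "z = hawaiian_loop m s"
      using assms by (simp add: hawaiian_loop_eq w_def)
    with s show "z \<in> hawaiian_loop m ` {0..1}" by blast
  qed
qed

lemma hawaiian_loop_eq_iff:
  assumes "m \<ge> 1" "s \<in> {0..1}" "t \<in> {0..1}" "hawaiian_loop m s = hawaiian_loop m t"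
  shows "s = t \<or> s = 0 \<and> t = 1 \<or> s = 1 \<and> t = 0"
proof -
  have "exp (- (2 * pi * s) * \<i>) = exp (- (2 * pi * t) * \<i>)"
    using assms by (simp add: hawaiian_loop_eq)
  then obtain k :: int where k: "- (2 * pi * s) * \<i> = - (2 * pi * t) * \<i> + (of_int (2 * k) * pi) * \<i>"
    by (auto simp: exp_eq)
  then have "- (2 * pi * s) = - (2 * pi * t) + 2 * real_of_int k * pi"
    by (simp add: complex_eq_iff)
  then have "pi * (t - s) = pi * real_of_int k" by (simp add: algebra_simps)
  then have k': "t - s = real_of_int k" by simp
  have "k \<ge> -1" "k \<le> 1" using k' assms(2,3) by auto
  then have "k = -1 \<or> k = 0 \<or> k = 1" by linarith
  then show ?thesis using k' assms(2,3) by auto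
qed

text \<open>The circle through a nonzero point is read off from the real part of its reciprocal, so
  away from the basepoint the circles are separated.\<close>

lemma hawaiian_earring_locally_circle:
  assumes "z \<in> hawaiian_circle m" "z \<noteq> 0" "m \<ge> 1"
  obtains S where "open S" "z \<in> S" "S \<inter> hawaiian_earring \<subseteq> hawaiian_circle m - {0}"
proof -
  have o: "openin (top_of_set (- {0})) ((- {0}) \<inter> (\<lambda>z. 2 * Re (1 / z)) -` ball (real m) (1/2))"
    by (intro continuous_openin_preimage_gen continuous_intros) auto
  then have "open ((- {0}) \<inter> (\<lambda>z. 2 * Re (1 / z)) -` ball (real m) (1/2))"
    by (subst (asm) openin_open_eq) auto
  moreover have "z \<in> (- {0}) \<inter> (\<lambda>z. 2 * Re (1 / z)) -` ball (real m) (1/2)"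
    using assms hawaiian_circle_iff_Re_inverse[of m z] by simp
  moreover have "((- {0}) \<inter> (\<lambda>z. 2 * Re (1 / z)) -` ball (real m) (1/2)) \<inter> hawaiian_earring
      \<subseteq> hawaiian_circle m - {0}"
  proof
    fix y assume y: "y \<in> ((- {0}) \<inter> (\<lambda>z. 2 * Re (1 / z)) -` ball (real m) (1/2)) \<inter> hawaiian_earring"
    then obtain j where j: "j \<ge> 1" "y \<in> hawaiian_circle j" by (auto simp: hawaiian_earring_def)
    have "\<bar>real m - real j\<bar> < 1/2"
      using y j hawaiian_circle_iff_Re_inverse[of j y] by (simp add: dist_real_def)
    then have "j = m" by linarith
    with y j show "y \<in> hawaiian_circle m - {0}" by auto
  qed
  ultimately show ?thesis using that by blast
qed

text \<open>Away from the basepoint the earring is locally a single circle. At the basepoint the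
  assumption \<open>small\<close> controls all but finitely many circles at once, and the remaining
  ones are handled by the smallest of their radii.\<close>

lemma continuous_on_hawaiian_earring:
  fixes g :: "complex \<Rightarrow> 'a::metric_space"
  assumes cont: "\<And>m. m \<ge> 1 \<Longrightarrow> continuous_on (hawaiian_circle m) g"
    and small: "\<And>e. e > 0 \<Longrightarrow> \<exists>M. \<forall>m\<ge>M. \<forall>z\<in>hawaiian_circle m. m \<ge> 1 \<longrightarrow> dist (g z) (g 0) < e"
  shows "continuous_on hawaiian_earring g"
  unfolding continuous_on_eq_continuous_within
proof
  fix z assume "z \<in> hawaiian_earring"
  then obtain m where m: "m \<ge> 1" "z \<in> hawaiian_circle m" by (auto simp: hawaiian_earring_def)
  show "continuous (at z within hawaiian_earring) g"
  proof (cases "z = 0")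
    case False
    then obtain S where S: "open S" "z \<in> S" "S \<inter> hawaiian_earring \<subseteq> hawaiian_circle m - {0}"
      using hawaiian_earring_locally_circle m by metis
    have "continuous (at z within hawaiian_circle m) g"
      using cont m by (simp add: continuous_on_eq_continuous_within)
    then have "continuous (at z within S \<inter> hawaiian_earring) g"
      by (rule continuous_within_subset) (use S in auto)
    moreover have "at z within S \<inter> hawaiian_earring = at z within hawaiian_earring"
      by (rule at_within_nhd[of z S]) (use S in auto)
    ultimately show ?thesis by simp
  next
    case True
    show ?thesis unfolding True continuous_within_eps_delta
    proof (intro allI impI)
      fix e :: real assume "e > 0"
      then obtain M where M: "\<And>m z. m \<ge> M \<Longrightarrow> m \<ge> 1 \<Longrightarrow> z\<in>hawaiian_circle m \<Longrightarrow> dist (g z) (g 0) < e"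
        using small by blast
      have "\<forall>m\<in>{1..<M}. \<exists>d>0. \<forall>x'\<in>hawaiian_circle m. dist x' 0 < d \<longrightarrow> dist (g x') (g 0) < e"
      proof
        fix m assume "m \<in> {1..<M}"
        then have "continuous (at 0 within hawaiian_circle m) g"
          using cont zero_in_hawaiian_circle by (simp add: continuous_on_eq_continuous_within)
        then show "\<exists>d>0. \<forall>x'\<in>hawaiian_circle m. dist x' 0 < d \<longrightarrow> dist (g x') (g 0) < e"
          using \<open>e > 0\<close> by (simp add: continuous_within_eps_delta)
      qed
      then obtain d where d: "\<And>m. m \<in> {1..<M} \<Longrightarrow> d m > 0"
        "\<And>m x. m \<in> {1..<M} \<Longrightarrow> x \<in> hawaiian_circle m \<Longrightarrow> dist x 0 < d m \<Longrightarrow> dist (g x) (g 0) < e"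
        by metis
      define D where "D = Min (insert 1 (d ` {1..<M}))"
      have D: "D > 0" "\<And>m. m \<in> {1..<M} \<Longrightarrow> D \<le> d m"
        using d(1) by (auto simp: D_def min.coboundedI2)
      have "dist (g x) (g 0) < e" if "x \<in> hawaiian_earring" "dist x 0 < D" for x
      proof -
        obtain j where j: "j \<ge> 1" "x \<in> hawaiian_circle j"
          using \<open>x \<in> hawaiian_earring\<close> by (blast elim: hawaiian_earringE)
        show ?thesis
          using M[of j x] d(2)[of j x] D(2)[of j] j that by (cases "j \<ge> M") auto
      qed
      with D(1) show "\<exists>d>0. \<forall>x'\<in>hawaiian_earring. dist x' 0 < d \<longrightarrow> dist (g x') (g 0) < e" by blast
    qed
  qed
qed

section \<open>Folding a circle, and then the earring, into a neighbourhood of a point\<close>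

lemma continuous_on_sgn_complex:
  fixes g :: "'a::topological_space \<Rightarrow> complex"
  assumes "continuous_on S g" "\<And>x. x \<in> S \<Longrightarrow> g x \<noteq> 0"
  shows "continuous_on S (\<lambda>x. sgn (g x))"
  unfolding sgn_div_norm using assms by (intro continuous_intros) auto

text \<open>A point is pulled along its chord towards \<open>b\<close> by a cutoff factor
  \<open>u\<close> and then normalised. The cutoff is \<open>1\<close> close to \<open>b\<close>,
  which gives the identity there, and \<open>0\<close> farther away, which gives the constant
  \<open>b\<close>.\<close>

lemma unit_circle_localize:
  fixes b :: complex
  assumes "norm b = 1" "e > 0"
  obtains F d where "continuous_on (sphere 0 1) F" "d > 0"
    "\<And>w. norm w = 1 \<Longrightarrow> norm (F w) = 1 \<and> dist (F w) b < e"
    "\<And>w. norm w = 1 \<Longrightarrow> dist w b < d \<Longrightarrow> F w = w"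
    "\<And>w. norm w = 1 \<Longrightarrow> dist w b \<ge> e \<Longrightarrow> F w = b"
proof -
  \<comment> \<open>The bound \<open>1/4\<close> keeps the norm of \<open>v w\<close> above
    \<open>1/2\<close>, so that it can be normalised. The bound \<open>e / 4\<close> absorbs the
    displacement and the error of normalisation, each below \<open>2 * d\<close>.\<close>
  define d where "d = min (e / 4) (1/4)"
  have d: "d > 0" "d \<le> 1/4" "d \<le> e/4" using assms(2) by (auto simp: d_def)
  define u where "u w = max 0 (min 1 (2 - dist w b / d))" for w
  define v where "v w = b + of_real (u w) * (w - b)" for w
  have u: "0 \<le> u w" "u w \<le> 1" for w by (auto simp: u_def)
  have u0: "u w = 0" if "dist w b \<ge> 2 * d" for w
    using that d(1) by (simp add: u_def field_simps)
  have u1: "u w = 1" if "dist w b \<le> d" for w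
    using that d(1) by (simp add: u_def field_simps)
  have vb: "norm (v w - b) < 2 * d" for w
  proof (cases "dist w b \<ge> 2 * d")
    case True then show ?thesis using u0 d(1) by (simp add: v_def)
  next
    case False
    have "norm (v w - b) = u w * dist w b"
      using u(1)[of w] by (simp add: v_def norm_mult dist_norm)
    also have "\<dots> \<le> 1 * dist w b" by (intro mult_right_mono u) auto
    finally show ?thesis using False by simp
  qed
  have nv: "\<bar>norm (v w) - 1\<bar> < 2 * d" for w
    using vb[of w] norm_triangle_ineq3[of "v w" b] assms(1) by simp
  have v0: "v w \<noteq> 0" for w using nv[of w] d(2) by auto
  have cu: "continuous_on S u" for S
    unfolding u_def using d(1) by (intro continuous_intros) auto
  have "continuous_on (sphere 0 1) (\<lambda>w. sgn (v w))"
    by (rule continuous_on_sgn_complex) (use v0 in \<open>auto simp: v_def intro!: continuous_intros cu\<close>)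
  moreover have "norm (sgn (v w)) = 1" for w using v0 by (simp add: norm_sgn)
  moreover have "dist (sgn (v w)) b < e" for w
  proof -
    have "v w = of_real (norm (v w)) * sgn (v w)"
      using v0[of w] by (simp add: sgn_div_norm scaleR_conv_of_real)
    then have "v w - sgn (v w) = of_real (norm (v w) - 1) * sgn (v w)"
      by (metis left_diff_distrib mult_1 of_real_1 of_real_diff)
    then have "norm (v w - sgn (v w)) = \<bar>norm (v w) - 1\<bar>"
      using v0[of w] by (simp add: norm_mult norm_sgn del: of_real_diff)
    then have "dist (sgn (v w)) (v w) < 2 * d" using nv[of w] by (simp add: dist_norm norm_minus_commute)
    moreover have "dist (v w) b < 2 * d" using vb[of w] by (simp add: dist_norm)
    ultimately show ?thesis using dist_triangle[of "sgn (v w)" b "v w"] d(3) by linarith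
  qed
  moreover have "sgn (v w) = w" if "norm w = 1" "dist w b < d" for w
    using u1[of w] that by (simp add: v_def sgn_div_norm)
  moreover have "sgn (v w) = b" if "norm w = 1" "dist w b \<ge> e" for w
    using u0[of w] that d assms by (simp add: v_def sgn_div_norm)
  ultimately show ?thesis using that[of "\<lambda>w. sgn (v w)" d] d(1) by blast
qed

lemma hawaiian_circle_localize:
  assumes "m \<ge> 1" "x \<in> hawaiian_circle m" "e > 0"
  obtains F d where "continuous_on (hawaiian_circle m) F" "d > 0"
    "\<And>z. z \<in> hawaiian_circle m \<Longrightarrow> F z \<in> hawaiian_circle m \<and> dist (F z) x < e"
    "\<And>z. z \<in> hawaiian_circle m \<Longrightarrow> dist z x < d \<Longrightarrow> F z = z"
    "\<And>z. z \<in> hawaiian_circle m \<Longrightarrow> dist z x \<ge> e \<Longrightarrow> F z = x"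
proof -
  define b where "b = 1 - of_nat m * x"
  have m: "real m > 0" using assms(1) by simp
  have b: "norm b = 1" using assms by (simp add: b_def hawaiian_circle_iff_unit)
  have "real m * e > 0" using m assms(3) by simp
  then obtain G d where G: "continuous_on (sphere 0 1) G" "d > 0"
    "\<And>w. norm w = 1 \<Longrightarrow> norm (G w) = 1 \<and> dist (G w) b < real m * e"
    "\<And>w. norm w = 1 \<Longrightarrow> dist w b < d \<Longrightarrow> G w = w"
    "\<And>w. norm w = 1 \<Longrightarrow> dist w b \<ge> real m * e \<Longrightarrow> G w = b"
    using unit_circle_localize[OF b] by metis
  define F where "F z = (1 - G (1 - of_nat m * z)) / of_nat m" for z
  have unit: "norm (1 - of_nat m * z) = 1" if "z \<in> hawaiian_circle m" for z
    using that assms(1) by (simp add: hawaiian_circle_iff_unit)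
  have dist_b: "dist (1 - of_nat m * z) b = real m * dist z x" for z
  proof -
    have "1 - of_nat m * z - b = of_nat m * (x - z)" by (simp add: b_def algebra_simps)
    then show ?thesis by (simp add: dist_norm norm_mult norm_minus_commute)
  qed
  have "continuous_on (hawaiian_circle m) F"
    unfolding F_def using m unit
    by (intro continuous_intros continuous_on_compose2[OF G(1)]) auto
  moreover have "d / real m > 0" using G(2) m by simp
  moreover have "F z \<in> hawaiian_circle m \<and> dist (F z) x < e" if "z \<in> hawaiian_circle m" for z
  proof
    show "F z \<in> hawaiian_circle m"
      using G(3)[OF unit[OF that]] assms(1) by (simp add: F_def unit_point_in_hawaiian_circle)
    have "1 - of_nat m * F z = G (1 - of_nat m * z)" using m by (simp add: F_def)
    then have "real m * dist (F z) x < real m * e"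
      using G(3)[OF unit[OF that]] dist_b[of "F z"] by simp
    then show "dist (F z) x < e" using m by simp
  qed
  moreover have "F z = z" if "z \<in> hawaiian_circle m" "dist z x < d / real m" for z
  proof -
    have "real m * dist z x < d" using that(2) m by (simp add: field_simps)
    then show ?thesis using G(4)[OF unit[OF that(1)]] m by (simp add: F_def dist_b)
  qed
  moreover have "F z = x" if "z \<in> hawaiian_circle m" "dist z x \<ge> e" for z
  proof -
    have "G (1 - of_nat m * z) = b" using G(5)[OF unit[OF that(1)]] that(2) m by (simp add: dist_b)
    then show ?thesis using m by (simp add: F_def b_def)
  qed
  ultimately show ?thesis using that[of F "d / real m"] by blast
qed

text \<open>The \<open>m\<close>-th circle has diameter \<open>2 / m\<close>, so a linear bound at
  the basepoint with a constant independent of \<open>m\<close> makes the oscillation on the circles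
  tend to \<open>0\<close>.\<close>

lemma continuous_on_hawaiian_earring_cofinite:
  fixes g :: "complex \<Rightarrow> complex"
  assumes "\<And>m. m \<ge> 1 \<Longrightarrow> continuous_on (hawaiian_circle m) g"
    and "\<And>m z. m \<ge> M \<Longrightarrow> z \<in> hawaiian_circle m \<Longrightarrow> norm (g z - g 0) \<le> B * norm z"
  shows "continuous_on hawaiian_earring g"
proof (rule continuous_on_hawaiian_earring)
  fix e :: real assume "e > 0"
  define K where "K = max M (nat \<lceil>2 * (\<bar>B\<bar> + 1) / e\<rceil> + 1)"
  have "dist (g z) (g 0) < e" if m: "m \<ge> K" "z \<in> hawaiian_circle m" "m \<ge> 1" for m z
  proof -
    have "2 * (\<bar>B\<bar> + 1) / e < real m"
      using m(1) unfolding K_def by linarith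
    then have "(\<bar>B\<bar> + 1) * (2 / real m) < e" using \<open>e > 0\<close> m(3) by (simp add: field_simps)
    moreover have "B * norm z \<le> (\<bar>B\<bar> + 1) * (2 / real m)"
      using norm_le_on_hawaiian_circle[OF m(3,2)] by (intro mult_mono) auto
    moreover have "norm (g z - g 0) \<le> B * norm z" by (rule assms(2)) (use m in \<open>auto simp: K_def\<close>)
    ultimately show ?thesis by (simp add: dist_norm)
  qed
  then show "\<exists>M. \<forall>m\<ge>M. \<forall>z\<in>hawaiian_circle m. m \<ge> 1 \<longrightarrow> dist (g z) (g 0) < e" by blast
qed (use assms in auto)

text \<open>Circles meeting the neighbourhood only partially are folded onto an arc; the small circles
  at the basepoint are kept.\<close>

lemma hawaiian_earring_localize:
  assumes "x \<in> hawaiian_earring" "openin (top_of_set hawaiian_earring) W" "x \<in> W"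
  obtains \<phi> W' where "continuous_on hawaiian_earring \<phi>" "\<phi> ` hawaiian_earring \<subseteq> W"
    "openin (top_of_set hawaiian_earring) W'" "x \<in> W'" "\<And>z. z \<in> W' \<Longrightarrow> \<phi> z = z"
    "\<And>m. m \<ge> 1 \<Longrightarrow> \<phi> ` hawaiian_circle m \<subseteq> hawaiian_circle m \<or> W' \<inter> hawaiian_circle m = {}"
proof -
  obtain e where e: "e > 0" "\<And>z. z \<in> hawaiian_earring \<Longrightarrow> dist z x < e \<Longrightarrow> z \<in> W"
    using assms(2,3) unfolding openin_euclidean_subtopology_iff by metis
  show ?thesis
  proof (cases "x = 0")
    case False
    obtain m where m: "m \<ge> 1" "x \<in> hawaiian_circle m"
      using assms(1) by (auto simp: hawaiian_earring_def)
    \<comment> \<open>The bound by \<open>norm x\<close> leaves the basepoint outside the disk of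
      radius \<open>e'\<close>. So \<open>F\<close> sends it to \<open>x\<close> and extends to the
      other circles by the constant \<open>x\<close>.\<close>
    define e' where "e' = min e (norm x)"
    have "e' > 0" using e(1) False by (simp add: e'_def)
    then obtain F d where F: "continuous_on (hawaiian_circle m) F" "d > 0"
      "\<And>z. z \<in> hawaiian_circle m \<Longrightarrow> F z \<in> hawaiian_circle m \<and> dist (F z) x < e'"
      "\<And>z. z \<in> hawaiian_circle m \<Longrightarrow> dist z x < d \<Longrightarrow> F z = z"
      "\<And>z. z \<in> hawaiian_circle m \<Longrightarrow> dist z x \<ge> e' \<Longrightarrow> F z = x"
      using hawaiian_circle_localize[OF m] by metis
    have F0: "F 0 = x" using F(5)[of 0] zero_in_hawaiian_circle m by (simp add: e'_def)
    define \<phi> where "\<phi> z = (if z \<in> hawaiian_circle m then F z else x)" for z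
    have other: "\<phi> z = x" if "z \<in> hawaiian_circle j" "j \<ge> 1" "j \<noteq> m" for z j
      using that hawaiian_circle_unique[of j m z] F0 m by (auto simp: \<phi>_def)
    obtain S where S: "open S" "x \<in> S" "S \<inter> hawaiian_earring \<subseteq> hawaiian_circle m - {0}"
      using hawaiian_earring_locally_circle m False by metis
    define W' where "W' = hawaiian_earring \<inter> (S \<inter> ball x d)"
    have W': "W' \<subseteq> hawaiian_circle m - {0}" using S by (auto simp: W'_def)
    show ?thesis
    proof (rule that[of \<phi> W'])
      show "continuous_on hawaiian_earring \<phi>"
      proof (rule continuous_on_hawaiian_earring_cofinite[where M = "Suc m" and B = 0])
        fix j assume j: "j \<ge> (1::nat)"
        show "continuous_on (hawaiian_circle j) \<phi>"
        proof (cases "j = m")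
          case True
          then show ?thesis using F(1) by (auto simp: \<phi>_def cong: continuous_on_cong)
        next
          case False
          then show ?thesis
            using other j by (subst continuous_on_cong[of _ _ _ "\<lambda>_. x"]) auto
        qed
      next
        fix j z assume "j \<ge> Suc m" "z \<in> hawaiian_circle j"
        then show "norm (\<phi> z - \<phi> 0) \<le> 0 * norm z"
          using other[of z j] other[of 0 j] zero_in_hawaiian_circle[of j] by auto
      qed
      show "\<phi> ` hawaiian_earring \<subseteq> W"
        using F(3) e assms(1,3) m hawaiian_circle_subset[OF m(1)]
        by (auto simp: \<phi>_def e'_def)
      show "openin (top_of_set hawaiian_earring) W'"
        unfolding W'_def using S by (intro openin_open_Int) auto
      show "x \<in> W'" using S F(2) assms(1) by (simp add: W'_def)
      show "\<phi> z = z" if "z \<in> W'" for z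
        using that F(4) W' by (auto simp: \<phi>_def W'_def dist_commute)
      show "\<phi> ` hawaiian_circle j \<subseteq> hawaiian_circle j \<or> W' \<inter> hawaiian_circle j = {}" if "j \<ge> 1" for j
        using F(3) W' that hawaiian_circle_unique[of j m] m by (cases "j = m") (auto simp: \<phi>_def)
    qed
  next
    case True
    have "\<exists>F d. continuous_on (hawaiian_circle m) F \<and> d > 0 \<and>
      (\<forall>z\<in>hawaiian_circle m. F z \<in> hawaiian_circle m \<and> dist (F z) 0 < e \<and> (dist z 0 < d \<longrightarrow> F z = z))"
      if "m \<ge> 1" for m
      using hawaiian_circle_localize[OF that zero_in_hawaiian_circle[OF that] e(1)] by metis
    then have "\<forall>m\<in>{1..}. \<exists>F d. continuous_on (hawaiian_circle m) F \<and> d > 0 \<and>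
      (\<forall>z\<in>hawaiian_circle m. F z \<in> hawaiian_circle m \<and> dist (F z) 0 < e \<and> (dist z 0 < d \<longrightarrow> F z = z))"
      by auto
    then obtain F d where F0: "\<forall>m\<in>{1..}. continuous_on (hawaiian_circle m) (F m) \<and> d m > 0 \<and>
      (\<forall>z\<in>hawaiian_circle m. F m z \<in> hawaiian_circle m \<and> dist (F m z) 0 < e \<and> (dist z 0 < d m \<longrightarrow> F m z = z))"
      unfolding bchoice_iff by blast
    then have F: "\<And>m. m \<ge> 1 \<Longrightarrow> continuous_on (hawaiian_circle m) (F m)"
      "\<And>m. m \<ge> 1 \<Longrightarrow> d m > (0::real)"
      "\<And>m z. m \<ge> 1 \<Longrightarrow> z \<in> hawaiian_circle m \<Longrightarrow> F m z \<in> hawaiian_circle m"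
      "\<And>m z. m \<ge> 1 \<Longrightarrow> z \<in> hawaiian_circle m \<Longrightarrow> dist (F m z) 0 < e"
      "\<And>m z. m \<ge> 1 \<Longrightarrow> z \<in> hawaiian_circle m \<Longrightarrow> dist z 0 < d m \<Longrightarrow> F m z = z"
      by auto
    define M where "M = nat \<lceil>2 / e\<rceil> + 1"
    have M: "2 / real m < e" if "m \<ge> M" for m
    proof -
      have "2 / e < real m" using that unfolding M_def by linarith
      then show ?thesis using e(1) that by (simp add: field_simps M_def)
    qed
    \<comment> \<open>The index is ambiguous only at the basepoint, which every \<open>F m\<close>
      fixes.\<close>
    define ix where "ix z = (SOME m. m \<ge> 1 \<and> z \<in> hawaiian_circle m)" for z
    define \<phi> where "\<phi> z = (if ix z \<ge> M then z else F (ix z) z)" for z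
    have \<phi>: "\<phi> z = (if m \<ge> M then z else F m z)" if "m \<ge> 1" "z \<in> hawaiian_circle m" for m z
    proof (cases "z = 0")
      case True
      have "ix 0 \<ge> 1" unfolding ix_def using zero_in_hawaiian_circle[of 1]
        by (rule_tac someI2[of _ 1]) auto
      then show ?thesis
        using True F(2,5) that(1) zero_in_hawaiian_circle by (simp add: \<phi>_def)
    next
      case False
      have "ix z = m" unfolding ix_def
        using that hawaiian_circle_unique False by (intro some_equality) auto
      then show ?thesis by (simp add: \<phi>_def)
    qed
    have \<phi>0: "\<phi> 0 = 0" using \<phi>[of 1 0] F(2,5)[of 1] zero_in_hawaiian_circle[of 1] by auto
    define D where "D = Min (insert 1 (d ` {1..<M}))"
    have D: "D > 0" "\<And>m. m \<in> {1..<M} \<Longrightarrow> D \<le> d m" using F(2) by (auto simp: D_def min.coboundedI2)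
    define W' where "W' = hawaiian_earring \<inter> ball 0 D"
    show ?thesis
    proof (rule that[of \<phi> W'])
      show "continuous_on hawaiian_earring \<phi>"
      proof (rule continuous_on_hawaiian_earring_cofinite[where M = "max 1 M" and B = 1])
        fix m assume m: "m \<ge> (1::nat)"
        show "continuous_on (hawaiian_circle m) \<phi>"
          using F(1)[OF m] \<phi>[OF m] by (cases "M \<le> m") (simp_all cong: continuous_on_cong)
      next
        fix m z assume "m \<ge> max 1 M" "z \<in> hawaiian_circle m"
        then show "norm (\<phi> z - \<phi> 0) \<le> 1 * norm z" using \<phi>[of m z] \<phi>0 by auto
      qed
      show "\<phi> ` hawaiian_earring \<subseteq> W"
      proof clarify
        fix z assume "z \<in> hawaiian_earring"
        then obtain m where m: "m \<ge> 1" "z \<in> hawaiian_circle m" by (auto simp: hawaiian_earring_def)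
        then have "\<phi> z \<in> hawaiian_circle m" "dist (\<phi> z) 0 < e"
          using \<phi>[of m z] F(3,4)[of m z] M[of m] norm_le_on_hawaiian_circle[of m z] by auto
        then show "\<phi> z \<in> W" using e(2) True hawaiian_circle_subset[OF m(1)] by auto
      qed
      show "openin (top_of_set hawaiian_earring) W'"
        unfolding W'_def by (intro openin_open_Int) auto
      show "x \<in> W'" using True D(1) zero_in_hawaiian_earring by (simp add: W'_def)
      show "\<phi> z = z" if z: "z \<in> W'" for z
      proof -
        obtain m where m: "m \<ge> 1" "z \<in> hawaiian_circle m"
          using z by (auto simp: W'_def hawaiian_earring_def)
        show ?thesis using \<phi>[OF m] F(5)[OF m] D(2)[of m] z m(1) by (auto simp: W'_def dist_commute)
      qed
      show "\<phi> ` hawaiian_circle m \<subseteq> hawaiian_circle m \<or> W' \<inter> hawaiian_circle m = {}" if "m \<ge> 1" for m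
        using \<phi>[OF that] F(3)[OF that] by auto
    qed
  qed
qed

section \<open>Flows on trees of circles\<close>

text \<open>The exponent of the \<open>p\<close>-th loop on the circle \<open>m\<close> of the \<open>p\<close>-th tree. The unit that enters
  at \<open>p\<close> comes up from the sibling of \<open>p\<close>, and below each circle it follows the first child.\<close>

fun pants_flow :: "int \<Rightarrow> nat \<Rightarrow> int" where
  "pants_flow p m =
     (if m \<le> 1 then (if p = int m then 1 else 0)
      else if even m then
        (if p = int m then 1 else if p = int m + 1 then -1 else pants_flow p (m div 2))
      else (if p = int m then 1 else if p = int m - 1 then -1 else 0))"

declare pants_flow.simps [simp del]

lemma pants_flow_self: "m \<ge> 1 \<Longrightarrow> pants_flow (int m) m = 1"
  by (subst pants_flow.simps) auto

lemma pants_flow_abs_le: "\<bar>pants_flow p m\<bar> \<le> 1"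
proof (induction m rule: less_induct)
  case (less m)
  show ?case using less[of "m div 2"] by (subst pants_flow.simps) auto
qed

text \<open>Such a circle \<open>m\<close> is neither \<open>p\<close> nor the sibling of
  \<open>p\<close>, and the inequality passes to its parent. So the recursion ends with
  \<open>0\<close>. In particular nothing flows through the parent of \<open>p\<close>.\<close>

lemma pants_flow_eq_0: "p \<ge> 2 * int m \<Longrightarrow> m \<ge> 1 \<Longrightarrow> pants_flow p m = 0"
proof (induction m rule: less_induct)
  case (less m)
  have "pants_flow p (m div 2) = 0" if "m > 1"
    using less.IH[of "m div 2"] less.prems that by auto
  then show ?case using less.prems by (subst pants_flow.simps) auto
qed

text \<open>If \<open>p\<close> is one of the children, they carry \<open>1\<close> and
  \<open>-1\<close> and the parent carries \<open>0\<close>. Otherwise the even child repeats the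
  value of the parent and the odd child carries \<open>0\<close>.\<close>

lemma pants_flow_children:
  assumes "m \<ge> 1"
  shows "pants_flow p m = pants_flow p (2 * m) + pants_flow p (2 * m + 1)"
  using assms pants_flow_eq_0[of m p]
  by (subst (2 3) pants_flow.simps) auto

text \<open>In the coordinate \<open>w = 1 - m z\<close>, which identifies the \<open>m\<close>-th circle with the unit circle, this is
  a power map to the \<open>p\<close>-th circle.\<close>

definition sheet_label :: "int \<Rightarrow> nat \<Rightarrow> complex \<Rightarrow> complex" where
  "sheet_label p m z =
     (if p \<ge> 1 then (1 - (1 - of_nat m * z) powi pants_flow p m) / of_int p else 0)"

lemma sheet_label_0 [simp]: "sheet_label p m 0 = 0"
  by (simp add: sheet_label_def)

lemma sheet_label_self: "m \<ge> 1 \<Longrightarrow> sheet_label (int m) m z = z"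
  by (simp add: sheet_label_def pants_flow_self)

lemma unit_label_in_hawaiian_earring:
  assumes "norm w = 1" "p \<ge> 1"
  shows "(1 - w) / of_int p \<in> hawaiian_earring"
proof -
  have "(1 - w) / of_nat (nat p) \<in> hawaiian_circle (nat p)"
    using assms by (intro unit_point_in_hawaiian_circle) auto
  then show ?thesis
    using hawaiian_circle_subset[of "nat p"] assms(2) by (auto simp: subset_iff)
qed

lemma sheet_label_in_hawaiian_earring:
  assumes "m \<ge> 1" "z \<in> hawaiian_circle m"
  shows "sheet_label p m z \<in> hawaiian_earring"
  using assms zero_in_hawaiian_earring
  by (auto simp: sheet_label_def hawaiian_circle_iff_unit norm_power_int
      intro!: unit_label_in_hawaiian_earring)

lemma continuous_on_sheet_label:
  assumes "m \<ge> 1"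
  shows "continuous_on (hawaiian_circle m) (sheet_label p m)"
proof (cases "p \<ge> 1")
  case True
  have "1 - of_nat m * z \<noteq> 0" if "z \<in> hawaiian_circle m" for z
    using that assms by (metis hawaiian_circle_iff_unit norm_zero zero_neq_one)
  then have "continuous_on (hawaiian_circle m)
      (\<lambda>z. (1 - (1 - of_nat m * z) powi pants_flow p m) / of_int p)"
    using True by (intro continuous_intros) auto
  then show ?thesis using True by (simp add: sheet_label_def cong: continuous_on_cong)
next
  case False
  then have "sheet_label p m = (\<lambda>_. 0)" by (auto simp: sheet_label_def)
  then show ?thesis by simp
qed

text \<open>Powers with exponent \<open>-1\<close>, \<open>0\<close> or \<open>1\<close> do not
  increase the distance to \<open>1\<close> on the unit circle. Only the rescaling from the circle
  \<open>m\<close> to the circle \<open>m - i\<close> costs a factor,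
  \<open>m / (m - i) \<le> 1 + \<bar>i\<bar>\<close>, which is bounded on each sheet.\<close>

lemma norm_sheet_label_le:
  assumes "m \<ge> 1" "z \<in> hawaiian_circle m"
  shows "norm (sheet_label (int m - i) m z) \<le> (1 + \<bar>of_int i\<bar>) * norm z"
proof (cases "int m - i \<ge> 1")
  case True
  define p where "p = int m - i"
  define w where "w = 1 - of_nat m * z"
  have w: "norm w = 1" using assms by (simp add: w_def hawaiian_circle_iff_unit)
  then have "w \<noteq> 0" by auto
  have p: "p \<ge> 1" using True by (simp add: p_def)
  have "pants_flow p m \<in> {-1, 0, 1}" using pants_flow_abs_le[of p m] by auto
  moreover have "norm (1 - inverse w) = norm (1 - w)"
  proof -
    have "1 - inverse w = - ((1 - w) / w)" using \<open>w \<noteq> 0\<close> by (simp add: field_simps)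
    then show ?thesis using w by (simp add: norm_divide)
  qed
  ultimately have "norm (1 - w powi pants_flow p m) \<le> norm (1 - w)"
    by (auto simp: power_int_minus)
  also have "\<dots> = real m * norm z" by (simp add: w_def norm_mult)
  finally have "norm (sheet_label p m z) \<le> real m / of_int p * norm z"
    using p by (simp add: sheet_label_def norm_divide w_def divide_right_mono)
  also have "\<dots> \<le> (1 + \<bar>of_int i\<bar>) * norm z"
  proof (rule mult_right_mono)
    have "real m = of_int (p + i)" by (simp add: p_def)
    also have "\<dots> \<le> (1 + \<bar>of_int i\<bar>) * of_int p"
    proof -
      have "\<bar>i\<bar> * 1 \<le> \<bar>i\<bar> * p" using p by (intro mult_left_mono) auto
      then have "p + i \<le> (1 + \<bar>i\<bar>) * p" by (simp add: algebra_simps)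
      then have "real_of_int (p + i) \<le> of_int ((1 + \<bar>i\<bar>) * p)" by linarith
      then show ?thesis by simp
    qed
    finally show "real m / of_int p \<le> 1 + \<bar>of_int i\<bar>" using p by (simp add: field_simps)
  qed auto
  finally show ?thesis by (simp add: p_def)
next
  case False
  then show ?thesis by (simp add: sheet_label_def)
qed

text \<open>This is the retraction on the copy of the earring on the sheet \<open>i\<close>, where
  the circle \<open>m\<close> belongs to the tree \<open>m - i\<close>. All choices of
  \<open>m\<close> at the basepoint give \<open>0\<close>.\<close>

definition sheet_map :: "int \<Rightarrow> complex \<Rightarrow> complex" where
  "sheet_map i z = (let m = SOME m. m \<ge> 1 \<and> z \<in> hawaiian_circle m in sheet_label (int m - i) m z)"

lemma sheet_map_eq:
  assumes "m \<ge> 1" "z \<in> hawaiian_circle m"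
  shows "sheet_map i z = sheet_label (int m - i) m z"
proof (cases "z = 0")
  case False
  have "(SOME m. m \<ge> 1 \<and> z \<in> hawaiian_circle m) = m"
    using assms hawaiian_circle_unique False by (intro some_equality) auto
  then show ?thesis by (simp add: sheet_map_def)
qed (simp add: sheet_map_def Let_def)

lemma sheet_map_in: "z \<in> hawaiian_earring \<Longrightarrow> sheet_map i z \<in> hawaiian_earring"
  by (elim hawaiian_earringE) (simp add: sheet_map_eq sheet_label_in_hawaiian_earring)

lemma sheet_map_0: "z \<in> hawaiian_earring \<Longrightarrow> sheet_map 0 z = z"
  by (elim hawaiian_earringE) (simp add: sheet_map_eq sheet_label_self)

lemma continuous_on_sheet_map: "continuous_on hawaiian_earring (sheet_map i)"
proof (rule continuous_on_hawaiian_earring_cofinite[where M = 1 and B = "1 + \<bar>of_int i\<bar>"])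
  fix m assume m: "m \<ge> (1::nat)"
  show "continuous_on (hawaiian_circle m) (sheet_map i)"
    using continuous_on_sheet_label[OF m] by (subst continuous_on_cong[OF refl sheet_map_eq[OF m]]) auto
next
  fix m z assume m: "m \<ge> (1::nat)" "z \<in> hawaiian_circle m"
  have "sheet_map i 0 = 0" by (simp add: sheet_map_def Let_def)
  then show "norm (sheet_map i z - sheet_map i 0) \<le> (1 + \<bar>of_int i\<bar>) * norm z"
    using norm_sheet_label_le[OF m] sheet_map_eq[OF m] by simp
qed

section \<open>Maps of a pair of pants to the circle\<close>

lemma path_logarithm:
  assumes "path p" "\<zeta> \<notin> path_image p"
  obtains q where "continuous_on {0..1} q" "\<And>t. t \<in> {0..1} \<Longrightarrow> p t - \<zeta> = exp (q t)"
    "q 1 - q 0 = 2 * of_real pi * \<i> * winding_number p \<zeta>"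
proof -
  have "continuous_on {0..1} (\<lambda>t. p t - \<zeta>)"
    using assms(1) by (auto simp: path_def intro: continuous_intros)
  moreover have "p t - \<zeta> \<noteq> 0" if "t \<in> {0..1}" for t
    using that assms(2) by (auto simp: path_image_def)
  ultimately obtain q where q: "continuous_on {0..1} q" "\<And>t. t \<in> {0..1} \<Longrightarrow> p t - \<zeta> = exp (q t)"
    using continuous_logarithm_on_contractible[of "{0..1::real}" "\<lambda>t. p t - \<zeta>"]
      convex_imp_contractible[OF convex_real_interval(5)] by metis
  have "winding_number p \<zeta> = winding_number (\<lambda>t. p t - \<zeta>) 0"
    by (rule winding_number_offset)
  also have "\<dots> = winding_number (exp \<circ> q) 0"
    by (intro winding_number_cong) (use q in auto)
  also have "\<dots> = (q 1 - q 0) / (2 * of_real pi * \<i>)"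
    using winding_number_compose_exp[of q] q(1) by (simp add: path_def pathfinish_def pathstart_def)
  finally show ?thesis using that[of q] q by (simp add: field_simps)
qed

text \<open>By compactness a simple loop is a quotient map from the interval onto its image, and it
  identifies nothing but the two endpoints.\<close>

lemma continuous_on_simple_loop_factor:
  fixes \<gamma> :: "real \<Rightarrow> complex" and L :: "real \<Rightarrow> complex"
  assumes "simple_path \<gamma>" "pathfinish \<gamma> = pathstart \<gamma>" "continuous_on {0..1} L" "L 1 = L 0"
  obtains \<mu> where "continuous_on (path_image \<gamma>) \<mu>" "\<And>t. t \<in> {0..1} \<Longrightarrow> \<mu> (\<gamma> t) = L t"
proof -
  define \<mu> where "\<mu> x = L (SOME t. t \<in> {0..1} \<and> \<gamma> t = x)" for x
  have \<mu>: "\<mu> (\<gamma> t) = L t" if t: "t \<in> {0..1}" for t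
  proof -
    define s where "s = (SOME s. s \<in> {0..1} \<and> \<gamma> s = \<gamma> t)"
    have s: "s \<in> {0..1} \<and> \<gamma> s = \<gamma> t"
      unfolding s_def by (rule someI[of _ t]) (use t in auto)
    then have "s = t \<or> s = 0 \<and> t = 1 \<or> s = 1 \<and> t = 0"
      using assms(1) t by (auto simp: simple_path_def loop_free_def)
    then have "L s = L t" using assms(4) by auto
    then show ?thesis by (simp add: \<mu>_def s_def)
  qed
  have cont: "continuous_on {0..1} \<gamma>" using assms(1) by (simp add: simple_path_def path_def)
  have "quotient_map (top_of_set {0..1}) (top_of_set (path_image \<gamma>)) \<gamma>"
    by (rule T1_Spaces.continuous_imp_quotient_map)
       (use cont in \<open>auto simp: path_image_def compact_space_subtopology Hausdorff_space_subtopology\<close>)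
  moreover have "continuous_map (top_of_set {0..1}) euclidean (\<mu> \<circ> \<gamma>)"
    using continuous_on_eq[OF assms(3), of "\<mu> \<circ> \<gamma>"] \<mu> by simp
  ultimately have "continuous_map (top_of_set (path_image \<gamma>)) euclidean \<mu>"
    by (rule continuous_compose_quotient_map)
  then show ?thesis using that \<mu> by simp
qed

text \<open>Index \<open>0\<close> is the outer disk, \<open>1\<close> and \<open>2\<close> are the
  removed disks. Numbering them lets all three boundary circles be treated alike, up to the sign
  \<open>side\<close>. The strict inequalities keep the circles a positive distance apart.\<close>

locale round_pants =
  fixes c :: "nat \<Rightarrow> complex" and \<rho> :: "nat \<Rightarrow> real"
  assumes radius_pos: "k < 3 \<Longrightarrow> \<rho> k > 0"
    and inside1: "dist (c 0) (c 1) + \<rho> 1 < \<rho> 0"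
    and inside2: "dist (c 0) (c 2) + \<rho> 2 < \<rho> 0"
    and separated: "\<rho> 1 + \<rho> 2 < dist (c 1) (c 2)"
begin

definition side :: "nat \<Rightarrow> real" where "side k = (if k = 0 then -1 else 1)"

text \<open>Signed distance to the \<open>k\<close>-th boundary circle, positive on the side of the
  pants.\<close>

definition depth :: "nat \<Rightarrow> complex \<Rightarrow> real" where
  "depth k x = side k * (dist (c k) x - \<rho> k)"

definition core :: "real \<Rightarrow> complex set" where
  "core s = {x. \<forall>k<3. depth k x \<ge> s}"

definition rim :: "nat \<Rightarrow> complex set" where "rim k = sphere (c k) (\<rho> k)"

text \<open>Radial motion of a rim point by \<open>s\<close> into the pants. Together with the
  radial projection \<open>proj\<close> and the depth it provides polar coordinates on a collar of
  the rim.\<close>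

definition push :: "nat \<Rightarrow> real \<Rightarrow> complex \<Rightarrow> complex" where
  "push k s b = c k + of_real ((\<rho> k + side k * s) / \<rho> k) * (b - c k)"

definition proj :: "nat \<Rightarrow> complex \<Rightarrow> complex" where
  "proj k x = c k + of_real (\<rho> k / dist (c k) x) * (x - c k)"

definition gap :: real where
  "gap = min (\<rho> 0 - dist (c 0) (c 1) - \<rho> 1)
           (min (\<rho> 0 - dist (c 0) (c 2) - \<rho> 2) (dist (c 1) (c 2) - \<rho> 1 - \<rho> 2))"

lemma less3D: "k < (3::nat) \<Longrightarrow> k = 0 \<or> k = 1 \<or> k = 2" by auto

lemma side_cases: "side k = 1 \<or> side k = -1" by (simp add: side_def)

lemma side_sq [simp]: "side k * side k = 1" using side_cases[of k] by auto

lemma gap_pos: "gap > 0"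
  using inside1 inside2 separated by (simp add: gap_def)

lemma gap_less_radius0: "gap < \<rho> 0"
  using radius_pos[of 1] zero_le_dist[of "c 0" "c 1"] unfolding gap_def by linarith

text \<open>This is the triangle inequality. It makes collars narrower than half of
  \<open>gap\<close> disjoint, and places every point close to one boundary circle deep below the
  other two.\<close>

lemma depth_sum_ge_gap:
  assumes "j < 3" "k < 3" "j \<noteq> k"
  shows "gap \<le> depth j x + depth k x"
  using less3D[OF assms(1)] less3D[OF assms(2)] assms(3)
    dist_triangle[of "c 0" x "c 1"] dist_triangle[of "c 0" x "c 2"] dist_triangle[of "c 1" "c 2" x]
  by (auto simp: depth_def side_def gap_def dist_commute)

lemma continuous_on_depth [continuous_intros]:
  "continuous_on S g \<Longrightarrow> continuous_on S (\<lambda>x. depth k (g x))"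
  unfolding depth_def by (intro continuous_intros)

lemma closed_core: "closed (core s)"
proof -
  have "core s = (\<Inter>k\<in>{..<3}. {x. s \<le> depth k x})" by (auto simp: core_def)
  moreover have "closed {x. s \<le> depth k x}" for k
    by (intro closed_Collect_le continuous_intros)
  ultimately show ?thesis by auto
qed

lemma core_mono: "s \<le> t \<Longrightarrow> core t \<subseteq> core s" by (force simp: core_def)

lemma dist_center: "dist (c k) x = \<rho> k + side k * depth k x"
  using side_cases[of k] by (auto simp: depth_def)

text \<open>The centres of the removed disks have negative depth, and the outer centre has depth
  \<open>\<rho> 0\<close>, which exceeds \<open>gap\<close>. So the radial projection is defined on
  every narrow collar.\<close>

lemma not_center:
  assumes "k < 3" "x \<in> core 0" "depth k x < gap"
  shows "x \<noteq> c k"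
proof
  assume "x = c k"
  then have *: "depth k x = - side k * \<rho> k" by (simp add: depth_def)
  have "depth k x \<ge> 0" using assms by (auto simp: core_def)
  then show False
    using * assms radius_pos[of k] gap_less_radius0 by (auto simp: side_def split: if_splits)
qed

lemma rim_depth: "b \<in> rim k \<longleftrightarrow> depth k b = 0"
  using side_cases[of k] by (auto simp: rim_def depth_def)

lemma depth_push:
  assumes "k < 3" "b \<in> rim k" "\<rho> k + side k * s \<ge> 0"
  shows "depth k (push k s b) = s"
proof -
  have "dist (c k) (push k s b) = norm (of_real ((\<rho> k + side k * s) / \<rho> k) * (b - c k))"
    by (simp add: push_def dist_norm)
  also have "\<dots> = (\<rho> k + side k * s) / \<rho> k * \<rho> k"
    unfolding norm_mult norm_of_real using assms radius_pos[of k]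
    by (simp add: rim_def dist_norm norm_minus_commute)
  also have "\<dots> = \<rho> k + side k * s" using radius_pos[OF assms(1)] by simp
  finally show ?thesis by (simp add: depth_def flip: mult.assoc)
qed

lemma push_0 [simp]: "k < 3 \<Longrightarrow> push k 0 b = b"
  using radius_pos[of k] by (simp add: push_def)

lemma dist_push:
  assumes "k < 3" "b \<in> rim k"
  shows "dist (push k s b) b = \<bar>s\<bar>"
proof -
  have r: "\<rho> k \<noteq> 0" using radius_pos[OF assms(1)] by simp
  have "push k s b - b = of_real (side k * s / \<rho> k) * (b - c k)"
    using r by (simp add: push_def field_simps)
  then have "dist (push k s b) b = \<bar>side k * s / \<rho> k\<bar> * \<rho> k"
    using assms(2) by (simp add: dist_norm norm_mult rim_def norm_minus_commute norm_divide abs_mult)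
  also have "\<dots> = \<bar>s\<bar>"
    using side_cases[of k] radius_pos[OF assms(1)] by (auto simp: abs_mult)
  finally show ?thesis .
qed

lemma radius_side_pos:
  assumes "k < 3" "0 \<le> s" "s < gap"
  shows "\<rho> k + side k * s > 0"
  using assms gap_less_radius0 radius_pos[of k] by (auto simp: side_def)

lemma push_in_core:
  assumes "k < 3" "b \<in> rim k" "0 \<le> s" "s < gap" "e \<le> s" "e \<le> gap - s"
  shows "push k s b \<in> core e"
  unfolding core_def
proof (intro CollectI allI impI)
  fix j :: nat assume j: "j < 3"
  have d: "depth k (push k s b) = s" using depth_push radius_side_pos[of k s] assms by simp
  show "e \<le> depth j (push k s b)"
    using d depth_sum_ge_gap[OF j assms(1)] assms by (cases "j = k") (auto, smt (verit))
qed

lemma proj_in_rim: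
  assumes "k < 3" "x \<noteq> c k"
  shows "proj k x \<in> rim k"
proof -
  have "dist (c k) (proj k x) = \<rho> k"
    using assms radius_pos[OF assms(1)]
    by (simp add: proj_def dist_norm norm_mult norm_divide norm_minus_commute)
  then show ?thesis by (simp add: rim_def)
qed

lemma push_proj:
  assumes "k < 3" "x \<noteq> c k"
  shows "push k (depth k x) (proj k x) = x"
  using assms radius_pos[of k] by (simp add: push_def proj_def flip: dist_center)

lemma proj_push:
  assumes "k < 3" "b \<in> rim k" "0 \<le> s" "s < gap"
  shows "proj k (push k s b) = b"
proof -
  have "dist (c k) (push k s b) = \<rho> k + side k * s"
    using depth_push[of k b s] radius_side_pos[of k s] assms by (simp add: dist_center)
  then show ?thesis
    using radius_side_pos[OF assms(1,3,4)] radius_pos[OF assms(1)]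
    by (simp add: proj_def push_def del: of_real_add of_real_mult of_real_divide)
       (simp add: mult.assoc[symmetric] del: of_real_add of_real_mult of_real_divide flip: of_real_mult)
qed

lemma proj_rim: "k < 3 \<Longrightarrow> b \<in> rim k \<Longrightarrow> proj k b = b"
  using proj_push[of k b 0] gap_pos by simp

lemma continuous_on_proj [continuous_intros]:
  assumes "continuous_on S g" "\<And>x. x \<in> S \<Longrightarrow> g x \<noteq> c k"
  shows "continuous_on S (\<lambda>x. proj k (g x))"
proof -
  have "\<forall>x\<in>S. dist (c k) (g x) \<noteq> 0" using assms(2) by (metis dist_eq_0_iff)
  then show ?thesis unfolding proj_def using assms(1) by (intro continuous_intros) auto
qed

lemma continuous_on_push [continuous_intros]:
  assumes "continuous_on S g" "continuous_on S h" "k < 3"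
  shows "continuous_on S (\<lambda>x. push k (h x) (g x))"
  unfolding push_def using assms radius_pos[of k] by (intro continuous_intros) auto

lemma rim_subset_core: "k < 3 \<Longrightarrow> rim k \<subseteq> core 0"
  using push_in_core[of k _ 0 0] gap_pos by auto

lemma core0_eq: "core 0 = pair_of_pants (cball (c 0) (\<rho> 0)) (cball (c 1) (\<rho> 1)) (cball (c 2) (\<rho> 2))"
proof -
  have "(\<forall>k<3. Q k) \<longleftrightarrow> Q 0 \<and> Q 1 \<and> Q 2" for Q :: "nat \<Rightarrow> bool"
    using less3D by auto
  then have "x \<in> core 0 \<longleftrightarrow> 0 \<le> depth 0 x \<and> 0 \<le> depth 1 x \<and> 0 \<le> depth 2 x" for x
    by (simp add: core_def)
  then show ?thesis
    by (intro set_eqI) (simp add: pair_of_pants_def depth_def side_def not_less)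
qed

lemma open_inner: "open {x. \<forall>k<3. depth k x > 0}"
proof -
  have "{x. \<forall>k<3. depth k x > 0} = (\<Inter>k\<in>{..<3}. {x. 0 < depth k x})" by auto
  moreover have "open {x. 0 < depth k x}" for k
    by (intro open_Collect_less continuous_intros)
  ultimately show ?thesis by auto
qed

lemma frontier_core0: "frontier (core 0) = (\<Union>k\<in>{..<3}. rim k)"
proof -
  have "interior (core 0) = {x. \<forall>k<3. depth k x > 0}"
  proof
    have "{x. \<forall>k<3. depth k x > 0} \<subseteq> core 0" by (auto simp: core_def less_imp_le)
    then show "{x. \<forall>k<3. depth k x > 0} \<subseteq> interior (core 0)"
      using open_inner by (simp add: interior_maximal)
    show "interior (core 0) \<subseteq> {x. \<forall>k<3. depth k x > 0}"
    proof (rule ccontr)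
      assume "\<not> ?thesis"
      then obtain x k where x: "x \<in> interior (core 0)" "k < 3" "\<not> depth k x > 0" by auto
      have "x \<in> core 0" using x(1) interior_subset by blast
      then have "x \<in> rim k" using x(2,3) by (force simp: rim_depth core_def)
      obtain e where e: "e > 0" "ball x e \<subseteq> core 0"
        using x(1) by (auto simp: mem_interior)
      \<comment> \<open>A rim point is moved by \<open>s\<close> out of the pants;
        \<open>s \<le> \<rho> k\<close> prevents it from passing the centre of a removed
        disk.\<close>
      define s where "s = min (e / 2) (\<rho> k)"
      have s: "s > 0" "s < e" "s \<le> \<rho> k"
        using e(1) radius_pos[OF x(2)] by (auto simp: s_def)
      have "depth k (push k (- s) x) = - s"
        using depth_push[of k x "- s"] s x(2) \<open>x \<in> rim k\<close> side_cases[of k] by auto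
      moreover have "push k (- s) x \<in> core 0"
        using e(2) dist_push[OF x(2) \<open>x \<in> rim k\<close>, of "- s"] s by (auto simp: dist_commute)
      ultimately show False using s(1) x(2) by (force simp: core_def)
    qed
  qed
  then have "frontier (core 0) = core 0 - {x. \<forall>k<3. depth k x > 0}"
    using closed_core by (simp add: frontier_def)
  also have "\<dots> = (\<Union>k\<in>{..<3}. rim k)"
    using rim_subset_core by (force simp: rim_depth core_def)
  finally show ?thesis .
qed

lemma inner_center_notin_core: "j \<in> {1, 2} \<Longrightarrow> c j \<notin> core 0"
proof -
  assume j: "j \<in> {1, 2}"
  then have "j < 3" "depth j (c j) < 0" using radius_pos[of j] by (auto simp: depth_def side_def)
  then show ?thesis by (auto simp: core_def not_le)
qed

text \<open>If the rim encloses \<open>c j\<close>, the radial homotopy from the rim to its pushed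
  copy stays in \<open>core 0\<close>, which omits \<open>c j\<close>, and the winding number is
  kept. If not, the pushed copy lies in a slightly larger disk around the other removed disk, which
  still omits \<open>c j\<close>.\<close>

lemma winding_number_push:
  assumes "k < 3" "j \<in> {1, 2}" "0 \<le> e" "2 * e < gap"
    and \<gamma>: "path \<gamma>" "pathfinish \<gamma> = pathstart \<gamma>" "path_image \<gamma> = rim k"
    and wn: "\<And>z. z \<in> ball (c k) (\<rho> k) \<Longrightarrow> winding_number \<gamma> z = -1"
  shows "winding_number (push k e \<circ> \<gamma>) (c j) = (if k = 0 \<or> k = j then -1 else 0)"
    and "path (push k e \<circ> \<gamma>)"
    and "c j \<notin> path_image (push k e \<circ> \<gamma>)"
proof -
  have rim: "\<gamma> t \<in> rim k" if "t \<in> {0..1}" for t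
    using that \<gamma>(3) by (auto simp: path_image_def)
  show p: "path (push k e \<circ> \<gamma>)"
    using \<gamma>(1) assms(1) unfolding path_def o_def by (intro continuous_intros)
  have core: "push k s (\<gamma> t) \<in> core 0" if "t \<in> {0..1}" "0 \<le> s" "s \<le> e" for s t
    using push_in_core[of k "\<gamma> t" s 0] rim that assms by auto
  have ncj: "c j \<notin> core 0" using inner_center_notin_core assms(2) .
  show "c j \<notin> path_image (push k e \<circ> \<gamma>)"
    using core[of _ e] ncj assms(3) by (auto simp: path_image_def)
  have closed: "pathfinish (push k e \<circ> \<gamma>) = pathstart (push k e \<circ> \<gamma>)"
    using \<gamma>(2) by (simp add: pathfinish_def pathstart_def)
  show "winding_number (push k e \<circ> \<gamma>) (c j) = (if k = 0 \<or> k = j then -1 else 0)"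
  proof (cases "k = 0 \<or> k = j")
    case True
    have "winding_number (push k e \<circ> \<gamma>) (c j) = winding_number \<gamma> (c j)"
    proof (rule winding_number_loops_linear_eq[OF \<gamma>(1) p \<gamma>(2) closed])
      fix t :: real assume t: "t \<in> {0..1}"
      show "c j \<notin> closed_segment (\<gamma> t) ((push k e \<circ> \<gamma>) t)"
      proof
        assume "c j \<in> closed_segment (\<gamma> t) ((push k e \<circ> \<gamma>) t)"
        then obtain u where u: "0 \<le> u" "u \<le> 1" "c j = (1 - u) *\<^sub>R \<gamma> t + u *\<^sub>R push k e (\<gamma> t)"
          by (auto simp: in_segment)
        have "(1 - u) *\<^sub>R \<gamma> t + u *\<^sub>R push k e (\<gamma> t) = push k (u * e) (\<gamma> t)"
          using radius_pos[OF assms(1)]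
          by (simp add: push_def scaleR_conv_of_real field_simps)
        moreover have "push k (u * e) (\<gamma> t) \<in> core 0"
          using core[OF t, of "u * e"] u assms(3) by (simp add: mult_left_le_one_le)
        ultimately show False using u(3) ncj by simp
      qed
    qed
    also have "c j \<in> ball (c k) (\<rho> k)"
      using True assms(2) inside1 inside2 radius_pos[of 1] radius_pos[of 2] by auto
    then have "winding_number \<gamma> (c j) = -1" by (rule wn)
    finally show ?thesis using True by simp
  next
    case False
    then have jk: "k = 1 \<and> j = 2 \<or> k = 2 \<and> j = 1" using assms(1,2) by auto
    have "winding_number (push k e \<circ> \<gamma>) (c j) = 0"
    proof (rule winding_number_zero_outside[OF p convex_cball closed])
      show "c j \<notin> cball (c k) (\<rho> k + e)"
        using jk assms(3,4) radius_pos[of 1] radius_pos[of 2]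
        by (auto simp: gap_def dist_commute)
      have "dist (c k) (push k e (\<gamma> t)) = \<rho> k + e" if "t \<in> {0..1}" for t
        using depth_push[OF assms(1) rim[OF that], of e] radius_side_pos[of k e] assms jk
        by (auto simp: dist_center side_def)
      then show "path_image (push k e \<circ> \<gamma>) \<subseteq> cball (c k) (\<rho> k + e)"
        by (auto simp: path_image_def)
    qed
    then show ?thesis using False by simp
  qed
qed

definition boundary_loop :: "nat \<Rightarrow> (real \<Rightarrow> complex) \<Rightarrow> bool" where
  "boundary_loop k \<gamma> \<longleftrightarrow> simple_path \<gamma> \<and> pathfinish \<gamma> = pathstart \<gamma> \<and> path_image \<gamma> = rim k \<and>
     (\<forall>z\<in>ball (c k) (\<rho> k). winding_number \<gamma> z = -1)"

text \<open>Along the loop, \<open>L\<close> is a logarithm of the quotient of the power of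
  \<open>T\<close> by the two factors. All of them turn clockwise, and \<open>deg\<close> is exactly
  the condition that the total increment of \<open>L\<close> vanishes. So \<open>L\<close> descends
  to the rim.\<close>

lemma boundary_log:
  assumes "k < 3" "0 \<le> e" "2 * e < gap" "boundary_loop k \<gamma>"
    and T: "\<And>t. t \<in> {0..1} \<Longrightarrow> T (\<gamma> t) = exp (- (2 * pi * t) * \<i>)"
    and deg: "m = (if k = 0 \<or> k = 1 then d1 else 0) + (if k = 0 \<or> k = 2 then d2 else 0)"
  obtains \<mu> where "continuous_on (rim k) \<mu>"
    "\<And>b. b \<in> rim k \<Longrightarrow>
       T b powi m = (push k e b - c 1) powi d1 * (push k e b - c 2) powi d2 * exp (\<mu> b)"
proof -
  have \<gamma>: "simple_path \<gamma>" "path \<gamma>" "pathfinish \<gamma> = pathstart \<gamma>" "path_image \<gamma> = rim k"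
    "\<And>z. z \<in> ball (c k) (\<rho> k) \<Longrightarrow> winding_number \<gamma> z = -1"
    using assms(4) by (auto simp: boundary_loop_def simple_path_imp_path)
  note wn = winding_number_push[OF assms(1) _ assms(2,3) \<gamma>(2-5)]
  obtain q1 where q1: "continuous_on {0..1} q1"
    "\<And>t. t \<in> {0..1} \<Longrightarrow> (push k e \<circ> \<gamma>) t - c 1 = exp (q1 t)"
    "q1 1 - q1 0 = 2 * of_real pi * \<i> * winding_number (push k e \<circ> \<gamma>) (c 1)"
    using path_logarithm[OF wn(2,3)[of 1]] by (metis insertI1)
  obtain q2 where q2: "continuous_on {0..1} q2"
    "\<And>t. t \<in> {0..1} \<Longrightarrow> (push k e \<circ> \<gamma>) t - c 2 = exp (q2 t)"
    "q2 1 - q2 0 = 2 * of_real pi * \<i> * winding_number (push k e \<circ> \<gamma>) (c 2)"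
    using path_logarithm[OF wn(2,3)[of 2]] by (metis insertI1 insertI2)
  define L where "L t = of_int m * (- (2 * pi * t) * \<i>) - of_int d1 * q1 t - of_int d2 * q2 t" for t :: real
  have "continuous_on {0..1} L" unfolding L_def by (intro continuous_intros q1 q2)
  moreover have "L 1 = L 0"
  proof -
    have "L 1 - L 0 = - (of_int m * 2 * pi * \<i>) - of_int d1 * (q1 1 - q1 0) - of_int d2 * (q2 1 - q2 0)"
      by (simp add: L_def algebra_simps)
    also have "\<dots> = 0"
    proof -
      have w: "winding_number (push k e \<circ> \<gamma>) (c 1) = (if k = 0 \<or> k = 1 then -1 else 0)"
        "winding_number (push k e \<circ> \<gamma>) (c 2) = (if k = 0 \<or> k = 2 then -1 else 0)"
        using wn(1)[of 1] wn(1)[of 2] by simp_all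
      show ?thesis
        unfolding q1(3) q2(3) w deg using less3D[OF assms(1)]
        by (elim disjE) (simp_all add: algebra_simps)
    qed
    finally show ?thesis by simp
  qed
  ultimately obtain \<mu> where \<mu>: "continuous_on (path_image \<gamma>) \<mu>" "\<And>t. t \<in> {0..1} \<Longrightarrow> \<mu> (\<gamma> t) = L t"
    using continuous_on_simple_loop_factor[OF \<gamma>(1,3)] by metis
  have "T b powi m = (push k e b - c 1) powi d1 * (push k e b - c 2) powi d2 * exp (\<mu> b)"
    if b: "b \<in> rim k" for b
  proof -
    obtain t where t: "t \<in> {0..1}" "b = \<gamma> t"
      using b \<gamma>(4) unfolding path_image_def by (metis imageE)
    define X where "X = (push k e b - c 1) powi d1"
    define Y where "Y = (push k e b - c 2) powi d2"
    have X: "exp (of_int d1 * q1 t) = X"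
      using q1(2)[OF t(1)] by (simp add: t(2) X_def exp_power_int)
    have Y: "exp (of_int d2 * q2 t) = Y"
      using q2(2)[OF t(1)] by (simp add: t(2) Y_def exp_power_int)
    have "X \<noteq> 0" "Y \<noteq> 0" by (simp_all flip: X Y)
    moreover have "exp (\<mu> b) = T b powi m / X / Y"
      by (simp only: t(2) \<mu>(2)[OF t(1)] L_def exp_diff T[OF t(1)] exp_power_int flip: X Y)
    ultimately show ?thesis unfolding X_def[symmetric] Y_def[symmetric] by simp
  qed
  then show ?thesis using that \<mu>(1) \<gamma>(4) by simp
qed

text \<open>The boundary values differ from those of
  \<open>(x - c\<^sub>1)\<^bsup>d\<^sub>1\<^esup> (x - c\<^sub>2)\<^bsup>d\<^sub>2\<^esup>\<close> by a
  factor of winding number zero on each boundary circle, whose logarithm extends by Dugundji's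
  theorem.\<close>

lemma degree_map_exists:
  assumes e: "0 \<le> e" "2 * e < gap"
    and \<gamma>: "\<And>k. k < 3 \<Longrightarrow> boundary_loop k (\<gamma> k)"
    and T: "\<And>k t. k < 3 \<Longrightarrow> t \<in> {0..1} \<Longrightarrow> T k (\<gamma> k t) = exp (- (2 * pi * t) * \<i>)"
    and deg: "d 0 = d 1 + (d 2 :: int)"
  obtains W where "continuous_on (core e) W" "\<And>x. x \<in> core e \<Longrightarrow> norm (W x) = 1"
    "\<And>k b. k < 3 \<Longrightarrow> b \<in> rim k \<Longrightarrow> W (push k e b) = T k b powi d k"
proof -
  define W0 where "W0 x = (x - c 1) powi d 1 * (x - c 2) powi d 2" for x
  have nc: "x \<noteq> c 1" "x \<noteq> c 2" if "x \<in> core e" for x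
    using that inner_center_notin_core[of 1] inner_center_notin_core[of 2] core_mono[OF e(1)] by auto
  have W0: "W0 x \<noteq> 0" if "x \<in> core e" for x using nc[OF that] by (simp add: W0_def)
  have contW0: "continuous_on (core e) W0"
    unfolding W0_def using nc by (intro continuous_intros) auto
  have "\<exists>\<mu>. continuous_on (rim k) \<mu> \<and> (\<forall>b\<in>rim k. T k b powi d k = W0 (push k e b) * exp (\<mu> b))"
    if k: "k < 3" for k
  proof -
    have "d k = (if k = 0 \<or> k = 1 then d 1 else 0) + (if k = 0 \<or> k = 2 then d 2 else 0)"
      using less3D[OF k] deg by auto
    then obtain \<mu> where "continuous_on (rim k) \<mu>"
      "\<And>b. b \<in> rim k \<Longrightarrow> T k b powi d k = (push k e b - c 1) powi d 1 * (push k e b - c 2) powi d 2 * exp (\<mu> b)"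
      using boundary_log[OF k e \<gamma>[OF k], of "T k"] T[OF k] by metis
    then show ?thesis unfolding W0_def by blast
  qed
  then obtain \<mu> where \<mu>: "\<And>k. k < 3 \<Longrightarrow> continuous_on (rim k) (\<mu> k)"
    "\<And>k b. k < 3 \<Longrightarrow> b \<in> rim k \<Longrightarrow> T k b powi d k = W0 (push k e b) * exp (\<mu> k b)"
    by metis
  \<comment> \<open>These are the inner edges of the collars of width \<open>e\<close>, disjoint
    because \<open>2 * e < gap\<close>. The logarithms are carried to them from the rims by
    \<open>proj\<close> and form one continuous function on their union.\<close>
  define S where "S k = {x \<in> core e. depth k x = e}" for k
  define \<nu> where "\<nu> x = (if depth 0 x = e then \<mu> 0 (proj 0 x)
      else if depth 1 x = e then \<mu> 1 (proj 1 x) else \<mu> 2 (proj 2 x))" for x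
  have disj: "j = k" if "x \<in> S j" "x \<in> S k" "j < 3" "k < 3" for j k x
    using depth_sum_ge_gap[of j k x] that e by (auto simp: S_def)
  have \<nu>: "\<nu> x = \<mu> k (proj k x)" if "x \<in> S k" "k < 3" for x k
    using disj[of x _ k] that less3D[OF that(2)] by (auto simp: \<nu>_def S_def)
  have clS: "closed (S k)" for k
  proof -
    have "S k = core e \<inter> {x. depth k x = e}" by (auto simp: S_def)
    moreover have "closed {x. depth k x = e}" by (intro closed_Collect_eq continuous_intros)
    ultimately show ?thesis using closed_core by auto
  qed
  have ncS: "x \<noteq> c k" if "x \<in> S k" "k < 3" for x k
    using not_center[of k x] that e core_mono[OF e(1)] by (auto simp: S_def)
  have "continuous_on (S k) \<nu>" if k: "k < 3" for k
  proof -
    have "continuous_on (S k) (\<lambda>x. \<mu> k (proj k x))"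
      using ncS k proj_in_rim
      by (intro continuous_on_compose2[OF \<mu>(1)[OF k]] continuous_intros) auto
    then show ?thesis by (rule continuous_on_eq) (use \<nu> k in auto)
  qed
  then have "continuous_on (\<Union>k\<in>{..<3}. S k) \<nu>"
    using clS by (intro continuous_on_closed_Union) auto
  moreover have "closedin (top_of_set (core e)) (\<Union>k\<in>{..<3}. S k)"
    using clS by (intro closed_subset) (auto simp: S_def)
  ultimately obtain N where N: "continuous_on (core e) N" "\<And>x. x \<in> (\<Union>k\<in>{..<3}. S k) \<Longrightarrow> N x = \<nu> x"
    using Dugundji[of "UNIV :: complex set" "core e" "\<Union>k\<in>{..<3}. S k" \<nu>]
    by (metis convex_UNIV UNIV_not_empty subset_UNIV)
  \<comment> \<open>The product has no zero on the core, and normalising it does not change its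
    values on the edges, which already have norm \<open>1\<close>.\<close>
  define W where "W x = sgn (W0 x * exp (N x))" for x
  show ?thesis
  proof (rule that[of W])
    show "continuous_on (core e) W"
      unfolding W_def by (intro continuous_on_sgn_complex continuous_intros contW0 N) (use W0 in auto)
    show "norm (W x) = 1" if "x \<in> core e" for x
      using W0[OF that] by (simp add: W_def norm_sgn)
    fix k b assume k: "k < (3::nat)" and b: "b \<in> rim k"
    have e': "e < gap" using e gap_pos by linarith
    have p: "push k e b \<in> S k"
      using push_in_core[OF k b e(1) e', of e] depth_push[OF k b, of e]
        radius_side_pos[OF k e(1) e'] e by (simp add: S_def)
    have "N (push k e b) = \<mu> k b"
    proof -
      have "push k e b \<in> (\<Union>k\<in>{..<3}. S k)" using p k by blast
      then show ?thesis using N(2) \<nu>[OF p k] proj_push[OF k b e(1) e'] by simp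
    qed
    then have "W (push k e b) = sgn (T k b powi d k)"
      using \<mu>(2)[OF k b] by (simp add: W_def)
    moreover have "norm (T k b) = 1"
    proof -
      obtain t where "t \<in> {0..1}" "b = \<gamma> k t"
        using \<gamma>[OF k] b unfolding boundary_loop_def path_image_def by (metis imageE)
      then show ?thesis using T[OF k] by simp
    qed
    ultimately show "W (push k e b) = T k b powi d k"
      by (simp add: sgn_div_norm norm_power_int)
  qed
qed

end

section \<open>Gluing pants to the earring\<close>

text \<open>After this the equivalence classes no longer appear: all that is used of the adjunction
  space is which values of the two coordinate maps coincide and which sets are open.\<close>

lemma adjunction_space_coordinates:
  assumes "A \<subseteq> topspace Y" "f ` A \<subseteq> topspace X"
  obtains qX :: "'a \<Rightarrow> ('a + 'b) set" and qY where
    "\<And>x x'. qX x = qX x' \<longleftrightarrow> x = x'"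
    "\<And>x y. qY y = qX x \<longleftrightarrow> y \<in> A \<and> x = f y"
    "\<And>y y'. qY y = qY y' \<longleftrightarrow> y = y' \<or> y \<in> A \<and> y' \<in> A \<and> f y = f y'"
    "topspace (adjunction_space X Y A f) = qX ` topspace X \<union> qY ` topspace Y"
    "\<And>U. openin (adjunction_space X Y A f) U \<longleftrightarrow>
       U \<subseteq> topspace (adjunction_space X Y A f) \<and>
       openin X {x \<in> topspace X. qX x \<in> U} \<and> openin Y {y \<in> topspace Y. qY y \<in> U}"
proof -
  define r where "r = {(Inr y :: 'a + 'b, Inl (f y) :: 'a + 'b) |y. y \<in> A}"
  define R where "R = (r \<union> r\<inverse>)\<^sup>*"
  \<comment> \<open>A normal form: each generating identification preserves \<open>rep\<close>, and
    every point is related to its normal form. So the classes are the fibres of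
    \<open>rep\<close>.\<close>
  define rep where "rep u = (case u of Inl x \<Rightarrow> Inl x | Inr y \<Rightarrow> if y \<in> A then Inl (f y) else Inr y)"
    for u :: "'a + 'b"
  have symR: "(v, u) \<in> R" if "(u, v) \<in> R" for u v
  proof -
    have "sym R" unfolding R_def by (intro sym_rtrancl sym_Un_converse)
    then show ?thesis using that by (simp add: sym_def)
  qed
  have transR: "(u, w) \<in> R" if "(u, v) \<in> R" "(v, w) \<in> R" for u v w
    using that unfolding R_def by (rule rtrancl_trans)
  have repR: "(u, rep u) \<in> R" for u
    by (cases u) (auto simp: rep_def R_def r_def)
  have R_iff: "(u, v) \<in> R \<longleftrightarrow> rep u = rep v" for u v
  proof
    assume "(u, v) \<in> R"
    then show "rep u = rep v"
      unfolding R_def by (induction rule: rtrancl_induct) (auto simp: r_def rep_def)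
  next
    assume "rep u = rep v"
    then show "(u, v) \<in> R" using repR[of u] symR[OF repR[of v]] transR by metis
  qed
  have class_eq: "R `` {u} = R `` {v} \<longleftrightarrow> rep u = rep v" for u v
  proof
    assume "R `` {u} = R `` {v}"
    moreover have "u \<in> R `` {u}" by (simp add: R_iff)
    ultimately have "(v, u) \<in> R" by blast
    then show "rep u = rep v" by (simp add: R_iff)
  qed (auto simp: R_iff)
  have T: "adjunction_space X Y A f = quotient_topology (binary_sum_topology X Y) R"
    by (simp add: adjunction_space_def R_def r_def Let_def)
  have top: "topspace (adjunction_space X Y A f) =
      (\<lambda>x. R `` {Inl x}) ` topspace X \<union> (\<lambda>y. R `` {Inr y}) ` topspace Y"
    by (auto simp: T quotient_def)
  have "Inl -` {z \<in> topspace X <+> topspace Y. R `` {z} \<in> U} = {x \<in> topspace X. R `` {Inl x} \<in> U}"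
    "Inr -` {z \<in> topspace X <+> topspace Y. R `` {z} \<in> U} = {y \<in> topspace Y. R `` {Inr y} \<in> U}" for U
    by auto
  then have "openin (adjunction_space X Y A f) U \<longleftrightarrow>
       U \<subseteq> topspace (adjunction_space X Y A f) \<and>
       openin X {x \<in> topspace X. R `` {Inl x} \<in> U} \<and> openin Y {y \<in> topspace Y. R `` {Inr y} \<in> U}" for U
    by (simp add: T openin_quotient_topology openin_binary_sum_topology)
  with top show ?thesis
    by (intro that[of "\<lambda>x. R `` {Inl x}" "\<lambda>y. R `` {Inr y}"])
       (auto simp: class_eq rep_def split: if_splits)
qed

section \<open>The earring with the pants attached along their boundary circles\<close>

definition circle_index :: "nat \<Rightarrow> nat \<Rightarrow> nat" where
  "circle_index n k = (if k = 0 then n else if k = 1 then 2 * n else 2 * n + 1)"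

lemma circle_index_ge: "n \<ge> 1 \<Longrightarrow> circle_index n k \<ge> 1"
  by (simp add: circle_index_def)

lemma pants_flow_circle_index:
  "n \<ge> 1 \<Longrightarrow> pants_flow p (circle_index n 0) = pants_flow p (circle_index n 1) + pants_flow p (circle_index n 2)"
  using pants_flow_children[of n p] by (simp add: circle_index_def)

text \<open>Only the pants with \<open>n \<ge> 1\<close> matter. The first assumption includes \<open>n = 0\<close> so that the sublocale
  below has no side condition.\<close>

locale hawaiian_pants_gluing =
  fixes c :: "nat \<Rightarrow> nat \<Rightarrow> complex" and \<rho> :: "nat \<Rightarrow> nat \<Rightarrow> real"
    and \<gamma> :: "nat \<Rightarrow> nat \<Rightarrow> real \<Rightarrow> complex" and f :: "nat \<Rightarrow> complex \<Rightarrow> complex"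
    and X :: "'p topology" and qH :: "complex \<Rightarrow> 'p" and qP :: "nat \<Rightarrow> complex \<Rightarrow> 'p"
  assumes round: "round_pants (c n) (\<rho> n)"
    and loops: "k < 3 \<Longrightarrow> round_pants.boundary_loop (c n) (\<rho> n) k (\<gamma> n k)"
    and cont_f: "n \<ge> 1 \<Longrightarrow> k < 3 \<Longrightarrow> continuous_on (round_pants.rim (c n) (\<rho> n) k) (f n)"
    and f_\<gamma>: "n \<ge> 1 \<Longrightarrow> k < 3 \<Longrightarrow> t \<in> {0..1} \<Longrightarrow> f n (\<gamma> n k t) = hawaiian_loop (circle_index n k) t"
    and qH_inj: "qH y = qH y' \<longleftrightarrow> y = y'"
    and qP_rim: "n \<ge> 1 \<Longrightarrow> k < 3 \<Longrightarrow> x \<in> round_pants.rim (c n) (\<rho> n) k \<Longrightarrow> qP n x = qH (f n x)"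
    and qP_eq_qH: "n \<ge> 1 \<Longrightarrow> qP n x = qH y \<Longrightarrow> \<exists>k<3. x \<in> round_pants.rim (c n) (\<rho> n) k"
    and qP_inj: "n \<ge> 1 \<Longrightarrow> n' \<ge> 1 \<Longrightarrow> qP n x = qP n' x' \<Longrightarrow>
      n = n' \<and> x = x' \<or> (\<exists>k<3. x \<in> round_pants.rim (c n) (\<rho> n) k)"
    and topspace_X: "topspace X = qH ` hawaiian_earring \<union>
      (\<Union>n\<in>{1..}. qP n ` round_pants.core (c n) (\<rho> n) 0)"
    and openin_X: "openin X U \<longleftrightarrow> U \<subseteq> topspace X \<and>
      openin (top_of_set hawaiian_earring) {y \<in> hawaiian_earring. qH y \<in> U} \<and>
      (\<forall>n\<ge>1. openin (top_of_set (round_pants.core (c n) (\<rho> n) 0))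
         {x \<in> round_pants.core (c n) (\<rho> n) 0. qP n x \<in> U})"
begin

sublocale P: round_pants "c n" "\<rho> n" for n
  by (rule round)

abbreviation "pants n \<equiv> P.core n 0"

lemma qH_in: "y \<in> hawaiian_earring \<Longrightarrow> qH y \<in> topspace X"
  by (auto simp: topspace_X)

lemma qP_in: "n \<ge> 1 \<Longrightarrow> x \<in> pants n \<Longrightarrow> qP n x \<in> topspace X"
  by (auto simp: topspace_X)

lemma openin_X_H: "openin X U \<Longrightarrow> openin (top_of_set hawaiian_earring) {y \<in> hawaiian_earring. qH y \<in> U}"
  by (subst (asm) openin_X) blast

lemma openin_X_P: "openin X U \<Longrightarrow> n \<ge> 1 \<Longrightarrow> openin (top_of_set (pants n)) {x \<in> pants n. qP n x \<in> U}"
  by (subst (asm) openin_X) blast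

lemma continuous_qH: "continuous_map (top_of_set hawaiian_earring) X qH"
  unfolding continuous_map_def by (simp add: openin_X_H qH_in)

lemma continuous_qP: "n \<ge> 1 \<Longrightarrow> continuous_map (top_of_set (pants n)) X (qP n)"
  unfolding continuous_map_def by (simp add: openin_X_P qP_in)

text \<open>Openness in \<open>X\<close> is tested on the earring and on each pair of pants
  separately. Because \<open>S\<close> is open, this test also applies to subsets of
  \<open>S\<close>.\<close>

lemma continuous_map_glued:
  assumes "openin X S"
    and H: "continuous_map (top_of_set {y \<in> hawaiian_earring. qH y \<in> S}) Z (\<lambda>y. F (qH y))"
    and P: "\<And>n. n \<ge> 1 \<Longrightarrow> continuous_map (top_of_set {x \<in> pants n. qP n x \<in> S}) Z (\<lambda>x. F (qP n x))"
  shows "continuous_map (subtopology X S) Z F"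
  unfolding continuous_map_def
proof (intro conjI allI impI)
  have S: "S \<subseteq> topspace X" using assms(1) by (rule openin_subset)
  have FZ: "F p \<in> topspace Z" if p: "p \<in> S" for p
  proof -
    have "p \<in> topspace X" using p S by blast
    then consider y where "y \<in> hawaiian_earring" "p = qH y"
      | n x where "n \<ge> 1" "x \<in> pants n" "p = qP n x"
      unfolding topspace_X by auto
    then show ?thesis
      using H P p unfolding continuous_map_def by cases (auto simp: Pi_iff)
  qed
  then show "F \<in> topspace (subtopology X S) \<rightarrow> topspace Z" by auto
  fix U assume U: "openin Z U"
  have "openin X {p \<in> S. F p \<in> U}"
  proof (subst openin_X, intro conjI allI impI)
    show "{p \<in> S. F p \<in> U} \<subseteq> topspace X" using S by auto
    have "openin (top_of_set {y \<in> hawaiian_earring. qH y \<in> S})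
        {y \<in> {y \<in> hawaiian_earring. qH y \<in> S}. F (qH y) \<in> U}"
      using openin_continuous_map_preimage[OF H U] by simp
    from openin_trans[OF this openin_X_H[OF assms(1)]]
    show "openin (top_of_set hawaiian_earring) {y \<in> hawaiian_earring. qH y \<in> {p \<in> S. F p \<in> U}}"
      by (simp add: conj_assoc)
    fix n :: nat assume n: "n \<ge> 1"
    have "openin (top_of_set {x \<in> pants n. qP n x \<in> S}) {x \<in> {x \<in> pants n. qP n x \<in> S}. F (qP n x) \<in> U}"
      using openin_continuous_map_preimage[OF P[OF n] U] by simp
    moreover have "openin (top_of_set (pants n)) {x \<in> pants n. qP n x \<in> S}"
      using assms(1) n by (rule openin_X_P)
    ultimately have "openin (top_of_set (pants n)) {x \<in> {x \<in> pants n. qP n x \<in> S}. F (qP n x) \<in> U}"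
      by (rule openin_trans)
    then show "openin (top_of_set (pants n)) {x \<in> pants n. qP n x \<in> {p \<in> S. F p \<in> U}}"
      by (simp add: conj_assoc)
  qed
  moreover have "{p \<in> topspace (subtopology X S). F p \<in> U} = {p \<in> S. F p \<in> U}" using S by auto
  ultimately show "openin (subtopology X S) {p \<in> topspace (subtopology X S). F p \<in> U}"
    using assms(1) by (simp add: openin_open_subtopology)
qed

text \<open>Only rim points are identified with other points, and there the assumption reduces the
  value to that of \<open>h1\<close> on the earring. All other points of the pants have a unique
  representative.\<close>

lemma glued_function_exists:
  assumes "\<And>n k x. n \<ge> 1 \<Longrightarrow> k < 3 \<Longrightarrow> x \<in> P.rim n k \<Longrightarrow> h2 n x = h1 (f n x)"
  obtains F where "\<And>y. F (qH y) = h1 y" "\<And>n x. n \<ge> 1 \<Longrightarrow> F (qP n x) = h2 n x"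
proof -
  define F where "F p = (if p \<in> range qH then h1 (inv qH p)
      else case (SOME (n, x). n \<ge> 1 \<and> qP n x = p) of (n, x) \<Rightarrow> h2 n x)" for p
  have inj: "inj qH" using qH_inj by (auto simp: inj_def)
  have 1: "F (qH y) = h1 y" for y using inj by (simp add: F_def)
  have 2: "F (qP n x) = h2 n x" if n: "n \<ge> 1" for n x
  proof (cases "\<exists>k<3. x \<in> P.rim n k")
    case True
    then show ?thesis using qP_rim[OF n] assms[OF n] 1 by metis
  next
    case False
    have nr: "qP n x \<notin> range qH" using qP_eq_qH[OF n] False by blast
    have "(SOME (n', x'). n' \<ge> 1 \<and> qP n' x' = qP n x) = (n, x)"
    proof (rule some_equality)
      show "case (n, x) of (n', x') \<Rightarrow> n' \<ge> 1 \<and> qP n' x' = qP n x" using n by simp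
      fix z assume "case z of (n', x') \<Rightarrow> n' \<ge> 1 \<and> qP n' x' = qP n x"
      then have "fst z \<ge> 1" "qP n x = qP (fst z) (snd z)" by auto
      then show "z = (n, x)" using qP_inj[OF n] False by (metis prod.collapse)
    qed
    then show ?thesis using nr by (simp add: F_def)
  qed
  show ?thesis using that 1 2 by blast
qed

lemma rim_loop:
  assumes "k < 3"
  shows "simple_path (\<gamma> n k)" "\<gamma> n k ` {0..1} = P.rim n k" "\<gamma> n k 1 = \<gamma> n k 0"
  using loops[OF assms, of n]
  by (auto simp: P.boundary_loop_def path_image_def pathfinish_def pathstart_def)

lemma f_rim_image:
  assumes "n \<ge> 1" "k < 3"
  shows "f n ` P.rim n k = hawaiian_circle (circle_index n k)"
proof -
  have "f n ` P.rim n k = (\<lambda>t. f n (\<gamma> n k t)) ` {0..1}"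
    using rim_loop(2)[OF assms(2), of n] by (metis image_image)
  also have "\<dots> = hawaiian_loop (circle_index n k) ` {0..1}"
    using f_\<gamma>[OF assms] by (intro image_cong) auto
  finally show ?thesis using hawaiian_loop_image circle_index_ge[OF assms(1)] by simp
qed

lemma f_rim: "n \<ge> 1 \<Longrightarrow> k < 3 \<Longrightarrow> b \<in> P.rim n k \<Longrightarrow> f n b \<in> hawaiian_circle (circle_index n k)"
  using f_rim_image by blast

text \<open>The boundary loop and the loop of the earring identify only their endpoints, so
  \<open>f n\<close> matches each rim with its circle bijectively. By compactness the inverse
  \<open>lift\<close> is continuous.\<close>

lemma f_rim_inj:
  assumes "n \<ge> 1" "k < 3"
  shows "inj_on (f n) (P.rim n k)"
proof
  fix a b assume ab: "a \<in> P.rim n k" "b \<in> P.rim n k" "f n a = f n b"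
  obtain s where s: "s \<in> {0..1}" "a = \<gamma> n k s" using ab(1) rim_loop(2)[OF assms(2), of n] by (metis imageE)
  obtain t where t: "t \<in> {0..1}" "b = \<gamma> n k t" using ab(2) rim_loop(2)[OF assms(2), of n] by (metis imageE)
  have "hawaiian_loop (circle_index n k) s = hawaiian_loop (circle_index n k) t"
    using ab(3) f_\<gamma>[OF assms] s t by simp
  from hawaiian_loop_eq_iff[OF circle_index_ge[OF assms(1)] s(1) t(1) this]
  show "a = b" using s(2) t(2) rim_loop(3)[OF assms(2), of n] by auto
qed

definition lift :: "nat \<Rightarrow> nat \<Rightarrow> complex \<Rightarrow> complex" where
  "lift n k = inv_into (P.rim n k) (f n)"

lemma
  assumes "n \<ge> 1" "k < 3"
  shows lift_f: "b \<in> P.rim n k \<Longrightarrow> lift n k (f n b) = b"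
    and f_lift: "y \<in> hawaiian_circle (circle_index n k) \<Longrightarrow> f n (lift n k y) = y"
    and lift_in: "y \<in> hawaiian_circle (circle_index n k) \<Longrightarrow> lift n k y \<in> P.rim n k"
    and continuous_on_lift: "continuous_on (hawaiian_circle (circle_index n k)) (lift n k)"
proof -
  note im = f_rim_image[OF assms]
  show l: "lift n k (f n b) = b" if "b \<in> P.rim n k" for b
    using that f_rim_inj[OF assms] by (simp add: lift_def)
  show "f n (lift n k y) = y" if "y \<in> hawaiian_circle (circle_index n k)" for y
    using that im by (simp add: lift_def f_inv_into_f)
  show "lift n k y \<in> P.rim n k" if "y \<in> hawaiian_circle (circle_index n k)" for y
    using that im by (metis lift_def inv_into_into)
  show "continuous_on (hawaiian_circle (circle_index n k)) (lift n k)"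
    using continuous_on_inv[OF cont_f[OF assms], of "lift n k"] l im by (simp add: P.rim_def)
qed

end

section \<open>Maps into the glued space and thin collars in open sets\<close>

context hawaiian_pants_gluing
begin

lemma continuous_map_qH_comp:
  assumes "continuous_on S g" "g ` S \<subseteq> hawaiian_earring"
  shows "continuous_map (top_of_set S) X (\<lambda>x. qH (g x))"
proof -
  have "continuous_map (top_of_set S) (top_of_set hawaiian_earring) g"
    using assms by (auto simp: continuous_map_in_subtopology)
  from continuous_map_compose[OF this continuous_qH] show ?thesis by (simp add: o_def)
qed

lemma continuous_map_qP_comp:
  assumes "continuous_on S g" "g ` S \<subseteq> pants n" "n \<ge> 1"
  shows "continuous_map (top_of_set S) X (\<lambda>x. qP n (g x))"
proof -
  have "continuous_map (top_of_set S) (top_of_set (pants n)) g"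
    using assms by (auto simp: continuous_map_in_subtopology)
  from continuous_map_compose[OF this continuous_qP[OF assms(3)]] show ?thesis by (simp add: o_def)
qed

text \<open>Compactness of \<open>K\<close> gives one width for all its points. The width may depend
  on \<open>n\<close>, since the topology of \<open>X\<close> imposes no uniformity over the
  pants.\<close>

lemma thin_collar:
  assumes "n \<ge> 1" "k < 3" "openin X W" "compact K" "K \<subseteq> P.rim n k" "\<And>b. b \<in> K \<Longrightarrow> qP n b \<in> W"
  obtains e where "e > 0" "\<And>b s. b \<in> K \<Longrightarrow> 0 \<le> s \<Longrightarrow> s \<le> e \<Longrightarrow> qP n (P.push n k s b) \<in> W"
proof (cases "K = {}")
  case True
  then show ?thesis using that[of 1] by simp
next
  case False
  obtain O' where O: "open O'" "{x \<in> pants n. qP n x \<in> W} = pants n \<inter> O'"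
    using openin_X_P[OF assms(3,1)] by (auto simp: openin_open)
  have "K \<subseteq> O'" using O(2) assms(5,6) P.rim_subset_core[OF assms(2), of n] by blast
  then obtain e where e: "e > 0" "{x. infdist x K \<le> e} \<subseteq> O'"
    using compact_in_open_separated[OF False assms(4) O(1)] by metis
  show ?thesis
  proof (rule that[of "min e (P.gap n / 2)"])
    show "0 < min e (P.gap n / 2)" using e(1) P.gap_pos by simp
    fix b s assume b: "b \<in> K" and s: "0 \<le> s" "s \<le> min e (P.gap n / 2)"
    have sg: "s < P.gap n" using s(2) P.gap_pos[of n] by linarith
    have br: "b \<in> P.rim n k" using b assms(5) by blast
    have "infdist (P.push n k s b) K \<le> s"
      using infdist_le[OF b, of "P.push n k s b"] P.dist_push[OF assms(2) br, of s] s(1) by simp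
    then have "P.push n k s b \<in> O'" using e(2) s(2) by auto
    moreover have "P.push n k s b \<in> pants n"
      using P.push_in_core[OF assms(2) br s(1) sg, of 0] s(1) sg by simp
    ultimately show "qP n (P.push n k s b) \<in> W" using O(2) by blast
  qed
qed

end

section \<open>Points away from the earring\<close>

context hawaiian_pants_gluing
begin

definition inner_pants :: "nat \<Rightarrow> complex set" where
  "inner_pants n = {x. \<forall>k<3. P.depth n k x > 0}"

lemma open_inner_pants: "open (inner_pants n)"
  unfolding inner_pants_def by (rule P.open_inner)

lemma inner_subset: "inner_pants n \<subseteq> pants n"
  by (auto simp: inner_pants_def P.core_def intro: less_imp_le)

lemma inner_in: "x \<in> inner_pants n \<Longrightarrow> x \<in> pants n"
  using inner_subset by blast

lemma qP_inner_eq: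
  assumes "n \<ge> 1" "n' \<ge> 1" "qP n x = qP n' x'" "x \<in> inner_pants n"
  shows "n' = n \<and> x' = x"
  using qP_inj[OF assms(1,2,3)] assms(4) by (auto simp: inner_pants_def P.rim_depth)

lemma qH_notin_inner: "n \<ge> 1 \<Longrightarrow> S \<subseteq> inner_pants n \<Longrightarrow> qH y \<notin> qP n ` S"
  using qP_eq_qH[of n _ y] by (fastforce simp: inner_pants_def P.rim_depth)

lemma qP_inner_preimage:
  assumes "n \<ge> 1" "m \<ge> 1" "S \<subseteq> inner_pants n"
  shows "{x \<in> pants m. qP m x \<in> qP n ` S} = (if m = n then S else {})"
proof (intro set_eqI iffI)
  fix x assume "x \<in> {x \<in> pants m. qP m x \<in> qP n ` S}"
  then obtain y where y: "y \<in> S" "qP n y = qP m x" by force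
  have "m = n \<and> x = y" by (rule qP_inner_eq[OF assms(1,2) y(2)]) (use y(1) assms(3) in blast)
  then show "x \<in> (if m = n then S else {})" using y(1) by simp
next
  fix x assume "x \<in> (if m = n then S else {})"
  then have "m = n" "x \<in> S" by (simp_all split: if_splits)
  moreover have "S \<subseteq> pants n" using assms(3) inner_subset by (rule order_trans)
  ultimately show "x \<in> {x \<in> pants m. qP m x \<in> qP n ` S}" by auto
qed

lemma openin_inner_image:
  assumes "n \<ge> 1" "open S" "S \<subseteq> inner_pants n"
  shows "openin X (qP n ` S)"
proof (subst openin_X, intro conjI allI impI)
  show "qP n ` S \<subseteq> topspace X" using qP_in[OF assms(1)] inner_subset assms(3) by blast
  have "{y \<in> hawaiian_earring. qH y \<in> qP n ` S} = {}" using qH_notin_inner[OF assms(1,3)] by blast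
  then show "openin (top_of_set hawaiian_earring) {y \<in> hawaiian_earring. qH y \<in> qP n ` S}"
    by (simp only: openin_empty)
  have "openin (top_of_set (pants n)) S"
    using assms(2) by (intro open_subset order_trans[OF assms(3) inner_subset])
  then show "openin (top_of_set (pants m)) {x \<in> pants m. qP m x \<in> qP n ` S}" if "m \<ge> 1" for m
    unfolding qP_inner_preimage[OF assms(1) that assms(3)] by simp
qed

lemma inner_chart:
  assumes "n \<ge> 1"
  obtains Q where "continuous_map (subtopology X (qP n ` inner_pants n)) euclidean Q"
    "\<And>x. x \<in> inner_pants n \<Longrightarrow> Q (qP n x) = x"
proof -
  define Q where "Q = inv_into (inner_pants n) (qP n)"
  have "inj_on (qP n) (inner_pants n)"
    using qP_inner_eq[OF assms assms] by (auto intro!: inj_onI)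
  then have Q: "Q (qP n x) = x" if "x \<in> inner_pants n" for x using that by (simp add: Q_def inv_into_f_f)
  have "continuous_map (subtopology X (qP n ` inner_pants n)) euclidean Q"
  proof (rule continuous_map_glued[OF openin_inner_image[OF assms open_inner_pants order_refl]])
    have "{y \<in> hawaiian_earring. qH y \<in> qP n ` inner_pants n} = {}"
      using qH_notin_inner[OF assms order_refl] by blast
    then show "continuous_map (top_of_set {y \<in> hawaiian_earring. qH y \<in> qP n ` inner_pants n}) euclidean (\<lambda>y. Q (qH y))"
      by (simp only:) simp
    show "continuous_map (top_of_set {x \<in> pants m. qP m x \<in> qP n ` inner_pants n}) euclidean (\<lambda>x. Q (qP m x))"
      if "m \<ge> 1" for m
      unfolding qP_inner_preimage[OF assms that order_refl]
      using Q by (cases "m = n") (auto intro: continuous_on_eq[OF continuous_on_id])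
  qed
  then show ?thesis using that Q by blast
qed

text \<open>Such a point has a chart onto a planar ball. The boundary values of any disk, read in
  the chart, extend over the disk within this convex ball, whatever the given disk does
  elsewhere.\<close>

lemma one_UV0_at_inner:
  assumes n: "n \<ge> 1" and x: "x \<in> inner_pants n"
  shows "one_UV0_at X (qP n x)"
  unfolding one_UV0_at_def
proof (intro allI impI, elim conjE exE)
  fix U W assume U: "U \<subseteq> topspace X" and W: "openin X W" "qP n x \<in> W" "W \<subseteq> U"
  obtain O' where O: "open O'" "{x \<in> pants n. qP n x \<in> W} = pants n \<inter> O'"
    using openin_X_P[OF W(1) n] by (auto simp: openin_open)
  have "x \<in> O' \<inter> inner_pants n" using O(2) W(2) x inner_subset by blast
  moreover have "open (O' \<inter> inner_pants n)" using O(1) open_inner_pants by (rule open_Int)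
  ultimately obtain e where e: "e > 0" "ball x e \<subseteq> O' \<inter> inner_pants n" by (meson open_contains_ball)
  define V where "V = qP n ` ball x e"
  have bW: "qP n y \<in> W" if "y \<in> ball x e" for y
    using that e(2) O(2) inner_subset by blast
  have bi: "ball x e \<subseteq> inner_pants n" using e(2) by blast
  obtain Q where Q: "continuous_map (subtopology X (qP n ` inner_pants n)) euclidean Q"
    "\<And>x. x \<in> inner_pants n \<Longrightarrow> Q (qP n x) = x" using inner_chart[OF n] by metis
  have fill: "\<exists>g. continuous_map (top_of_set (cball 0 1)) (subtopology X U) g \<and> (\<forall>z\<in>sphere 0 1. u z = g z)"
    if u: "continuous_map (top_of_set (cball (0::complex) 1)) X u" "u ` sphere 0 1 \<subseteq> V" for u
  proof -
    have "continuous_map (top_of_set (sphere 0 1)) (subtopology X (qP n ` inner_pants n)) u"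
    proof -
      have "u \<in> sphere 0 1 \<rightarrow> qP n ` inner_pants n" using u(2) bi unfolding V_def by blast
      moreover have "continuous_map (top_of_set (sphere 0 1)) X u"
        by (rule continuous_map_from_subtopology_mono[OF u(1)]) auto
      ultimately show ?thesis by (simp add: continuous_map_in_subtopology)
    qed
    from continuous_map_compose[OF this Q(1)]
    have contQu: "continuous_on (sphere 0 1) (Q \<circ> u)" by simp
    have Qu: "Q (u z) \<in> ball x e \<and> qP n (Q (u z)) = u z" if "z \<in> sphere 0 1" for z
    proof -
      have "u z \<in> V" using u(2) that by blast
      then obtain y where y: "y \<in> ball x e" "u z = qP n y" unfolding V_def by blast
      then have "Q (u z) = y" using Q(2)[of y] bi by auto
      then show ?thesis using y by simp
    qed
    have img: "(Q \<circ> u) ` sphere 0 1 \<subseteq> ball x e"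
      unfolding o_def using Qu by blast
    have clo: "closedin (top_of_set (cball 0 1)) (sphere (0::complex) 1)"
      by (intro closed_subset) auto
    have ne: "ball x e \<noteq> {}" using e(1) by simp
    obtain g where g: "continuous_on (cball 0 1) g" "g ` cball 0 1 \<subseteq> ball x e"
      "\<And>z. z \<in> sphere 0 1 \<Longrightarrow> g z = (Q \<circ> u) z"
      using Dugundji[OF convex_ball ne clo contQu img] by blast
    have "continuous_map (top_of_set (cball 0 1)) X (\<lambda>z. qP n (g z))"
      by (rule continuous_map_qP_comp[OF g(1) _ n]) (use g(2) bi inner_subset in blast)
    moreover have "(\<lambda>z. qP n (g z)) \<in> cball 0 1 \<rightarrow> U" using g(2) bW W(3) by blast
    ultimately have "continuous_map (top_of_set (cball 0 1)) (subtopology X U) (\<lambda>z. qP n (g z))"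
      by (simp add: continuous_map_in_subtopology)
    moreover have "u z = qP n (g z)" if "z \<in> sphere 0 1" for z
      using g(3)[OF that] Qu[OF that] by simp
    ultimately show ?thesis by blast
  qed
  show "\<exists>V. openin X V \<and> qP n x \<in> V \<and> V \<subseteq> U \<and>
      (\<forall>f. continuous_map (top_of_set (cball (0::complex) 1)) X f \<and> f ` sphere 0 1 \<subseteq> V \<longrightarrow>
        (\<exists>g. continuous_map (top_of_set (cball 0 1)) (subtopology X U) g \<and> (\<forall>z\<in>sphere 0 1. f z = g z)))"
  proof (intro exI[of _ V] conjI allI impI)
    show "openin X V" unfolding V_def by (rule openin_inner_image[OF n open_ball bi])
    show "qP n x \<in> V" "V \<subseteq> U" using e(1) bW W(3) by (auto simp: V_def)
  qed (elim conjE, rule fill)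
qed

end

section \<open>The retraction of the infinite cyclic cover\<close>

text \<open>The filling has to stay in \<open>W0\<close>. The map \<open>\<phi>\<close> folds the
  earring into \<open>W0\<close> and is the identity on \<open>W'\<close>. By
  \<open>\<phi>_circle\<close> a circle is either preserved, so that the fold lifts to the rims
  attached to it, or it misses \<open>W'\<close> and nothing has to be fixed near it. The collar
  width \<open>\<epsilon> n\<close> is so small that the lifted folds stay in \<open>W0\<close> when
  pushed into the pants.\<close>

locale hawaiian_pants_retraction = hawaiian_pants_gluing +
  fixes W0 :: "'a set" and W' :: "complex set" and \<phi> :: "complex \<Rightarrow> complex" and \<epsilon> :: "nat \<Rightarrow> real"
  assumes open_W0: "openin X W0"
    and open_W': "openin (top_of_set hawaiian_earring) W'"
    and cont_\<phi>: "continuous_on hawaiian_earring \<phi>"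
    and \<phi>_in: "y \<in> hawaiian_earring \<Longrightarrow> \<phi> y \<in> hawaiian_earring"
    and \<phi>_W0: "y \<in> hawaiian_earring \<Longrightarrow> qH (\<phi> y) \<in> W0"
    and \<phi>_id: "y \<in> W' \<Longrightarrow> \<phi> y = y"
    and \<phi>_circle: "m \<ge> 1 \<Longrightarrow> \<phi> ` hawaiian_circle m \<subseteq> hawaiian_circle m \<or> W' \<inter> hawaiian_circle m = {}"
    and \<epsilon>_pos: "n \<ge> 1 \<Longrightarrow> 0 < \<epsilon> n"
    and \<epsilon>_gap: "n \<ge> 1 \<Longrightarrow> 2 * \<epsilon> n < round_pants.gap (c n) (\<rho> n)"
    and \<epsilon>_W0: "n \<ge> 1 \<Longrightarrow> k < 3 \<Longrightarrow>
      \<phi> ` hawaiian_circle (circle_index n k) \<subseteq> hawaiian_circle (circle_index n k) \<Longrightarrow>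
      y \<in> hawaiian_circle (circle_index n k) \<Longrightarrow> 0 \<le> s \<Longrightarrow> s \<le> \<epsilon> n \<Longrightarrow>
      qP n (round_pants.push (c n) (\<rho> n) k s (lift n k (\<phi> y))) \<in> W0"
begin

abbreviation circle :: "nat \<Rightarrow> nat \<Rightarrow> complex set" where
  "circle n k \<equiv> hawaiian_circle (circle_index n k)"

definition collar :: "nat \<Rightarrow> nat \<Rightarrow> complex set" where
  "collar n k = {x \<in> pants n. P.depth n k x \<le> \<epsilon> n}"

definition foot :: "nat \<Rightarrow> nat \<Rightarrow> complex \<Rightarrow> complex" where
  "foot n k x = f n (P.proj n k x)"

text \<open>On the sheet \<open>0\<close> the depth first increases with unit speed and then decreases to \<open>0\<close>. So the map is
  the identity close to the rim, and it depends only on the foot point at the inner edge.\<close>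

definition collar_map :: "int \<Rightarrow> nat \<Rightarrow> nat \<Rightarrow> complex \<Rightarrow> 'a" where
  "collar_map i n k x =
     (if i = 0 \<and> \<phi> ` circle n k \<subseteq> circle n k
      then qP n (P.push n k (min (P.depth n k x) (\<epsilon> n - P.depth n k x)) (lift n k (\<phi> (foot n k x))))
      else qH (\<phi> (sheet_map i (foot n k x))))"

lemma circle_subset: "n \<ge> 1 \<Longrightarrow> circle n k \<subseteq> hawaiian_earring"
  using hawaiian_circle_subset circle_index_ge by blast

lemma collarD:
  assumes "n \<ge> 1" "k < 3" "x \<in> collar n k"
  shows "x \<in> pants n" "P.depth n k x \<le> \<epsilon> n" "0 \<le> P.depth n k x" "x \<noteq> c n k"
    "P.proj n k x \<in> P.rim n k" "foot n k x \<in> circle n k" "foot n k x \<in> hawaiian_earring"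
proof -
  show 1: "x \<in> pants n" "P.depth n k x \<le> \<epsilon> n" using assms(3) by (auto simp: collar_def)
  show "0 \<le> P.depth n k x" using 1(1) assms(2) by (auto simp: P.core_def)
  show 2: "x \<noteq> c n k"
    using P.not_center[OF assms(2) 1(1)] 1(2) \<epsilon>_pos[OF assms(1)] \<epsilon>_gap[OF assms(1)] by linarith
  show 3: "P.proj n k x \<in> P.rim n k" by (rule P.proj_in_rim[OF assms(2) 2])
  show 4: "foot n k x \<in> circle n k" unfolding foot_def by (rule f_rim[OF assms(1,2) 3])
  then show "foot n k x \<in> hawaiian_earring" using circle_subset[OF assms(1)] by blast
qed

lemma rim_in_collar: "n \<ge> 1 \<Longrightarrow> k < 3 \<Longrightarrow> x \<in> P.rim n k \<Longrightarrow> x \<in> collar n k"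
  using P.rim_subset_core[of k n] \<epsilon>_pos[of n] by (auto simp: collar_def P.rim_depth)

lemma foot_rim: "k < 3 \<Longrightarrow> x \<in> P.rim n k \<Longrightarrow> foot n k x = f n x"
  by (simp add: foot_def P.proj_rim)

lemma continuous_on_foot:
  assumes "n \<ge> 1" "k < 3"
  shows "continuous_on (collar n k) (foot n k)"
  unfolding foot_def
  by (rule continuous_on_compose2[OF cont_f[OF assms]])
     (use collarD[OF assms] in \<open>auto intro!: continuous_intros\<close>)

lemma collar_unique:
  assumes "n \<ge> 1" "j < 3" "k < 3" "x \<in> collar n j" "x \<in> collar n k"
  shows "j = k"
  using P.depth_sum_ge_gap[OF assms(2,3), of n x] \<epsilon>_gap[OF assms(1)] assms(4,5)
  by (force simp: collar_def)

lemma collar_map_in: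
  assumes "n \<ge> 1" "k < 3" "x \<in> collar n k"
  shows "collar_map i n k x \<in> W0"
  using \<epsilon>_W0[OF assms(1,2), of "foot n k x" "min (P.depth n k x) (\<epsilon> n - P.depth n k x)"]
    collarD[OF assms] \<phi>_W0[OF sheet_map_in] by (auto simp: collar_map_def)

text \<open>At both edges the depth used in the first branch is \<open>0\<close>, so the value lies
  in the earring. This makes the collar agree with the earring at the rim and with the core of the
  pants at the inner edge.\<close>

lemma collar_map_edge:
  assumes "n \<ge> 1" "k < 3" "x \<in> collar n k" "P.depth n k x = 0 \<or> P.depth n k x = \<epsilon> n"
  shows "collar_map i n k x = qH (\<phi> (sheet_map i (foot n k x)))"
proof (cases "i = 0 \<and> \<phi> ` circle n k \<subseteq> circle n k")
  case True
  note x = collarD[OF assms(1-3)]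
  have y: "\<phi> (foot n k x) \<in> circle n k" using True x(6) by blast
  have "min (P.depth n k x) (\<epsilon> n - P.depth n k x) = 0" using assms(4) \<epsilon>_pos[OF assms(1)] by auto
  then have "collar_map i n k x = qP n (lift n k (\<phi> (foot n k x)))"
    using True assms(2) by (simp add: collar_map_def)
  also have "\<dots> = qH (\<phi> (foot n k x))"
    using qP_rim[OF assms(1,2)] lift_in[OF assms(1,2) y] f_lift[OF assms(1,2) y] by simp
  finally show ?thesis using True sheet_map_0[OF x(7)] by simp
qed (auto simp: collar_map_def)

lemma push_in_pants:
  assumes "n \<ge> 1" "k < 3" "b \<in> P.rim n k" "0 \<le> s" "s \<le> \<epsilon> n"
  shows "P.push n k s b \<in> pants n"
proof -
  have "s < P.gap n" using assms(4,5) \<epsilon>_gap[OF assms(1)] by linarith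
  then show ?thesis using P.push_in_core[OF assms(2-4), of 0] assms(4) by simp
qed

lemma continuous_collar_map:
  assumes "n \<ge> 1" "k < 3"
  shows "continuous_map (top_of_set (collar n k)) X (collar_map i n k)"
proof (cases "i = 0 \<and> \<phi> ` circle n k \<subseteq> circle n k")
  case True
  note x = collarD[OF assms]
  have "continuous_on (collar n k) (\<lambda>x. \<phi> (foot n k x))"
    by (rule continuous_on_compose2[OF cont_\<phi> continuous_on_foot[OF assms]]) (use x in auto)
  then have "continuous_on (collar n k) (\<lambda>x. lift n k (\<phi> (foot n k x)))"
    by (rule continuous_on_compose2[OF continuous_on_lift[OF assms]]) (use x(6) True in auto)
  then have "continuous_on (collar n k) (\<lambda>x. P.push n k (min (P.depth n k x) (\<epsilon> n - P.depth n k x))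
      (lift n k (\<phi> (foot n k x))))"
    using assms(2) by (intro continuous_intros)
  then have "continuous_map (top_of_set (collar n k)) X (\<lambda>x. qP n
      (P.push n k (min (P.depth n k x) (\<epsilon> n - P.depth n k x)) (lift n k (\<phi> (foot n k x)))))"
  proof (rule continuous_map_qP_comp)
    show "(\<lambda>x. P.push n k (min (P.depth n k x) (\<epsilon> n - P.depth n k x)) (lift n k (\<phi> (foot n k x))))
        ` collar n k \<subseteq> pants n"
    proof clarify
      fix x assume "x \<in> collar n k"
      note x = collarD[OF assms this]
      show "P.push n k (min (P.depth n k x) (\<epsilon> n - P.depth n k x)) (lift n k (\<phi> (foot n k x))) \<in> pants n"
        by (rule push_in_pants[OF assms]) (use x True lift_in[OF assms] in auto)
    qed
  qed (use assms in auto)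
  then show ?thesis using True by (simp add: collar_map_def[abs_def])
next
  case False
  have "continuous_map (top_of_set (collar n k)) X (\<lambda>x. qH (\<phi> (sheet_map i (foot n k x))))"
    by (rule continuous_map_qH_comp)
       (use collarD[OF assms] \<phi>_in sheet_map_in in
         \<open>auto intro!: continuous_on_compose2[OF cont_\<phi>] continuous_on_compose2[OF continuous_on_sheet_map]
           continuous_on_foot[OF assms]\<close>)
  moreover have "collar_map i n k = (\<lambda>x. qH (\<phi> (sheet_map i (foot n k x))))"
    by (simp only: collar_map_def[abs_def] if_not_P[OF False])
  ultimately show ?thesis by simp
qed

lemma closedin_collar: "closedin (top_of_set (pants n)) (collar n k)"
proof -
  have "closed {x. P.depth n k x \<le> \<epsilon> n}" by (intro closed_Collect_le continuous_intros)
  then show ?thesis using closedin_closed_Int[of _ "pants n"] by (auto simp: collar_def Collect_conj_eq)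
qed

lemma core_collar_cover:
  "x \<in> pants n \<Longrightarrow> x \<in> P.core n (\<epsilon> n) \<or> (\<exists>k<3. x \<in> collar n k)"
  by (auto simp: collar_def P.core_def not_le intro: less_imp_le)

lemma rim_hawaiian_coordinate:
  assumes "n \<ge> 1" "k < 3" "t \<in> {0..1}"
  shows "1 - of_nat (circle_index n k) * f n (\<gamma> n k t) = exp (- (2 * pi * t) * \<i>)"
  using circle_index_ge[OF assms(1), of k] by (simp add: f_\<gamma>[OF assms] hawaiian_loop_eq)

text \<open>This is the retraction on the copy of the \<open>n\<close>-th pants in the tree
  \<open>p\<close>, where the circle \<open>m\<close> lies on the sheet \<open>m - p\<close>. The
  core goes to the \<open>p\<close>-th circle by a map whose boundary degrees are the flow values,
  and is then folded by \<open>\<phi>\<close>. At the inner edges it coincides with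
  \<open>sheet_map\<close> of the foot point.\<close>

lemma pants_piece_exists:
  assumes n: "n \<ge> 1"
  shows "\<exists>G. continuous_map (top_of_set (pants n)) X G \<and> (\<forall>x\<in>pants n. G x \<in> W0) \<and>
     (\<forall>k<3. \<forall>x\<in>collar n k. G x = collar_map (int (circle_index n k) - p) n k x)"
proof -
  define d where "d k = pants_flow p (circle_index n k)" for k
  define T where "T k b = 1 - of_nat (circle_index n k) * f n b" for k b
  have T: "T k (\<gamma> n k t) = exp (- (2 * pi * t) * \<i>)" if "k < 3" "t \<in> {0..1}" for k t
    unfolding T_def by (rule rim_hawaiian_coordinate[OF n that])
  have d: "d 0 = d 1 + d 2" unfolding d_def by (rule pants_flow_circle_index[OF n])
  obtain W where W: "continuous_on (P.core n (\<epsilon> n)) W" "\<And>x. x \<in> P.core n (\<epsilon> n) \<Longrightarrow> norm (W x) = 1"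
    "\<And>k b. k < 3 \<Longrightarrow> b \<in> P.rim n k \<Longrightarrow> W (P.push n k (\<epsilon> n) b) = T k b powi d k"
    using P.degree_map_exists[OF less_imp_le[OF \<epsilon>_pos[OF n]] \<epsilon>_gap[OF n] loops T d] by metis
  define L where "L x = (if p \<ge> 1 then (1 - W x) / of_int p else 0)" for x
  have L_in: "L x \<in> hawaiian_earring" if "x \<in> P.core n (\<epsilon> n)" for x
    using W(2)[OF that] unit_label_in_hawaiian_earring zero_in_hawaiian_earring by (simp add: L_def)
  have contL: "continuous_on (P.core n (\<epsilon> n)) L"
  proof (cases "p \<ge> 1")
    case True
    have "continuous_on (P.core n (\<epsilon> n)) (\<lambda>x. (1 - W x) / of_int p)"
      using True by (intro continuous_intros W) auto
    then show ?thesis using True by (simp add: L_def[abs_def])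
  qed (simp add: L_def[abs_def])
  have core_sub: "P.core n (\<epsilon> n) \<subseteq> pants n"
    using P.core_mono \<epsilon>_pos[OF n] by (simp add: less_imp_le)
  \<comment> \<open>The indices \<open>0\<close>, \<open>1\<close>, \<open>2\<close> are the collars
    and \<open>3\<close> is the core.\<close>
  define S where "S k = (if k < 3 then collar n k else P.core n (\<epsilon> n))" for k
  define g where "g k = (if k < 3 then collar_map (int (circle_index n k) - p) n k else (\<lambda>x. qH (\<phi> (L x))))" for k
  have edge: "collar_map (int (circle_index n k) - p) n k x = qH (\<phi> (L x))"
    if k: "k < 3" and x: "x \<in> collar n k" "x \<in> P.core n (\<epsilon> n)" for k x
  proof -
    have dx: "P.depth n k x = \<epsilon> n" using x k by (force simp: collar_def P.core_def)
    define b where "b = P.proj n k x"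
    have b: "b \<in> P.rim n k" using collarD(5)[OF n k x(1)] by (simp add: b_def)
    have "x = P.push n k (\<epsilon> n) b"
      using P.push_proj[OF k collarD(4)[OF n k x(1)]] dx by (simp add: b_def)
    then have "L x = sheet_label p (circle_index n k) (f n b)"
      using W(3)[OF k b] by (simp add: L_def sheet_label_def T_def d_def)
    also have "\<dots> = sheet_map (int (circle_index n k) - p) (f n b)"
      by (simp add: sheet_map_eq[OF circle_index_ge[OF n] f_rim[OF n k b]])
    also have "f n b = foot n k x" by (simp add: foot_def b_def)
    finally show ?thesis using collar_map_edge[OF n k x(1)] dx by simp
  qed
  obtain G where G: "continuous_map (top_of_set (pants n)) X G"
    "\<And>x i. i \<in> {..3} \<Longrightarrow> x \<in> topspace (top_of_set (pants n)) \<inter> S i \<Longrightarrow> G x = g i x"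
  proof (rule pasting_lemma_exists_closed[of "{..3::nat}" "top_of_set (pants n)" S X g])
    show "finite {..3::nat}" by simp
    show "topspace (top_of_set (pants n)) \<subseteq> \<Union> (S ` {..3})"
    proof
      fix x assume "x \<in> topspace (top_of_set (pants n))"
      then consider "x \<in> S 3" | k where "k < 3" "x \<in> S k"
        using core_collar_cover[of x n] by (auto simp: S_def)
      then show "x \<in> \<Union> (S ` {..3})" by cases (auto intro: less_imp_le)
    qed
    show "closedin (top_of_set (pants n)) (S i)" for i
      unfolding S_def using closedin_collar core_sub P.closed_core by (auto intro: closed_subset)
    show "continuous_map (subtopology (top_of_set (pants n)) (S i)) X (g i)" for i
    proof -
      have "pants n \<inter> S i = S i" using core_sub by (auto simp: S_def collar_def)
      moreover have "continuous_map (top_of_set (S i)) X (g i)"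
      proof (cases "i < 3")
        case True
        then show ?thesis using continuous_collar_map[OF n True] by (simp add: S_def g_def)
      next
        case False
        have "continuous_map (top_of_set (P.core n (\<epsilon> n))) X (\<lambda>x. qH (\<phi> (L x)))"
          by (rule continuous_map_qH_comp)
             (use L_in \<phi>_in in \<open>auto intro!: continuous_on_compose2[OF cont_\<phi> contL]\<close>)
        then show ?thesis using False by (simp add: S_def g_def)
      qed
      ultimately show ?thesis by (simp add: subtopology_subtopology)
    qed
    show "g i x = g j x" if "i \<in> {..3}" "j \<in> {..3}" "x \<in> topspace (top_of_set (pants n)) \<inter> S i \<inter> S j" for i j x
      using that edge[of i x] edge[of j x] collar_unique[OF n, of i j x]
      by (auto simp: S_def g_def split: if_splits)
  qed (rule that; blast)
  have "G x \<in> W0" if x: "x \<in> pants n" for x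
  proof -
    consider "x \<in> P.core n (\<epsilon> n)" | k where "k < 3" "x \<in> collar n k"
      using core_collar_cover[OF x] by blast
    then show ?thesis
    proof cases
      case 1
      then show ?thesis using G(2)[of 3 x] x \<phi>_W0[OF L_in[OF 1]] by (simp add: S_def g_def)
    next
      case 2
      then show ?thesis using G(2)[of k x] x collar_map_in[OF n 2] by (simp add: S_def g_def)
    qed
  qed
  moreover have "G x = collar_map (int (circle_index n k) - p) n k x" if "k < 3" "x \<in> collar n k" for k x
    using G(2)[of k x] that collarD(1)[OF n that] by (simp add: S_def g_def)
  ultimately show ?thesis using G(1) by blast
qed

text \<open>The height is an integer constant on each collar, so over this open neighbourhood of the
  earring the pullback splits into sheets.\<close>

definition near :: "'a set" where
  "near = qH ` hawaiian_earring \<union> (\<Union>n\<in>{1..}. \<Union>k\<in>{..<3}. qP n ` {x \<in> pants n. P.depth n k x < \<epsilon> n})"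

lemma qH_near: "y \<in> hawaiian_earring \<Longrightarrow> qH y \<in> near"
  by (simp add: near_def)

lemma qP_near_iff:
  assumes "n \<ge> 1" "x \<in> pants n"
  shows "qP n x \<in> near \<longleftrightarrow> (\<exists>k<3. P.depth n k x < \<epsilon> n)"
proof
  have rim: "\<exists>k<3. P.depth n k x < \<epsilon> n" if "\<exists>k<3. x \<in> P.rim n k"
    using that \<epsilon>_pos[OF assms(1)] by (auto simp: P.rim_depth)
  assume "qP n x \<in> near"
  then consider y where "qP n x = qH y" | m k z where "m \<ge> 1" "k < 3" "P.depth m k z < \<epsilon> m" "qP n x = qP m z"
    by (auto simp: near_def)
  then show "\<exists>k<3. P.depth n k x < \<epsilon> n"
  proof cases
    case 1 then show ?thesis using rim qP_eq_qH[OF assms(1)] by blast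
  next
    case 2 then show ?thesis using rim qP_inj[OF assms(1) 2(1,4)] by blast
  qed
next
  assume "\<exists>k<3. P.depth n k x < \<epsilon> n"
  then show "qP n x \<in> near" using assms by (auto simp: near_def)
qed

lemma openin_depth_less: "openin (top_of_set (pants n)) {x \<in> pants n. P.depth n k x < e}"
proof -
  have "open {x. P.depth n k x < e}" by (intro open_Collect_less continuous_intros)
  then show ?thesis using openin_open_Int[of _ "pants n"] by (auto simp: Collect_conj_eq)
qed

lemma near_preimage:
  "n \<ge> 1 \<Longrightarrow> {x \<in> pants n. qP n x \<in> near} = (\<Union>k\<in>{..<3}. {x \<in> pants n. P.depth n k x < \<epsilon> n})"
  using qP_near_iff by auto

lemma openin_near: "openin X near"
proof (subst openin_X, intro conjI allI impI)
  show "near \<subseteq> topspace X" by (auto simp: near_def topspace_X)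
  have "{y \<in> hawaiian_earring. qH y \<in> near} = hawaiian_earring" using qH_near by auto
  then show "openin (top_of_set hawaiian_earring) {y \<in> hawaiian_earring. qH y \<in> near}" by simp
  show "openin (top_of_set (pants n)) {x \<in> pants n. qP n x \<in> near}" if "n \<ge> 1" for n
    unfolding near_preimage[OF that] by (intro openin_Union) (auto simp: openin_depth_less)
qed

text \<open>The collars are disjoint, and on the rims they agree with the map on the earring by
  \<open>collar_map_edge\<close>. So the collar maps of the sheet \<open>i\<close> glue to one map
  on \<open>near\<close>.\<close>

lemma sheet_retraction_exists:
  "\<exists>E. continuous_map (subtopology X near) X E \<and> E ` near \<subseteq> W0 \<and>
     (\<forall>y\<in>hawaiian_earring. E (qH y) = qH (\<phi> (sheet_map i y))) \<and>
     (\<forall>n\<ge>1. \<forall>k<3. \<forall>x\<in>collar n k. E (qP n x) = collar_map i n k x)"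
proof -
  define h2 where "h2 n x = collar_map i n (SOME k. k < 3 \<and> x \<in> collar n k) x" for n x
  have h2: "h2 n x = collar_map i n k x" if "n \<ge> 1" "k < 3" "x \<in> collar n k" for n k x
  proof -
    have "(SOME k. k < 3 \<and> x \<in> collar n k) = k"
      using that collar_unique[OF that(1)] by (intro some_equality) auto
    then show ?thesis by (simp add: h2_def)
  qed
  have "h2 n x = qH (\<phi> (sheet_map i (f n x)))" if "n \<ge> 1" "k < 3" "x \<in> P.rim n k" for n k x
    using h2[OF that(1,2) rim_in_collar[OF that]] collar_map_edge[OF that(1,2) rim_in_collar[OF that]] that
    by (simp add: P.rim_depth foot_rim)
  then obtain E where E: "\<And>y. E (qH y) = qH (\<phi> (sheet_map i y))" "\<And>n x. n \<ge> 1 \<Longrightarrow> E (qP n x) = h2 n x"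
    using glued_function_exists[of h2 "\<lambda>y. qH (\<phi> (sheet_map i y))"] by metis
  have cont: "continuous_map (subtopology X near) X E"
  proof (rule continuous_map_glued[OF openin_near])
    have "{y \<in> hawaiian_earring. qH y \<in> near} = hawaiian_earring" using qH_near by auto
    moreover have "continuous_map (top_of_set hawaiian_earring) X (\<lambda>y. qH (\<phi> (sheet_map i y)))"
      by (rule continuous_map_qH_comp)
         (use \<phi>_in sheet_map_in in \<open>auto intro!: continuous_on_compose2[OF cont_\<phi> continuous_on_sheet_map]\<close>)
    ultimately show "continuous_map (top_of_set {y \<in> hawaiian_earring. qH y \<in> near}) X (\<lambda>y. E (qH y))"
      by (simp add: E(1))
    fix n :: nat assume n: "n \<ge> 1"
    let ?S = "\<lambda>k. {x \<in> pants n. P.depth n k x < \<epsilon> n}"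
    have sub: "?S k \<subseteq> collar n k" for k by (auto simp: collar_def)
    have SN: "?S k \<subseteq> {x \<in> pants n. qP n x \<in> near}" if "k < 3" for k
      using that by (auto simp: near_preimage[OF n])
    show "continuous_map (top_of_set {x \<in> pants n. qP n x \<in> near}) X (\<lambda>x. E (qP n x))"
    proof (rule pasting_lemma[where I = "{..<3}" and T = ?S and f = "\<lambda>k. collar_map i n k"])
      fix k :: nat assume k: "k \<in> {..<3}"
      have k3: "k < 3" using k by simp
      show "openin (top_of_set {x \<in> pants n. qP n x \<in> near}) (?S k)"
        by (rule openin_subset_trans[OF openin_depth_less SN[OF k3]]) auto
      have "continuous_map (top_of_set (?S k)) X (collar_map i n k)"
        using continuous_map_from_subtopology_mono[OF continuous_collar_map[OF n k3] sub] .
      moreover have "{x \<in> pants n. qP n x \<in> near} \<inter> ?S k = ?S k" using SN[OF k3] by blast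
      ultimately show "continuous_map (subtopology (top_of_set {x \<in> pants n. qP n x \<in> near}) (?S k)) X
          (collar_map i n k)"
        by (simp only: subtopology_subtopology)
    next
      fix j k x assume "j \<in> {..<3}" "k \<in> {..<3}"
        "x \<in> topspace (top_of_set {x \<in> pants n. qP n x \<in> near}) \<inter> ?S j \<inter> ?S k"
      then have "j = k" using collar_unique[OF n, of j k x] sub by blast
      then show "collar_map i n j x = collar_map i n k x" by simp
    next
      fix x assume "x \<in> topspace (top_of_set {x \<in> pants n. qP n x \<in> near})"
      then obtain k where k: "k < 3" "x \<in> ?S k" by (auto simp: near_preimage[OF n])
      then have "E (qP n x) = collar_map i n k x" using E(2)[OF n] h2[OF n k(1)] sub by auto
      then show "\<exists>k. k \<in> {..<3} \<and> x \<in> ?S k \<and> E (qP n x) = collar_map i n k x" using k by auto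
    qed
  qed
  have "E q \<in> W0" if "q \<in> near" for q
    using that unfolding near_def
  proof (elim UnE UN_E imageE)
    fix y assume "q = qH y" "y \<in> hawaiian_earring"
    then show ?thesis using E(1) \<phi>_W0[OF sheet_map_in] by simp
  next
    fix n k x assume *: "n \<in> {1..}" "k \<in> {..<3}" "q = qP n x" "x \<in> {x \<in> pants n. P.depth n k x < \<epsilon> n}"
    then have "x \<in> collar n k" by (auto simp: collar_def)
    then show ?thesis using * E(2) h2 collar_map_in by simp
  qed
  then show ?thesis using cont E h2 by (intro exI[of _ E]) auto
qed

text \<open>A cutoff that is \<open>1\<close> on the \<open>k\<close>-th collar and \<open>0\<close>
  from depth \<open>gap - \<epsilon>\<close> on, hence on the other two collars.\<close>

definition bump :: "nat \<Rightarrow> nat \<Rightarrow> complex \<Rightarrow> real" where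
  "bump n k x = max 0 (min 1 ((P.gap n - \<epsilon> n - P.depth n k x) / (P.gap n - 2 * \<epsilon> n)))"

text \<open>The increments \<open>n\<close> and \<open>n + 1\<close> raise the height
  \<open>n\<close> of the outer collar to \<open>2n\<close> and \<open>2n + 1\<close> on the inner
  ones.\<close>

definition height :: "nat \<Rightarrow> complex \<Rightarrow> real" where
  "height n x = real n + real n * bump n 1 x + (real n + 1) * bump n 2 x"

lemma bump_own: "n \<ge> 1 \<Longrightarrow> k < 3 \<Longrightarrow> x \<in> collar n k \<Longrightarrow> bump n k x = 1"
  using \<epsilon>_gap[of n] by (simp add: bump_def collar_def field_simps)

lemma bump_other:
  assumes "n \<ge> 1" "j < 3" "k < 3" "j \<noteq> k" "x \<in> collar n k"
  shows "bump n j x = 0"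
proof -
  have "P.gap n - \<epsilon> n - P.depth n j x \<le> 0"
    using P.depth_sum_ge_gap[OF assms(2-4), of n x] assms(5) by (simp add: collar_def)
  then show ?thesis using \<epsilon>_gap[OF assms(1)] by (simp add: bump_def field_simps)
qed

lemma height_collar:
  assumes "n \<ge> 1" "k < 3" "x \<in> collar n k"
  shows "height n x = real (circle_index n k)"
  using bump_own[OF assms] bump_other[OF assms(1) _ assms(2) _ assms(3)] less_Suc_eq[of k]
    P.less3D[OF assms(2)]
  by (auto simp: height_def circle_index_def)

lemma continuous_on_height:
  assumes "n \<ge> 1"
  shows "continuous_on S (height n)"
proof -
  have "P.gap n - 2 * \<epsilon> n \<noteq> 0" using \<epsilon>_gap[OF assms] by simp
  then show ?thesis unfolding height_def bump_def by (intro continuous_intros) auto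
qed

text \<open>Heights on the collars are integers, so the exponential is \<open>1\<close> on all rims
  and extends by \<open>1\<close> over the earring. Passing to heights modulo \<open>1\<close> is
  what makes the gluing continuous at the basepoint, where the heights are unbounded.\<close>

lemma angle_exists:
  "\<exists>h. continuous_map X euclidean h \<and> (\<forall>q\<in>near. h q = (1::complex)) \<and>
     (\<forall>n\<ge>1. \<forall>x\<in>pants n. h (qP n x) = exp (2 * pi * height n x * \<i>))"
proof -
  have one: "exp (2 * pi * height n x * \<i>) = (1::complex)" if "n \<ge> 1" "k < 3" "x \<in> collar n k" for n k x
    using exp_integer_2pi[of "of_nat (circle_index n k)"]
    by (simp add: height_collar[OF that] mult.assoc mult.left_commute mult.commute)
  obtain h where h: "\<And>y. h (qH y) = (1::complex)"
    "\<And>n x. n \<ge> 1 \<Longrightarrow> h (qP n x) = exp (2 * pi * height n x * \<i>)"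
    using glued_function_exists[of "\<lambda>n x. exp (2 * pi * height n x * \<i>)" "\<lambda>_. 1"]
      one rim_in_collar by metis
  have "continuous_map (subtopology X (topspace X)) euclidean h"
  proof (rule continuous_map_glued)
    show "continuous_map (top_of_set {y \<in> hawaiian_earring. qH y \<in> topspace X}) euclidean (\<lambda>y. h (qH y))"
      by (simp add: h(1))
    show "continuous_map (top_of_set {x \<in> pants n. qP n x \<in> topspace X}) euclidean (\<lambda>x. h (qP n x))"
      if "n \<ge> 1" for n
      using that by (simp add: h(2)) (intro continuous_intros continuous_on_height[OF that])
  qed simp
  moreover have "h q = 1" if "q \<in> near" for q
    using that unfolding near_def
  proof (elim UnE UN_E imageE)
    fix n k x assume *: "n \<in> {1..}" "k \<in> {..<3}" "q = qP n x" "x \<in> {x \<in> pants n. P.depth n k x < \<epsilon> n}"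
    then have "x \<in> collar n k" by (auto simp: collar_def)
    moreover have "n \<ge> 1" "k < 3" using *(1,2) by (simp_all only: atLeast_iff lessThan_iff)
    ultimately show "h q = 1" using *(3) h(2) one by simp
  qed (simp add: h(1))
  ultimately show ?thesis using h(2) by (intro exI[of _ h]) simp
qed

text \<open>Below half the collar width, \<open>collar_map\<close> on the sheet \<open>0\<close>
  keeps the depth, and over \<open>W'\<close> it keeps the foot point. So the retraction of this
  sheet fixes these points.\<close>

definition basin :: "'a set" where
  "basin = qH ` W' \<union>
     (\<Union>n\<in>{1..}. \<Union>k\<in>{..<3}. qP n ` {x \<in> pants n. P.depth n k x < \<epsilon> n / 2 \<and> foot n k x \<in> W'})"

lemma W'_subset: "W' \<subseteq> hawaiian_earring"
  using open_W' openin_imp_subset by blast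

lemma basin_subset_near: "basin \<subseteq> near"
proof -
  have "P.depth n k x < \<epsilon> n" if "n \<ge> 1" "P.depth n k x < \<epsilon> n / 2" for n k x
    using that \<epsilon>_pos[of n] by linarith
  then show ?thesis using W'_subset unfolding basin_def near_def by fastforce
qed

text \<open>A point of \<open>basin\<close> might be represented in another pair of pants or on
  another rim. Then both representatives are rim points, and their feet are the same point of the
  earring.\<close>

lemma qP_basin_iff:
  assumes "n \<ge> 1" "x \<in> pants n"
  shows "qP n x \<in> basin \<longleftrightarrow> (\<exists>k<3. P.depth n k x < \<epsilon> n / 2 \<and> foot n k x \<in> W')"
proof
  have rim: "\<exists>k<3. P.depth n k x < \<epsilon> n / 2 \<and> foot n k x \<in> W'"
    if "k < 3" "x \<in> P.rim n k" "qP n x = qH y" "y \<in> W'" for k y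
  proof -
    have "f n x = y" using qP_rim[OF assms(1) that(1,2)] that(3) qH_inj by simp
    then show ?thesis
      using that \<epsilon>_pos[OF assms(1)] by (intro exI[of _ k]) (simp add: P.rim_depth foot_rim)
  qed
  assume "qP n x \<in> basin"
  then consider y where "y \<in> W'" "qP n x = qH y"
    | m k z where "m \<ge> 1" "k < 3" "P.depth m k z < \<epsilon> m / 2" "foot m k z \<in> W'" "qP n x = qP m z" "z \<in> pants m"
    by (auto simp: basin_def)
  then show "\<exists>k<3. P.depth n k x < \<epsilon> n / 2 \<and> foot n k x \<in> W'"
  proof cases
    case 1
    then show ?thesis using rim qP_eq_qH[OF assms(1)] by blast
  next
    case 2
    show ?thesis
    proof (cases "n = m \<and> x = z")
      case False
      then obtain j where j: "j < 3" "x \<in> P.rim n j" using qP_inj[OF assms(1) 2(1,5)] by blast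
      obtain j' where j': "j' < 3" "z \<in> P.rim m j'"
        using qP_inj[OF 2(1) assms(1) 2(5)[symmetric]] False by blast
      have "z \<in> collar m j'" "z \<in> collar m k"
        using rim_in_collar[OF 2(1) j'] 2(3,6) \<epsilon>_pos[OF 2(1)] by (auto simp: collar_def)
      then have "j' = k" using collar_unique[OF 2(1) j'(1) 2(2)] by blast
      then have "qP m z = qH (foot m k z)"
        using qP_rim[OF 2(1) j'] foot_rim[OF j'] by simp
      then show ?thesis using rim[OF j, of "foot m k z"] 2 by simp
    qed (use 2 in blast)
  qed
next
  assume "\<exists>k<3. P.depth n k x < \<epsilon> n / 2 \<and> foot n k x \<in> W'"
  then show "qP n x \<in> basin" using assms by (auto simp: basin_def)
qed

lemma openin_basin: "openin X basin"
proof (subst openin_X, intro conjI allI impI)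
  show "basin \<subseteq> topspace X" using basin_subset_near openin_subset[OF openin_near] by blast
  have "{y \<in> hawaiian_earring. qH y \<in> basin} = W'"
  proof (intro equalityI subsetI)
    fix y assume "y \<in> {y \<in> hawaiian_earring. qH y \<in> basin}"
    then consider "y \<in> W'"
      | n x where "n \<ge> 1" "x \<in> pants n" "qP n x = qH y" "qP n x \<in> basin"
      by (auto simp: basin_def qH_inj)
    then show "y \<in> W'"
    proof cases
      case 2
      obtain j where j: "j < 3" "P.depth n j x < \<epsilon> n / 2" "foot n j x \<in> W'"
        using qP_basin_iff[OF 2(1,2)] 2(4) by blast
      obtain i where i: "i < 3" "x \<in> P.rim n i" using qP_eq_qH[OF 2(1,3)] by blast
      have "x \<in> collar n i" "x \<in> collar n j"
        using rim_in_collar[OF 2(1) i] j(2) 2(2) \<epsilon>_pos[OF 2(1)] by (auto simp: collar_def)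
      then have "i = j" using collar_unique[OF 2(1) i(1) j(1)] by blast
      then have "qH y = qH (foot n j x)"
        using qP_rim[OF 2(1) i] foot_rim[OF i] 2(3) by simp
      then show ?thesis using j(3) qH_inj by simp
    qed
  qed (use W'_subset in \<open>auto simp: basin_def\<close>)
  then show "openin (top_of_set hawaiian_earring) {y \<in> hawaiian_earring. qH y \<in> basin}"
    using open_W' by simp
  fix n :: nat assume n: "n \<ge> 1"
  have "openin (top_of_set (pants n)) {x \<in> pants n. P.depth n k x < \<epsilon> n / 2 \<and> foot n k x \<in> W'}"
    if k: "k < 3" for k
  proof -
    let ?S = "{x \<in> pants n. P.depth n k x < \<epsilon> n / 2}"
    have sub: "?S \<subseteq> collar n k" using \<epsilon>_pos[OF n] by (auto simp: collar_def)
    have "continuous_on ?S (foot n k)"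
      by (rule continuous_on_subset[OF continuous_on_foot[OF n k] sub])
    moreover have "foot n k \<in> ?S \<rightarrow> hawaiian_earring" using collarD(7)[OF n k] sub by blast
    ultimately have "openin (top_of_set ?S) (?S \<inter> foot n k -` W')"
      using open_W' by (rule continuous_openin_preimage)
    from openin_trans[OF this openin_depth_less]
    show ?thesis by (simp add: Int_def conj_assoc)
  qed
  then have "openin (top_of_set (pants n))
      (\<Union>k\<in>{..<3}. {x \<in> pants n. P.depth n k x < \<epsilon> n / 2 \<and> foot n k x \<in> W'})"
    by (intro openin_Union) auto
  moreover have "{x \<in> pants n. qP n x \<in> basin} =
      (\<Union>k\<in>{..<3}. {x \<in> pants n. P.depth n k x < \<epsilon> n / 2 \<and> foot n k x \<in> W'})"
    using qP_basin_iff[OF n] by auto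
  ultimately show "openin (top_of_set (pants n)) {x \<in> pants n. qP n x \<in> basin}" by simp
qed

lemma collar_map_basin:
  assumes "n \<ge> 1" "k < 3" "x \<in> pants n" "P.depth n k x < \<epsilon> n / 2" "foot n k x \<in> W'"
  shows "collar_map 0 n k x = qP n x"
proof -
  have x: "x \<in> collar n k" using assms \<epsilon>_pos[OF assms(1)] by (auto simp: collar_def)
  note xD = collarD[OF assms(1,2) x]
  have "\<phi> ` circle n k \<subseteq> circle n k"
    using \<phi>_circle[OF circle_index_ge[OF assms(1)]] assms(5) xD(6) by blast
  moreover have "min (P.depth n k x) (\<epsilon> n - P.depth n k x) = P.depth n k x" using assms(4) by simp
  moreover have "lift n k (\<phi> (foot n k x)) = P.proj n k x"
    using \<phi>_id[OF assms(5)] lift_f[OF assms(1,2) xD(5)] by (simp add: foot_def)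
  ultimately show ?thesis
    using P.push_proj[OF assms(2) xD(4)] by (simp add: collar_map_def)
qed

end

section \<open>Filling disks\<close>

lemma exp_2pi_eq_iff_int: "exp (of_real (2 * pi * a) * \<i>) = exp (of_real (2 * pi * b) * \<i>) \<longleftrightarrow> a - b \<in> \<int>"
proof
  assume "exp (of_real (2 * pi * a) * \<i>) = exp (of_real (2 * pi * b) * \<i>)"
  then obtain k :: int where
    "of_real (2 * pi * a) * \<i> = of_real (2 * pi * b) * \<i> + (of_int (2 * k) * of_real pi) * \<i>"
    by (auto simp: exp_eq)
  then have "2 * pi * a = 2 * pi * b + 2 * real_of_int k * pi" by (simp add: complex_eq_iff)
  then have "pi * (a - b) = pi * real_of_int k" by (simp add: algebra_simps)
  then have "a - b = real_of_int k" by simp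
  then show "a - b \<in> \<int>" by simp
next
  assume "a - b \<in> \<int>"
  then obtain k where "a - b = real_of_int k" by (auto elim: Ints_cases)
  then have "a = b + real_of_int k" by simp
  then have "of_real (2 * pi * a) * \<i> = of_real (2 * pi * b) * \<i> + (of_int (2 * k) * of_real pi) * \<i>"
    by (simp add: algebra_simps)
  then show "exp (of_real (2 * pi * a) * \<i>) = exp (of_real (2 * pi * b) * \<i>)"
    unfolding exp_eq by (intro exI[of _ k]) simp
qed

text \<open>A real logarithm exists on the disk. On the boundary circle it takes integer values, so
  it is constant there by connectedness, and this integer can be subtracted.\<close>

lemma continuous_lift_angle:
  fixes h :: "complex \<Rightarrow> complex"
  assumes "continuous_on (cball 0 1) h" "\<And>z. z \<in> cball 0 1 \<Longrightarrow> norm (h z) = 1"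
    and "\<And>z. z \<in> sphere 0 1 \<Longrightarrow> h z = 1"
  obtains l :: "complex \<Rightarrow> real" where "continuous_on (cball 0 1) l"
    "\<And>z. z \<in> cball 0 1 \<Longrightarrow> h z = exp (of_real (2 * pi * l z) * \<i>)"
    "\<And>z. z \<in> sphere 0 1 \<Longrightarrow> l z = 0"
proof -
  have "h z \<noteq> 0" if "z \<in> cball 0 1" for z using assms(2)[OF that] by auto
  then obtain L where L: "continuous_on (cball 0 1) L" "\<And>z. z \<in> cball 0 1 \<Longrightarrow> h z = exp (L z)"
    using continuous_logarithm_on_cball[OF assms(1)] by metis
  define l0 where "l0 z = Im (L z) / (2 * pi)" for z
  have h0: "h z = exp (of_real (2 * pi * l0 z) * \<i>)" if "z \<in> cball 0 1" for z
  proof -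
    have "Re (L z) = 0" using assms(2)[OF that] L(2)[OF that] by simp
    then have "L z = of_real (2 * pi * l0 z) * \<i>" by (simp add: complex_eq_iff l0_def)
    then show ?thesis using L(2)[OF that] by simp
  qed
  have c0: "continuous_on (cball 0 1) l0" unfolding l0_def by (intro continuous_intros L(1)) auto
  have int: "l0 z \<in> \<int>" if "z \<in> sphere 0 1" for z
    using exp_2pi_eq_iff_int[of "l0 z" 0] h0[of z] assms(3)[OF that] that by simp
  have "connected (sphere (0::complex) 1)" by (rule connected_sphere) simp
  moreover have "continuous_on (sphere 0 1) l0" by (rule continuous_on_subset[OF c0]) auto
  moreover have "\<exists>e>0. \<forall>y. y \<in> sphere 0 1 \<and> l0 y \<noteq> l0 x \<longrightarrow> e \<le> norm (l0 y - l0 x)"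
    if "x \<in> sphere 0 1" for x
  proof (intro exI[of _ 1] conjI allI impI)
    fix y assume y: "y \<in> sphere 0 1 \<and> l0 y \<noteq> l0 x"
    then have "l0 y - l0 x \<in> \<int>" "l0 y - l0 x \<noteq> 0" using int that by auto
    then show "1 \<le> norm (l0 y - l0 x)" using Ints_nonzero_abs_ge1[of "l0 y - l0 x"] by simp
  qed simp
  ultimately have "l0 constant_on sphere 0 1" using continuous_discrete_range_constant by blast
  then obtain N where N: "\<And>z. z \<in> sphere 0 1 \<Longrightarrow> l0 z = N" by (auto simp: constant_on_def)
  have "(1::complex) \<in> sphere 0 1" by simp
  then have "N \<in> \<int>" using N int by metis
  show ?thesis
  proof (rule that[of "\<lambda>z. l0 z - N"])
    show "h z = exp (of_real (2 * pi * (l0 z - N)) * \<i>)" if "z \<in> cball 0 1" for z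
      using h0[OF that] exp_2pi_eq_iff_int[of "l0 z" "l0 z - N"] \<open>N \<in> \<int>\<close> by simp
  qed (use N c0 in \<open>auto intro: continuous_intros\<close>)
qed

section \<open>Replacing a disk by its image under the retraction of the lifted disk\<close>

context hawaiian_pants_retraction
begin

lemma basin_filling:
  assumes u: "continuous_map (top_of_set (cball (0::complex) 1)) X u" "u ` sphere 0 1 \<subseteq> basin"
  obtains g where "continuous_map (top_of_set (cball 0 1)) (subtopology X W0) g"
    "\<And>z. z \<in> sphere 0 1 \<Longrightarrow> g z = u z"
proof -
  let ?D = "cball (0::complex) 1"
  obtain h where h: "continuous_map X euclidean h" "\<And>q. q \<in> near \<Longrightarrow> h q = (1::complex)"
    "\<And>n x. n \<ge> 1 \<Longrightarrow> x \<in> pants n \<Longrightarrow> h (qP n x) = exp (of_real (2 * pi * height n x) * \<i>)"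
    using angle_exists by blast
  obtain E where E: "\<And>i. continuous_map (subtopology X near) X (E i)" "\<And>i. E i ` near \<subseteq> W0"
     "\<And>i y. y\<in>hawaiian_earring \<Longrightarrow> E i (qH y) = qH (\<phi> (sheet_map i y))"
     "\<And>i n k x. n\<ge>1 \<Longrightarrow> k<3 \<Longrightarrow> x\<in>collar n k \<Longrightarrow> E i (qP n x) = collar_map i n k x"
    using sheet_retraction_exists by metis
  obtain G where G: "\<And>n p. n \<ge> 1 \<Longrightarrow> continuous_map (top_of_set (pants n)) X (G n p)"
    "\<And>n p x. n \<ge> 1 \<Longrightarrow> x\<in>pants n \<Longrightarrow> G n p x \<in> W0"
    "\<And>n p k x. n \<ge> 1 \<Longrightarrow> k<3 \<Longrightarrow> x\<in>collar n k \<Longrightarrow>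
       G n p x = collar_map (int (circle_index n k) - p) n k x"
    using pants_piece_exists by metis
  have "\<forall>n. \<exists>Q. n \<ge> 1 \<longrightarrow> continuous_map (subtopology X (qP n ` inner_pants n)) euclidean Q \<and>
     (\<forall>x\<in>inner_pants n. Q (qP n x) = x)" using inner_chart by metis
  then obtain Q where Q: "\<And>n. n \<ge> 1 \<Longrightarrow> continuous_map (subtopology X (qP n ` inner_pants n)) euclidean (Q n)"
    "\<And>n x. n \<ge> 1 \<Longrightarrow> x \<in> inner_pants n \<Longrightarrow> Q n (qP n x) = x" by metis
  have utop: "u z \<in> topspace X" if "z \<in> ?D" for z
    using u(1) that by (auto simp: continuous_map_def Pi_iff)
  have cover: "u z \<in> near \<or> (\<exists>n\<ge>1. u z \<in> qP n ` inner_pants n)" if "z \<in> ?D" for z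
  proof -
    have "u z \<in> topspace X" using utop[OF that] .
    then consider "u z \<in> near" | n x where "n \<ge> 1" "x \<in> pants n" "u z = qP n x"
      unfolding topspace_X using qH_near by auto
    then show ?thesis
    proof cases
      case 2
      show ?thesis
      proof (cases "\<exists>k<3. P.depth n k x < \<epsilon> n")
        case True
        then show ?thesis using qP_near_iff[OF 2(1,2)] 2(3) by simp
      next
        case False
        have "0 < P.depth n k x" if "k < 3" for k
        proof -
          have "\<epsilon> n \<le> P.depth n k x" using False that not_le by blast
          then show ?thesis using \<epsilon>_pos[OF 2(1)] by linarith
        qed
        then have "x \<in> inner_pants n" by (simp add: inner_pants_def)
        then show ?thesis using 2(1,3) by blast
      qed
    qed blast
  qed
  have hnorm: "norm (h (u z)) = 1" if "z \<in> ?D" for z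
    using cover[OF that]
  proof (elim disjE exE conjE)
    fix n assume n: "n \<ge> 1" "u z \<in> qP n ` inner_pants n"
    then obtain x where "x \<in> inner_pants n" "u z = qP n x" by blast
    then show ?thesis using h(3)[OF n(1) inner_in] by simp
  qed (use h(2) in simp)
  have hs: "h (u z) = 1" if "z \<in> sphere 0 1" for z
    by (rule h(2)) (use that u(2) basin_subset_near in blast)
  have hu: "continuous_on ?D (\<lambda>z. h (u z))"
    using continuous_map_compose[OF u(1) h(1)] by (simp add: o_def)
  obtain l :: "complex \<Rightarrow> real" where l: "continuous_on ?D l"
    "\<And>z. z \<in> ?D \<Longrightarrow> h (u z) = exp (of_real (2 * pi * l z) * \<i>)"
    "\<And>z. z \<in> sphere 0 1 \<Longrightarrow> l z = 0"
    using continuous_lift_angle[OF hu hnorm hs] by blast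
  have l_near: "l z \<in> \<int>" if "z \<in> ?D" "u z \<in> near" for z
    using exp_2pi_eq_iff_int[of "l z" 0] l(2)[OF that(1)] h(2)[OF that(2)] by simp
  have l_inner: "height n x - l z \<in> \<int>" if "z \<in> ?D" "u z = qP n x" "n \<ge> 1" "x \<in> pants n" for z n x
    using exp_2pi_eq_iff_int[of "height n x" "l z"] l(2)[OF that(1)] h(3)[OF that(3,4)] that(2) by simp
  \<comment> \<open>\<open>Inl i\<close> is the part of the disk near the sheet \<open>i\<close>,
    \<open>Inr (n, p)\<close> the part in the \<open>n\<close>-th pants of the tree
    \<open>p\<close>. The two quantities restricted to intervals of length \<open>1\<close> are
    integers on these parts, so the open conditions select exact values.\<close>
  define S where "S j = (case j of
      Inl i \<Rightarrow> {z \<in> ?D. u z \<in> near} \<inter> l -` {of_int i - 1/2 <..< of_int i + 1/2}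
    | Inr (n, p) \<Rightarrow> {z \<in> ?D. u z \<in> qP n ` inner_pants n} \<inter>
        (\<lambda>z. height n (Q n (u z)) - l z) -` {of_int p - 1/2 <..< of_int p + 1/2})"
    for j :: "int + nat \<times> int"
  define F where "F j = (case j of Inl i \<Rightarrow> E i \<circ> u | Inr (n, p) \<Rightarrow> G n p \<circ> (Q n \<circ> u))"
    for j :: "int + nat \<times> int"
  define I :: "(int + nat \<times> int) set" where "I = range Inl \<union> Inr ` ({1..} \<times> UNIV)"
  have near_open: "openin (top_of_set ?D) {z \<in> ?D. u z \<in> near}"
    using openin_continuous_map_preimage[OF u(1) openin_near] by simp
  have inner_open: "openin (top_of_set ?D) {z \<in> ?D. u z \<in> qP n ` inner_pants n}" if "n \<ge> 1" for n
    using openin_continuous_map_preimage[OF u(1) openin_inner_image[OF that open_inner_pants order_refl]]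
    by simp
  have cont_Qu: "continuous_on {z \<in> ?D. u z \<in> qP n ` inner_pants n} (Q n \<circ> u)" if "n \<ge> 1" for n
  proof -
    have "continuous_map (top_of_set {z \<in> ?D. u z \<in> qP n ` inner_pants n}) (subtopology X (qP n ` inner_pants n)) u"
    proof -
      have "continuous_map (top_of_set {z \<in> ?D. u z \<in> qP n ` inner_pants n}) X u"
        by (rule continuous_map_from_subtopology_mono[OF u(1)]) auto
      then show ?thesis by (simp add: continuous_map_in_subtopology Pi_iff)
    qed
    from continuous_map_compose[OF this Q(1)[OF that]] show ?thesis by simp
  qed
  have S_inl: "l z = of_int i" "u z \<in> near" "z \<in> ?D" if "z \<in> S (Inl i)" for z i
  proof -
    show z: "u z \<in> near" "z \<in> ?D" using that by (auto simp: S_def)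
    obtain a where "l z = of_int a" using l_near[OF z(2,1)] by (auto elim: Ints_cases)
    then show "l z = of_int i" using that by (auto simp: S_def)
  qed
  have S_inr: "\<exists>x\<in>inner_pants n. u z = qP n x \<and> Q n (u z) = x \<and> height n x - l z = of_int p" "z \<in> ?D"
    if zS: "z \<in> S (Inr (n, p))" and n: "n \<ge> 1" for z n p
  proof -
    show z: "z \<in> ?D" using zS by (auto simp: S_def)
    have "u z \<in> qP n ` inner_pants n" using zS by (simp add: S_def)
    then obtain x where x: "x \<in> inner_pants n" "u z = qP n x" by blast
    have Qx: "Q n (u z) = x" using Q(2)[OF n x(1)] x(2) by simp
    obtain a where "height n x - l z = of_int a"
      using l_inner[OF z x(2) n inner_in[OF x(1)]] by (blast elim: Ints_cases)
    moreover have "height n x - l z \<in> {of_int p - 1/2 <..< of_int p + 1/2}"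
      using zS Qx by (simp add: S_def)
    ultimately have "height n x - l z = of_int p" by auto
    then show "\<exists>x\<in>inner_pants n. u z = qP n x \<and> Q n (u z) = x \<and> height n x - l z = of_int p"
      using x Qx by blast
  qed
  \<comment> \<open>An overlap point lies in a collar, whose height is the index \<open>m\<close> of
    its circle. Hence \<open>p = m - i\<close>, and both pieces prescribe the same collar
    map.\<close>
  have mixed: "F (Inl i) z = F (Inr (n, p)) z" if z: "z \<in> S (Inl i)" "z \<in> S (Inr (n, p))" and n: "n \<ge> 1" for i n p z
  proof -
    obtain x where x: "x \<in> inner_pants n" "u z = qP n x" "Q n (u z) = x" "height n x - l z = of_int p"
      using S_inr(1)[OF z(2) n] by blast
    obtain k where k: "k < 3" "x \<in> collar n k"
    proof -
      obtain k where k: "k < 3" "P.depth n k x < \<epsilon> n"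
        using S_inl(2)[OF z(1)] x(2) qP_near_iff[OF n inner_in[OF x(1)]] by auto
      then show ?thesis using that[OF k(1)] inner_in[OF x(1)] by (simp add: collar_def)
    qed
    have "real (circle_index n k) - of_int i = of_int p"
      using x(4) height_collar[OF n k] S_inl(1)[OF z(1)] by simp
    then have "int (circle_index n k) - p = i" by linarith
    then show ?thesis using x(2,3) E(4)[OF n k] G(3)[OF n k] by (simp add: F_def)
  qed
  obtain g where g: "continuous_map (top_of_set ?D) (subtopology X W0) g"
    "\<And>z j. j \<in> I \<Longrightarrow> z \<in> topspace (top_of_set ?D) \<inter> S j \<Longrightarrow> g z = F j z"
  proof (rule pasting_lemma_exists[where X = "top_of_set ?D" and I = I and T = S and Y = "subtopology X W0" and f = F])
    show "topspace (top_of_set ?D) \<subseteq> (\<Union>j\<in>I. S j)"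
    proof
      fix z assume "z \<in> topspace (top_of_set ?D)"
      then have z: "z \<in> ?D" by simp
      show "z \<in> (\<Union>j\<in>I. S j)"
      proof (cases "u z \<in> near")
        case True
        then obtain i where "l z = of_int i" using l_near[OF z] by (auto elim: Ints_cases)
        then have "z \<in> S (Inl i)" using z True by (simp add: S_def)
        then show ?thesis by (auto simp: I_def)
      next
        case False
        then obtain n x where x: "n \<ge> 1" "x \<in> inner_pants n" "u z = qP n x" using cover[OF z] by blast
        then obtain p where "height n x - l z = of_int p"
          using l_inner[OF z x(3,1) inner_in[OF x(2)]] by (blast elim: Ints_cases)
        then have "z \<in> S (Inr (n, p))" using z x Q(2)[OF x(1,2)] by (auto simp: S_def)
        then show ?thesis using x(1) by (auto simp: I_def)
      qed
    qed
    fix j assume j: "j \<in> I"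
    have "openin (top_of_set ?D) (S j) \<and> continuous_map (top_of_set (S j)) X (F j) \<and> F j ` S j \<subseteq> W0"
    proof (cases j)
      case (Inl i)
      have sub: "{z \<in> ?D. u z \<in> near} \<subseteq> ?D" by auto
      have "openin (top_of_set ?D) (S j)"
        using openin_trans[OF continuous_openin_preimage_gen[OF continuous_on_subset[OF l(1) sub]
          open_greaterThanLessThan] near_open] by (simp add: S_def Inl)
      moreover have "continuous_map (top_of_set (S j)) (subtopology X near) u"
      proof -
        have "S j \<subseteq> ?D" using S_inl(3) Inl by blast
        then have "continuous_map (top_of_set (S j)) X u"
          by (rule continuous_map_from_subtopology_mono[OF u(1)])
        then show ?thesis using S_inl(2) by (auto simp: continuous_map_in_subtopology Inl)
      qed
      then have "continuous_map (top_of_set (S j)) X (F j)"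
        using continuous_map_compose[OF _ E(1)] by (auto simp: F_def Inl)
      moreover have "F j ` S j \<subseteq> W0" using S_inl(2) E(2) by (fastforce simp: F_def Inl)
      ultimately show ?thesis by blast
    next
      case (Inr np)
      obtain n p where np: "j = Inr (n, p)" "n \<ge> 1" using j Inr by (auto simp: I_def)
      let ?N = "{z \<in> ?D. u z \<in> qP n ` inner_pants n}"
      have sub: "?N \<subseteq> ?D" by auto
      have Sub: "S j \<subseteq> ?N" by (auto simp: S_def np)
      have "continuous_on ?N (\<lambda>z. height n ((Q n \<circ> u) z) - l z)"
        by (intro continuous_intros continuous_on_subset[OF l(1) sub]
            continuous_on_compose2[OF continuous_on_height[OF np(2), of UNIV] cont_Qu[OF np(2)]]) auto
      then have "openin (top_of_set ?N) (?N \<inter> (\<lambda>z. height n ((Q n \<circ> u) z) - l z) -` {of_int p - 1/2 <..< of_int p + 1/2})"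
        by (rule continuous_openin_preimage_gen) simp
      from openin_trans[OF this inner_open[OF np(2)]]
      have "openin (top_of_set ?D) (S j)" by (simp add: S_def np)
      moreover have Qin: "(Q n \<circ> u) z \<in> pants n" if z: "z \<in> S j" for z
      proof -
        obtain x where "x \<in> inner_pants n" "Q n (u z) = x"
          using S_inr(1)[of z n p] z np by blast
        then show ?thesis using inner_in by simp
      qed
      have "continuous_map (top_of_set (S j)) (top_of_set (pants n)) (Q n \<circ> u)"
        using continuous_on_subset[OF cont_Qu[OF np(2)] Sub] Qin
        by (auto simp: continuous_map_in_subtopology)
      from continuous_map_compose[OF this G(1)[OF np(2)]]
      have "continuous_map (top_of_set (S j)) X (F j)" by (simp add: F_def np)
      moreover have "F j ` S j \<subseteq> W0" using Qin G(2)[OF np(2)] by (auto simp: F_def np)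
      ultimately show ?thesis by blast
    qed
    moreover from this have "?D \<inter> S j = S j" using openin_imp_subset by blast
    ultimately show "openin (top_of_set ?D) (S j)"
      "continuous_map (subtopology (top_of_set ?D) (S j)) (subtopology X W0) (F j)"
      by (auto simp: subtopology_subtopology continuous_map_in_subtopology)
  next
    fix i j z assume ij: "i \<in> I" "j \<in> I" and z': "z \<in> topspace (top_of_set ?D) \<inter> S i \<inter> S j"
    then have z: "z \<in> S i" "z \<in> S j" by auto
    have cases: "\<exists>a. j = Inl a \<or> (\<exists>n p. n \<ge> 1 \<and> j = Inr (n, p))" if "j \<in> I" for j :: "int + nat \<times> int"
      using that by (auto simp: I_def)
    consider a b where "i = Inl a" "j = Inl b"
      | a n p where "i = Inl a" "j = Inr (n, p)" "n \<ge> 1"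
      | a n p where "j = Inl a" "i = Inr (n, p)" "n \<ge> 1"
      | n p m q where "i = Inr (n, p)" "n \<ge> 1" "j = Inr (m, q)" "m \<ge> 1"
      using cases[OF ij(1)] cases[OF ij(2)] by blast
    then show "F i z = F j z"
    proof cases
      case 1
      then show ?thesis using S_inl(1)[of z a] S_inl(1)[of z b] z by simp
    next
      case 2 then show ?thesis using mixed z by simp
    next
      case 3 then show ?thesis using mixed[of z a n p] z by simp
    next
      case 4
      \<comment> \<open>The point \<open>u z\<close> determines the pants and the point in it, and
        then \<open>l z\<close> determines the tree; so both indices are equal.\<close>
      obtain x where x: "x \<in> inner_pants n" "u z = qP n x" "height n x - l z = of_int p"
        using S_inr(1)[of z n p] z 4 by blast
      obtain y where y: "y \<in> inner_pants m" "u z = qP m y" "height m y - l z = of_int q"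
        using S_inr(1)[of z m q] z 4 by blast
      have "m = n \<and> y = x" using qP_inner_eq[OF 4(2,4) _ x(1), of y] x(2) y(2) by simp
      then show ?thesis using x(3) y(3) 4 by simp
    qed
  qed (rule that; blast)
  have "g z = u z" if z: "z \<in> sphere 0 1" for z
  proof -
    have zD: "z \<in> ?D" using z by simp
    have uz: "u z \<in> basin" using u(2) z by blast
    \<comment> \<open>The normalisation \<open>l = 0\<close> on the boundary puts it on the sheet
      \<open>0\<close>, whose retraction fixes \<open>basin\<close>.\<close>
    have "z \<in> S (Inl 0)" using zD l(3)[OF z] uz basin_subset_near by (auto simp: S_def)
    then have "g z = E 0 (u z)" using g(2)[of "Inl 0" z] zD by (simp add: I_def F_def)
    also have "E 0 (u z) = u z"
      using uz unfolding basin_def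
    proof (elim UnE UN_E imageE)
      fix y assume "u z = qH y" "y \<in> W'"
      then show ?thesis using E(3)[of y 0] sheet_map_0[of y] \<phi>_id W'_subset by auto
    next
      fix n k x assume *: "n \<in> {1..}" "k \<in> {..<3}" "u z = qP n x"
        "x \<in> {x \<in> pants n. P.depth n k x < \<epsilon> n / 2 \<and> foot n k x \<in> W'}"
      then have n: "n \<ge> 1" "k < 3" by auto
      moreover have "x \<in> collar n k" using * \<epsilon>_pos[OF n(1)] by (auto simp: collar_def)
      ultimately show ?thesis using *(3,4) E(4) collar_map_basin by simp
    qed
    finally show ?thesis .
  qed
  then show ?thesis using that g(1) by blast
qed

text \<open>The filling applied to a constant disk takes this constant as its boundary value, and
  all its values lie in \<open>W0\<close>.\<close>

lemma basin_subset_W0: "basin \<subseteq> W0"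
proof
  fix q assume "q \<in> basin"
  then have "u ` sphere 0 1 \<subseteq> basin" if "u = (\<lambda>_::complex. q)" for u using that by auto
  moreover have "q \<in> topspace X"
    using \<open>q \<in> basin\<close> openin_subset[OF openin_basin] by blast
  ultimately obtain g where g: "continuous_map (top_of_set (cball (0::complex) 1)) (subtopology X W0) g"
    "\<And>z. z \<in> sphere 0 1 \<Longrightarrow> g z = q"
    using basin_filling[of "\<lambda>_. q"] by auto
  have "g 1 \<in> W0" using g(1) by (auto simp: continuous_map_in_subtopology)
  then show "q \<in> W0" using g(2)[of 1] by simp
qed

end

lemma (in hawaiian_pants_gluing) one_UV0_at_qH:
  assumes y0: "y0 \<in> hawaiian_earring"
  shows "one_UV0_at X (qH y0)"
  unfolding one_UV0_at_def
proof (intro allI impI, elim conjE exE)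
  fix U W0 assume U: "U \<subseteq> topspace X" and W0: "openin X W0" "qH y0 \<in> W0" "W0 \<subseteq> U"
  obtain \<phi> W' where \<phi>: "continuous_on hawaiian_earring \<phi>"
    "\<phi> ` hawaiian_earring \<subseteq> {y \<in> hawaiian_earring. qH y \<in> W0}"
    "openin (top_of_set hawaiian_earring) W'" "y0 \<in> W'" "\<And>z. z \<in> W' \<Longrightarrow> \<phi> z = z"
    "\<And>m. m \<ge> 1 \<Longrightarrow> \<phi> ` hawaiian_circle m \<subseteq> hawaiian_circle m \<or> W' \<inter> hawaiian_circle m = {}"
    using hawaiian_earring_localize[OF y0 openin_X_H[OF W0(1)]] W0(2) y0 by blast
  have \<phi>_in: "\<phi> y \<in> hawaiian_earring" "qH (\<phi> y) \<in> W0" if "y \<in> hawaiian_earring" for y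
    using \<phi>(2) that by blast+
  \<comment> \<open>The lift of a folded circle is a compact set of rim points that are glued into
    \<open>W0\<close>, so one collar width serves the whole circle.\<close>
  have "\<exists>e>0. \<phi> ` hawaiian_circle (circle_index n k) \<subseteq> hawaiian_circle (circle_index n k) \<longrightarrow>
      (\<forall>y\<in>hawaiian_circle (circle_index n k). \<forall>s. 0 \<le> s \<and> s \<le> e \<longrightarrow>
        qP n (P.push n k s (lift n k (\<phi> y))) \<in> W0)" if nk: "n \<ge> 1" "k < 3" for n k
  proof (cases "\<phi> ` hawaiian_circle (circle_index n k) \<subseteq> hawaiian_circle (circle_index n k)")
    case True
    let ?C = "hawaiian_circle (circle_index n k)"
    have C: "?C \<subseteq> hawaiian_earring" using hawaiian_circle_subset circle_index_ge[OF nk(1)] by blast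
    have "continuous_on ?C (\<lambda>y. lift n k (\<phi> y))"
      using continuous_on_compose2[OF continuous_on_lift[OF nk] continuous_on_subset[OF \<phi>(1) C]] True
      by blast
    then have "compact ((\<lambda>y. lift n k (\<phi> y)) ` ?C)"
      by (rule compact_continuous_image) (simp add: hawaiian_circle_def)
    moreover have "(\<lambda>y. lift n k (\<phi> y)) ` ?C \<subseteq> P.rim n k" using lift_in[OF nk] True by blast
    moreover have "qP n b \<in> W0" if b: "b \<in> (\<lambda>y. lift n k (\<phi> y)) ` ?C" for b
    proof -
      obtain y where y: "y \<in> ?C" "b = lift n k (\<phi> y)" using b by blast
      then have "\<phi> y \<in> ?C" using True by blast
      then have "qP n b = qH (\<phi> y)"
        using y(2) qP_rim[OF nk lift_in[OF nk]] f_lift[OF nk] by simp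
      then show ?thesis using \<phi>_in(2) y(1) C by auto
    qed
    ultimately obtain e where "e > 0"
      "\<And>b s. b \<in> (\<lambda>y. lift n k (\<phi> y)) ` ?C \<Longrightarrow> 0 \<le> s \<Longrightarrow> s \<le> e \<Longrightarrow> qP n (P.push n k s b) \<in> W0"
      using thin_collar[OF nk W0(1)] by blast
    then show ?thesis by blast
  qed (auto intro: exI[of _ 1])
  then obtain e where e: "\<And>n k. n \<ge> 1 \<Longrightarrow> k < 3 \<Longrightarrow> e n k > 0"
    "\<And>n k y s. n \<ge> 1 \<Longrightarrow> k < 3 \<Longrightarrow>
      \<phi> ` hawaiian_circle (circle_index n k) \<subseteq> hawaiian_circle (circle_index n k) \<Longrightarrow>
      y \<in> hawaiian_circle (circle_index n k) \<Longrightarrow> 0 \<le> s \<Longrightarrow> s \<le> e n k \<Longrightarrow>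
      qP n (P.push n k s (lift n k (\<phi> y))) \<in> W0"
    by metis
  \<comment> \<open>The bound \<open>gap / 3\<close> gives the strict inequality
    \<open>2 * \<epsilon> n < gap\<close>, which separates the collars.\<close>
  define \<epsilon> where "\<epsilon> n = Min (insert (P.gap n / 3) (e n ` {..<3}))" for n
  have \<epsilon>: "\<epsilon> n \<le> P.gap n / 3" "k < 3 \<Longrightarrow> \<epsilon> n \<le> e n k" for n k
    unfolding \<epsilon>_def by (rule Min_le; simp)+
  have \<epsilon>_pos: "\<epsilon> n > 0" if "n \<ge> 1" for n
    unfolding \<epsilon>_def using e(1)[OF that] P.gap_pos[of n] by (subst Min_gr_iff) auto
  have "hawaiian_pants_retraction c \<rho> \<gamma> f X qH qP W0 W' \<phi> \<epsilon>"
  proof unfold_locales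
    show "2 * \<epsilon> n < P.gap n" if "n \<ge> 1" for n
      using \<epsilon>(1)[of n] P.gap_pos[of n] by linarith
    show "qP n (P.push n k s (lift n k (\<phi> y))) \<in> W0"
      if "n \<ge> 1" "k < 3" "\<phi> ` hawaiian_circle (circle_index n k) \<subseteq> hawaiian_circle (circle_index n k)"
        "y \<in> hawaiian_circle (circle_index n k)" "0 \<le> s" "s \<le> \<epsilon> n" for n k y s
      by (rule e(2)[OF that(1-5)]) (use that(6) \<epsilon>(2)[OF that(2), of n] in linarith)
  qed (use W0 \<phi> \<phi>_in \<epsilon>_pos in blast)+
  then interpret R: hawaiian_pants_retraction c \<rho> \<gamma> f X qH qP W0 W' \<phi> \<epsilon> .
  show "\<exists>V. openin X V \<and> qH y0 \<in> V \<and> V \<subseteq> U \<and>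
      (\<forall>f. continuous_map (top_of_set (cball (0::complex) 1)) X f \<and> f ` sphere 0 1 \<subseteq> V \<longrightarrow>
        (\<exists>g. continuous_map (top_of_set (cball 0 1)) (subtopology X U) g \<and> (\<forall>z\<in>sphere 0 1. f z = g z)))"
  proof (intro exI[of _ R.basin] conjI allI impI)
    show "openin X R.basin" by (rule R.openin_basin)
    show "qH y0 \<in> R.basin" using \<phi>(4) by (auto simp: R.basin_def)
    show "R.basin \<subseteq> U" using R.basin_subset_W0 W0(3) by blast
    fix u assume u: "continuous_map (top_of_set (cball (0::complex) 1)) X u \<and> u ` sphere 0 1 \<subseteq> R.basin"
    obtain g where g: "continuous_map (top_of_set (cball 0 1)) (subtopology X W0) g"
      "\<And>z. z \<in> sphere 0 1 \<Longrightarrow> g z = u z"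
      using R.basin_filling u by blast
    have "continuous_map (top_of_set (cball 0 1)) (subtopology X U) g"
      using g(1) W0(3) by (auto simp: continuous_map_in_subtopology)
    then show "\<exists>g. continuous_map (top_of_set (cball 0 1)) (subtopology X U) g \<and> (\<forall>z\<in>sphere 0 1. u z = g z)"
      using g(2) by (intro exI[of _ g]) auto
  qed
qed

lemma (in hawaiian_pants_gluing) one_UV0_glued: "one_UV0 X"
  unfolding one_UV0_def
proof
  fix q assume "q \<in> topspace X"
  then consider y where "y \<in> hawaiian_earring" "q = qH y"
    | n x where "n \<ge> 1" "x \<in> pants n" "q = qP n x"
    unfolding topspace_X by auto
  then show "one_UV0_at X q"
  proof cases
    case 1
    then show ?thesis using one_UV0_at_qH by simp
  next
    case 2
    show ?thesis
    proof (cases "x \<in> inner_pants n")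
      case True
      then show ?thesis using one_UV0_at_inner 2 by simp
    next
      case False
      then obtain k where k: "k < 3" "x \<in> P.rim n k"
        using 2(2) by (force simp: inner_pants_def P.core_def P.rim_depth)
      then have "f n x \<in> hawaiian_earring"
        using f_rim[OF 2(1) k] hawaiian_circle_subset circle_index_ge[OF 2(1)] by blast
      then show ?thesis using one_UV0_at_qH qP_rim[OF 2(1) k] 2(3) by simp
    qed
  qed
qed

section \<open>From the given disks and boundary parametrizations to the gluing data\<close>

lemma disjoint_cballs_dist:
  fixes x y :: "'a::real_normed_vector"
  assumes "0 < r" "0 < s" "cball x r \<inter> cball y s = {}"
  shows "r + s < dist x y"
proof (rule ccontr)
  assume "\<not> r + s < dist x y"
  then have le: "norm (y - x) \<le> r + s" by (simp add: dist_norm norm_minus_commute)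
  \<comment> \<open>This point divides the segment between the centres in the ratio
    \<open>r : s\<close>, so it lies in both balls if the centres are too close.\<close>
  define z where "z = x + (r / (r + s)) *\<^sub>R (y - x)"
  have "y - z = (s / (r + s)) *\<^sub>R (y - x)"
  proof -
    have "s / (r + s) = 1 - r / (r + s)" using assms(1,2) by (simp add: field_simps)
    then show ?thesis by (simp add: z_def scaleR_left_diff_distrib)
  qed
  then have "dist y z = s / (r + s) * norm (y - x)" using assms(1,2) by (simp add: dist_norm)
  also have "\<dots> \<le> s / (r + s) * (r + s)" by (intro mult_left_mono le) (use assms in auto)
  finally have "z \<in> cball y s" using assms(1,2) by simp
  have "dist x z = r / (r + s) * norm (y - x)" using assms(1,2) by (simp add: dist_norm z_def)
  also have "\<dots> \<le> r / (r + s) * (r + s)" by (intro mult_left_mono le) (use assms in auto)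
  finally have "z \<in> cball x r" using assms(1,2) by simp
  with \<open>z \<in> cball y s\<close> show False using assms(3) by blast
qed

theorem theorem7p3:
  fixes D D1 D2 P :: "nat \<Rightarrow> complex set"
    and \<alpha> \<beta> \<gamma> :: "nat \<Rightarrow> real \<Rightarrow> complex"
    and f :: "nat \<Rightarrow> complex \<Rightarrow> complex"
  assumes "\<And>n. n \<ge> 1 \<Longrightarrow> closed_disk (D n) \<and> closed_disk (D1 n) \<and> closed_disk (D2 n)"
    and "\<And>n. n \<ge> 1 \<Longrightarrow> D1 n \<subseteq> interior (D n) \<and> D2 n \<subseteq> interior (D n)"
    and "\<And>n. n \<ge> 1 \<Longrightarrow> D1 n \<inter> D2 n = {}"
    and "\<And>n. n \<ge> 1 \<Longrightarrow> P n = pair_of_pants (D n) (D1 n) (D2 n)"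
    and "\<And>n. n \<ge> 1 \<Longrightarrow> clockwise_boundary (D n) (\<alpha> n)"
    and "\<And>n. n \<ge> 1 \<Longrightarrow> clockwise_boundary (D1 n) (\<beta> n)"
    and "\<And>n. n \<ge> 1 \<Longrightarrow> clockwise_boundary (D2 n) (\<gamma> n)"
    and "\<And>n. n \<ge> 1 \<Longrightarrow>
           continuous_map (top_of_set (frontier (P n))) (top_of_set hawaiian_earring) (f n)"
    and "\<And>n t. n \<ge> 1 \<Longrightarrow> t \<in> {0..1} \<Longrightarrow> f n (\<alpha> n t) = hawaiian_loop n t"
    and "\<And>n t. n \<ge> 1 \<Longrightarrow> t \<in> {0..1} \<Longrightarrow> f n (\<beta> n t) = hawaiian_loop (2 * n) t"
    and "\<And>n t. n \<ge> 1 \<Longrightarrow> t \<in> {0..1} \<Longrightarrow> f n (\<gamma> n t) = hawaiian_loop (2 * n + 1) t"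
  shows "one_UV0 (hawaiian_pants P f)"
proof -
  define disk where "disk n k = (if k = 0 then D n else if k = 1 then D1 n else D2 n)" for n k :: nat
  define lp where "lp n k = (if k = 0 then \<alpha> n else if k = 1 then \<beta> n else \<gamma> n)" for n k :: nat
  have three: "k = 0 \<or> k = 1 \<or> k = 2" if "k < 3" for k :: nat using that by auto
  have "\<exists>c r. 0 < r \<and> disk n k = cball c r" if "n \<ge> 1" for n k
    using assms(1)[OF that] by (auto simp: disk_def closed_disk_def)
  then obtain c0 \<rho>0 where disk: "\<And>n k. n \<ge> 1 \<Longrightarrow> 0 < \<rho>0 n k \<and> disk n k = cball (c0 n k) (\<rho>0 n k)"
    by metis
  \<comment> \<open>The locale wants a pair of pants for \<open>n = 0\<close> as well; the data of
    the first one are used there.\<close>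
  define nn where "nn n = max 1 n" for n :: nat
  have nn: "nn n \<ge> 1" "n \<ge> 1 \<Longrightarrow> nn n = n" for n by (auto simp: nn_def)
  define c where "c n = c0 (nn n)" for n
  define \<rho> where "\<rho> n = \<rho>0 (nn n)" for n
  define lp' where "lp' n = lp (nn n)" for n
  have D: "D n = cball (c0 n 0) (\<rho>0 n 0)" "D1 n = cball (c0 n 1) (\<rho>0 n 1)" "D2 n = cball (c0 n 2) (\<rho>0 n 2)"
    and pos: "0 < \<rho>0 n k" if "n \<ge> 1" for n k
    using disk[OF that, of 0] disk[OF that, of 1] disk[OF that, of 2] disk[OF that, of k]
    by (simp_all add: disk_def)
  have rp: "round_pants (c n) (\<rho> n)" for n
  proof
    note m = nn(1)[of n]
    show "0 < \<rho> n k" for k using pos[OF m] by (simp add: \<rho>_def)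
    have sub: "cball (c n 1) (\<rho> n 1) \<subseteq> ball (c n 0) (\<rho> n 0)" "cball (c n 2) (\<rho> n 2) \<subseteq> ball (c n 0) (\<rho> n 0)"
      using assms(2)[OF m] unfolding D[OF m] interior_cball c_def \<rho>_def by auto
    show "dist (c n 0) (c n 1) + \<rho> n 1 < \<rho> n 0"
      using sub(1) pos[OF m, of 1] by (simp add: cball_subset_ball_iff \<rho>_def dist_commute)
    show "dist (c n 0) (c n 2) + \<rho> n 2 < \<rho> n 0"
      using sub(2) pos[OF m, of 2] by (simp add: cball_subset_ball_iff \<rho>_def dist_commute)
    have "cball (c n 1) (\<rho> n 1) \<inter> cball (c n 2) (\<rho> n 2) = {}"
      using assms(3)[OF m] unfolding D[OF m] c_def \<rho>_def .
    then show "\<rho> n 1 + \<rho> n 2 < dist (c n 1) (c n 2)"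
      by (rule disjoint_cballs_dist[rotated 2]) (use pos[OF m] in \<open>auto simp: \<rho>_def\<close>)
  qed
  have P: "P n = round_pants.core (c n) (\<rho> n) 0" if "n \<ge> 1" for n
    using round_pants.core0_eq[OF rp, of n] assms(4)[OF that] D[OF that] nn(2)[OF that]
    by (simp add: c_def \<rho>_def)
  have frontier_P: "frontier (P n) = (\<Union>k\<in>{..<3}. round_pants.rim (c n) (\<rho> n) k)" if "n \<ge> 1" for n
    using round_pants.frontier_core0[OF rp, of n] P[OF that] by simp
  let ?A = "SIGMA n:{1..}. frontier (P n)"
  let ?Y = "sum_topology (\<lambda>n. top_of_set (P n)) {1..}"
  have fH: "f n x \<in> hawaiian_earring" if "n \<ge> 1" "x \<in> frontier (P n)" for n x
    using assms(8)[OF that(1)] that(2) by (auto simp: continuous_map_def Pi_iff)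
  have closedP: "closed (P n)" if "n \<ge> 1" for n
    using P[OF that] round_pants.closed_core[OF rp] by simp
  have A: "?A \<subseteq> topspace ?Y"
  proof
    fix z assume "z \<in> ?A"
    then obtain n x where z: "z = (n, x)" "n \<ge> 1" "x \<in> frontier (P n)" by auto
    then have "x \<in> P n" using frontier_subset_closed[OF closedP] by blast
    then show "z \<in> topspace ?Y" using z by simp
  qed
  have fA: "(\<lambda>(n, z). f n z) ` ?A \<subseteq> topspace (top_of_set hawaiian_earring)" using fH by auto
  obtain qH qY where q: "\<And>x x'. qH x = qH x' \<longleftrightarrow> x = x'"
    "\<And>x y. qY y = qH x \<longleftrightarrow> y \<in> ?A \<and> x = (\<lambda>(n, z). f n z) y"
    "\<And>y y'. qY y = qY y' \<longleftrightarrow> y = y' \<or> y \<in> ?A \<and> y' \<in> ?A \<and> (\<lambda>(n, z). f n z) y = (\<lambda>(n, z). f n z) y'"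
    "topspace (hawaiian_pants P f) = qH ` topspace (top_of_set hawaiian_earring) \<union> qY ` topspace ?Y"
    "\<And>U. openin (hawaiian_pants P f) U \<longleftrightarrow> U \<subseteq> topspace (hawaiian_pants P f) \<and>
       openin (top_of_set hawaiian_earring) {x \<in> topspace (top_of_set hawaiian_earring). qH x \<in> U} \<and>
       openin ?Y {y \<in> topspace ?Y. qY y \<in> U}"
    by (rule adjunction_space_coordinates[OF A fA, folded hawaiian_pants_def], rule that)
  define qP where "qP n x = qY (n, x)" for n x
  have "hawaiian_pants_gluing c \<rho> lp' f (hawaiian_pants P f) qH qP"
  proof (rule hawaiian_pants_gluing.intro)
    fix n k :: nat
    show "round_pants (c n) (\<rho> n)" by (rule rp)
    show "round_pants.boundary_loop (c n) (\<rho> n) k (lp' n k)" if k: "k < 3"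
    proof -
      note m = nn(1)[of n]
      have "clockwise_boundary (disk (nn n) k) (lp (nn n) k)"
        using assms(5-7)[OF m] three[OF k] by (auto simp: disk_def lp_def)
      then show ?thesis
        using disk[OF m, of k] unfolding round_pants.boundary_loop_def[OF rp] round_pants.rim_def[OF rp]
        by (simp add: clockwise_boundary_def c_def \<rho>_def lp'_def)
    qed
    assume n: "n \<ge> 1"
    show "continuous_on (round_pants.rim (c n) (\<rho> n) k) (f n)" if "k < 3"
    proof -
      have "continuous_on (frontier (P n)) (f n)"
        using assms(8)[OF n] by (simp add: continuous_map_in_subtopology)
      then show ?thesis by (rule continuous_on_subset) (use that frontier_P[OF n] in auto)
    qed
    show "f n (lp' n k t) = hawaiian_loop (circle_index n k) t" if "k < 3" "t \<in> {0..1}" for t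
      using three[OF that(1)] assms(9-11)[OF n that(2)] nn(2)[OF n]
      by (auto simp: lp'_def lp_def circle_index_def)
    show "qP n x = qH (f n x)" if "k < 3" "x \<in> round_pants.rim (c n) (\<rho> n) k" for x
    proof -
      have "x \<in> frontier (P n)" using that frontier_P[OF n] by blast
      then show ?thesis using n by (simp add: qP_def q(2))
    qed
    show "\<exists>k<3. x \<in> round_pants.rim (c n) (\<rho> n) k" if "qP n x = qH y" for x y
    proof -
      have "x \<in> frontier (P n)" using that by (simp add: qP_def q(2))
      then show ?thesis using frontier_P[OF n] by blast
    qed
    show "n = n' \<and> x = x' \<or> (\<exists>k<3. x \<in> round_pants.rim (c n) (\<rho> n) k)"
      if "n' \<ge> 1" "qP n x = qP n' x'" for n' x x'
    proof -
      have "(n, x) = (n', x') \<or> x \<in> frontier (P n)" using that(2) unfolding qP_def q(3) by blast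
      then show ?thesis using frontier_P[OF n] by blast
    qed
  next
    have Y: "topspace ?Y = (SIGMA n:{1..}. round_pants.core (c n) (\<rho> n) 0)"
      using P by (auto simp: o_def)
    show top: "topspace (hawaiian_pants P f) = qH ` hawaiian_earring \<union>
      (\<Union>n\<in>{1..}. qP n ` round_pants.core (c n) (\<rho> n) 0)"
      unfolding q(4) Y by (auto simp: qP_def)
    fix U
    have "openin ?Y {y \<in> topspace ?Y. qY y \<in> U} \<longleftrightarrow>
      (\<forall>n\<ge>1. openin (top_of_set (round_pants.core (c n) (\<rho> n) 0))
         {x \<in> round_pants.core (c n) (\<rho> n) 0. qP n x \<in> U})"
      unfolding openin_sum_topology Y using P
      by (auto simp: qP_def o_def)
    then show "openin (hawaiian_pants P f) U \<longleftrightarrow> U \<subseteq> topspace (hawaiian_pants P f) \<and>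
      openin (top_of_set hawaiian_earring) {y \<in> hawaiian_earring. qH y \<in> U} \<and>
      (\<forall>n\<ge>1. openin (top_of_set (round_pants.core (c n) (\<rho> n) 0))
         {x \<in> round_pants.core (c n) (\<rho> n) 0. qP n x \<in> U})"
      by (subst q(5)) simp
  qed (rule q(1))
  then show ?thesis by (rule hawaiian_pants_gluing.one_UV0_glued)
qed

end
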